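(* With $\psi(M)$ denoting the weight of a connected closed $3$-manifold $M$: $\psi(\mathbb{RP}^3)=\psi(S^2\times S^1)=\psi(S^2\tilde\times S^1)=8$; $\psi(L(3,1))=12$; $\psi(L(5,q))=16$ for $1\le q\le 2$; $\psi(S^3/Q_8)=18$; and $\psi(S^1\times S^1\times S^1)=24$.
   Context: **Manifolds.** $S^2\tilde\times S^1$ is the non-orientable $S^2$-bundle over $S^1$. For relatively prime $p,q$, $L(p,q)=S^3/\mathbb Z_p$ is the lens space, where a generator of $\mathbb Z_p$ acts on $S^3=\{(z_1,z_2)\in\mathbb C^2:|z_1|^2+|z_2|^2=1\}$ by $(z_1,z_2)\mapsto(e^{2\pi i/p}z_1,e^{2\pi iq/p}z_2)$. $Q_8=\{\pm1,\pm i,\pm j,\pm k\}$ is the quaternion group and $S^3/Q_8$ is the quotient of the unit quaternions $S^3$ by multiplication by $Q_8$. **Weight of a group.** $F(S)$ is the free group on $S$; for $R\subseteq F(S)$, $N(R)$ is the smallest normal subgroup containing $R$ and $\langle S\mid R\rangle=F(S)/N(R)$. For a reduced word $w=x_1^{\varepsilon_1}\cdots x_m^{\varepsilon_m}$ ($x_i\in S$, $\varepsilon_i=\pm1$, $m\ge1$), let $\varepsilon(w)=0$ if $m=1$, and $\varepsilon(w)=|\varepsilon_1-\varepsilon_2|+\cdots+|\varepsilon_{m-1}-\varepsilon_m|+|\varepsilon_m-\varepsilon_1|$ if $m\ge2$. Define $\lambda$ on $F(S)$ inductively: $\lambda(\emptyset)=2$ for the empty word (identity); $\lambda(w)=2m-\tfrac12\varepsilon(w)$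 if $w=x_1^{\varepsilon_1}\cdots x_m^{\varepsilon_m}$ with $(x_m,\varepsilon_m)\ne(x_1,-\varepsilon_1)$; and $\lambda(w)=\lambda(w')$ if $w=x_1^{\varepsilon_1}w'x_1^{-\varepsilon_1}$ is reduced. For finite $R\subseteq F(S)$, let $\overline R=\{w\in N(R): N((R\setminus\{r\})\cup\{w\})=N(R)\text{ for each }r\in R\}$. For $S=\{x_1,\dots,x_s\}$ and $R=\{r_1,\dots,r_t\}\subseteq F(S)$ with $t\le s$, let $r_{t+1}$ be an element of $\overline R$ of minimum $\lambda$ (if $R=\emptyset$, $r_{t+1}$ is the empty word), and put $\varphi(S,R)=\lambda(r_1)+\cdots+\lambda(r_t)+\lambda(r_{t+1})+2(s-t)$. For a finitely presented group $G$ and an integer $q\ge0$, let $\mathcal P_q(G)$ be the set of presentations $\langle S\mid R\rangle\cong G$ with $\#R\le\#S\le q$. For a group $G$ having a finite presentation with at most as many relations as generators, put $\mu(G)=\min\{q:\mathcal P_q(G)\ne\emptyset\}$; $\psi(G;q)=\min\{\varphi(S,R):\langle S\mid R\rangle\in\mathcal P_q(G)\}$ for $q\ge\mu(G)$; $\rho(G)=\min\{q\ge\mu(G):\psi(G;q)\le 6(q+1)\}$; and the weight $\psi(G)=\max\{\psi(G;\rho(G)),\,6\mu(G)+2\}$. For a connected closed $3$-manifold $M$ (whose fundamental group always has such a presentation, by Epstein), $\psi(M):=\psi(\pi_1(M))$. *)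

theory Defs
  imports "HOL-Analysis.Analysis" "HOL-Algebra.Coset"
begin

section \<open>Free groups and presentations\<close>

text \<open>A letter \<open>(x, True)\<close> stands for \<open>x\<close> and \<open>(x, False)\<close> for the inverse of \<open>x\<close>.\<close>

type_synonym 'a letter = "'a \<times> bool"

definition inv_letter :: "'a letter \<Rightarrow> 'a letter" where
  "inv_letter a = (fst a, \<not> snd a)"

definition exponent :: "'a letter \<Rightarrow> int" where
  "exponent a = (if snd a then 1 else -1)"

definition reduced :: "'a letter list \<Rightarrow> bool" where
  "reduced w \<longleftrightarrow> successively (\<lambda>a b. b \<noteq> inv_letter a) w"

definition cancel_Cons :: "'a letter \<Rightarrow> 'a letter list \<Rightarrow> 'a letter list" where
  "cancel_Cons a w = (if w \<noteq> [] \<and> hd w = inv_letter a then tl w else a # w)"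

definition reduce :: "'a letter list \<Rightarrow> 'a letter list" where
  "reduce w = foldr cancel_Cons w []"

definition free_group :: "'a set \<Rightarrow> 'a letter list monoid" where
  "free_group S =
     \<lparr> carrier = {w. reduced w \<and> fst ` set w \<subseteq> S},
       monoid.mult = (\<lambda>u v. reduce (u @ v)),
       one = [] \<rparr>"

definition normal_closure :: "'a set \<Rightarrow> 'a letter list set \<Rightarrow> 'a letter list set" where
  "normal_closure S R = \<Inter>{H. H \<lhd> free_group S \<and> R \<subseteq> H}"

definition presented_group :: "'a set \<Rightarrow> 'a letter list set \<Rightarrow> 'a letter list set monoid" where
  "presented_group S R = free_group S Mod normal_closure S R"

section \<open>Weight of a group\<close>

definition eps :: "'a letter list \<Rightarrow> int" where
  "eps w =
     (if length w \<le> 1 then 0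
      else (\<Sum>i<length w. \<bar>exponent (w ! i) - exponent (w ! (Suc i mod length w))\<bar>))"

text \<open>
  The divisions below are exact: there is an even number of sign changes around a cyclic word and
  each contributes 2, so \<open>eps w\<close> is a multiple of 4. As \<open>eps w \<le> 2 * length w\<close>, nothing is
  truncated by \<open>nat\<close> either.
\<close>

fun lam :: "'a letter list \<Rightarrow> nat" where
  "lam [] = 2"
| "lam (a # v) =
     (if last (a # v) = inv_letter a then lam (butlast v)
      else nat (2 * int (length (a # v)) - eps (a # v) div 2))"

definition Rbar :: "'a set \<Rightarrow> 'a letter list set \<Rightarrow> 'a letter list set" where
  "Rbar S R =
     {w \<in> normal_closure S R.
        \<forall>r\<in>R. normal_closure S ((R - {r}) \<union> {w}) = normal_closure S R}"

definition phi :: "'a set \<Rightarrow> 'a letter list set \<Rightarrow> nat" where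
  "phi S R =
     (\<Sum>r\<in>R. lam r) + (LEAST n. \<exists>w\<in>Rbar S R. n = lam w) + 2 * (card S - card R)"

text \<open>Any finite set of generators may be renamed to a finite set of natural numbers.\<close>

definition presentations ::
    "('g, 'm) monoid_scheme \<Rightarrow> nat \<Rightarrow> (nat set \<times> nat letter list set) set" where
  "presentations G q =
     {(S, R). finite S \<and> finite R \<and> R \<subseteq> carrier (free_group S) \<and>
        card R \<le> card S \<and> card S \<le> q \<and> presented_group S R \<cong> G}"

definition mu :: "('g, 'm) monoid_scheme \<Rightarrow> nat" where
  "mu G = (LEAST q. presentations G q \<noteq> {})"

definition psi_at :: "('g, 'm) monoid_scheme \<Rightarrow> nat \<Rightarrow> nat" where
  "psi_at G q = (LEAST n. \<exists>(S, R) \<in> presentations G q. n = phi S R)"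

definition rho :: "('g, 'm) monoid_scheme \<Rightarrow> nat" where
  "rho G = (LEAST q. mu G \<le> q \<and> psi_at G q \<le> 6 * (q + 1))"

definition weight :: "('g, 'm) monoid_scheme \<Rightarrow> nat" where
  "weight G = max (psi_at G (rho G)) (6 * mu G + 2)"

section \<open>Fundamental group\<close>

definition loops_at :: "'a topology \<Rightarrow> 'a \<Rightarrow> (real \<Rightarrow> 'a) set" where
  "loops_at X x = {p. pathin X p \<and> p 0 = x \<and> p 1 = x}"

definition loop_homotopic :: "'a topology \<Rightarrow> 'a \<Rightarrow> (real \<Rightarrow> 'a) \<Rightarrow> (real \<Rightarrow> 'a) \<Rightarrow> bool" where
  "loop_homotopic X x p q \<longleftrightarrow>
     homotopic_with (\<lambda>r. r 0 = x \<and> r 1 = x) (top_of_set {0..1}) X p q"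

text \<open>
  The library's \<open>joinpaths\<close> needs a topological type class on the points, which orbits lack.
\<close>

definition loop_join :: "(real \<Rightarrow> 'a) \<Rightarrow> (real \<Rightarrow> 'a) \<Rightarrow> real \<Rightarrow> 'a" where
  "loop_join p q = (\<lambda>t. if t \<le> 1 / 2 then p (2 * t) else q (2 * t - 1))"

definition loop_class :: "'a topology \<Rightarrow> 'a \<Rightarrow> (real \<Rightarrow> 'a) \<Rightarrow> (real \<Rightarrow> 'a) set" where
  "loop_class X x p = {q \<in> loops_at X x. loop_homotopic X x p q}"

definition fundamental_group :: "'a topology \<Rightarrow> 'a \<Rightarrow> (real \<Rightarrow> 'a) set monoid" where
  "fundamental_group X x =
     \<lparr> carrier = loop_class X x ` loops_at X x,
       monoid.mult = (\<lambda>A B. \<Union>p\<in>A. \<Union>q\<in>B. loop_class X x (loop_join p q)),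
       one = loop_class X x (\<lambda>_. x) \<rparr>"

text \<open>
  For path-connected spaces, the isomorphism type of the fundamental group, and hence the weight,
  does not depend on the chosen base point.
\<close>

definition space_weight :: "'a topology \<Rightarrow> nat" where
  "space_weight X = weight (fundamental_group X (SOME x. x \<in> topspace X))"

section \<open>The manifolds\<close>

definition quotient_topology :: "'a topology \<Rightarrow> ('a \<Rightarrow> 'b) \<Rightarrow> 'b topology" where
  "quotient_topology X f =
     topology (\<lambda>U. U \<subseteq> f ` topspace X \<and> openin X {x \<in> topspace X. f x \<in> U})"

lemma openin_quotient_topology:
  "openin (quotient_topology X f) U \<longleftrightarrow>
     U \<subseteq> f ` topspace X \<and> openin X {x \<in> topspace X. f x \<in> U}"
proof -
  have "istopology (\<lambda>U. U \<subseteq> f ` topspace X \<and> openin X {x \<in> topspace X. f x \<in> U})"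
    unfolding istopology_def
  proof (intro conjI allI impI)
    fix A B
    assume "A \<subseteq> f ` topspace X \<and> openin X {x \<in> topspace X. f x \<in> A}"
      and "B \<subseteq> f ` topspace X \<and> openin X {x \<in> topspace X. f x \<in> B}"
    moreover have "{x \<in> topspace X. f x \<in> A \<inter> B} =
        {x \<in> topspace X. f x \<in> A} \<inter> {x \<in> topspace X. f x \<in> B}"
      by auto
    ultimately show "A \<inter> B \<subseteq> f ` topspace X" "openin X {x \<in> topspace X. f x \<in> A \<inter> B}"
      by (auto intro: openin_Int)
  next
    fix K
    assume K: "\<forall>A\<in>K. A \<subseteq> f ` topspace X \<and> openin X {x \<in> topspace X. f x \<in> A}"
    then show "\<Union>K \<subseteq> f ` topspace X"
      by blast
    have "{x \<in> topspace X. f x \<in> \<Union>K} = (\<Union>A\<in>K. {x \<in> topspace X. f x \<in> A})"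
      by auto
    with K show "openin X {x \<in> topspace X. f x \<in> \<Union>K}"
      by auto
  qed
  then show ?thesis
    by (simp add: quotient_topology_def)
qed

lemma topspace_quotient_topology [simp]:
  "topspace (quotient_topology X f) = f ` topspace X"
proof
  show "topspace (quotient_topology X f) \<subseteq> f ` topspace X"
    using openin_quotient_topology[of X f] openin_topspace by blast
  have "{x \<in> topspace X. f x \<in> f ` topspace X} = topspace X"
    by auto
  then have "openin (quotient_topology X f) (f ` topspace X)"
    by (simp add: openin_quotient_topology)
  then show "f ` topspace X \<subseteq> topspace (quotient_topology X f)"
    by (rule openin_subset)
qed

lemma quotient_map_quotient_topology: "quotient_map X (quotient_topology X f) f"
  by (auto simp: quotient_map_def openin_quotient_topology)

text \<open>Here \<open>\<Gamma>\<close> is meant to be a group of homeomorphisms of \<open>X\<close>; the points are the orbits.\<close>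

definition orbit_space :: "'a topology \<Rightarrow> ('a \<Rightarrow> 'a) set \<Rightarrow> 'a set topology" where
  "orbit_space X \<Gamma> = quotient_topology X (\<lambda>x. (\<lambda>g. g x) ` \<Gamma>)"

definition S1 :: "complex topology" where
  "S1 = top_of_set (sphere 0 1)"

definition S2 :: "(real ^ 3) topology" where
  "S2 = top_of_set (sphere 0 1)"

definition S3 :: "(complex \<times> complex) topology" where
  "S3 = top_of_set {(z1, z2). (cmod z1)\<^sup>2 + (cmod z2)\<^sup>2 = 1}"

definition RP3 :: "(complex \<times> complex) set topology" where
  "RP3 = orbit_space S3 {\<lambda>z. z, \<lambda>z. - z}"

definition lens_rotation :: "nat \<Rightarrow> nat \<Rightarrow> complex \<times> complex \<Rightarrow> complex \<times> complex" where
  "lens_rotation p q =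
     (\<lambda>(z1, z2). (cis (2 * pi / real p) * z1, cis (2 * pi * real q / real p) * z2))"

text \<open>The rotation has finite order \<open>p > 0\<close>, so its iterates form the cyclic group it generates.\<close>

definition lens_space :: "nat \<Rightarrow> nat \<Rightarrow> (complex \<times> complex) set topology" where
  "lens_space p q = orbit_space S3 (range (\<lambda>k::nat. lens_rotation p q ^^ k))"

text \<open>
  A pair \<open>(a, b)\<close> of complex numbers stands for the quaternion \<open>a + b j\<close>; the product follows from
  \<open>j c = cnj c j\<close> and \<open>j\<^sup>2 = -1\<close>. In this model \<open>i\<close>, \<open>j\<close>, \<open>k\<close> are \<open>(\<i>, 0)\<close>, \<open>(0, 1)\<close>, \<open>(0, \<i>)\<close>,
  and the unit quaternions are the points of \<open>S3\<close>.
\<close>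

definition quat_mult :: "complex \<times> complex \<Rightarrow> complex \<times> complex \<Rightarrow> complex \<times> complex" where
  "quat_mult = (\<lambda>(a, b) (c, d). (a * c - b * cnj d, a * d + b * cnj c))"

definition Q8 :: "(complex \<times> complex) set" where
  "Q8 = {(1, 0), (-1, 0), (\<i>, 0), (-\<i>, 0), (0, 1), (0, -1), (0, \<i>), (0, -\<i>)}"

definition S3_mod_Q8 :: "(complex \<times> complex) set topology" where
  "S3_mod_Q8 = orbit_space S3 (quat_mult ` Q8)"

text \<open>
  The non-orientable \<open>S2\<close>-bundle over the circle is the mapping torus of the antipodal map, which
  reverses the orientation of \<open>S2\<close>: the quotient of \<open>S2 \<times> \<real>\<close> by the infinite cyclic group
  generated by \<open>(x, t) \<mapsto> (- x, t + 1)\<close>.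
\<close>

definition S2_twisted_S1 :: "((real ^ 3) \<times> real) set topology" where
  "S2_twisted_S1 =
     orbit_space (prod_topology S2 euclideanreal)
       (range (\<lambda>k::int. \<lambda>(x, t). (if even k then x else - x, t + real_of_int k)))"

end

theory Submission
  imports Defs "HOL-Algebra.Elementary_Groups" "HOL-Computational_Algebra.Primes"
begin

text \<open>
  The weight of a space depends only on the isomorphism type of its fundamental group, so the claim
  splits into a topological and a combinatorial part.

  Topology. Each of the manifolds is the base of a regular covering by a simply connected space:
  \<open>S3\<close> for the spherical ones, \<open>S2 \<times> \<real>\<close> for the two sphere bundles, \<open>\<real>\<^sup>3\<close> for the torus. A loop lifts
  to a path that ends at the image of its starting point under a unique deck transformation. Homotopic loops have the
  same deck transformation, because homotopies lift; loops with the same deck transformation are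
  homotopic, because their lifts are; and joining loops composes the transformations. So the fundamental group
  is the deck group (\<open>deck_group_iso_fundamental_group\<close>): \<open>\<int>/2\<close>, \<open>\<int>\<close>, \<open>\<int>\<close>, \<open>\<int>/3\<close>, \<open>\<int>/5\<close>, the quaternion group
  and \<open>\<int>\<^sup>3\<close>.

  Combinatorics. Upper bounds come from explicit presentations. To see which group they present, normal
  forms are multiplied by generators (\<open>markingI_normal_form\<close>); a relator that may replace each of the others is
  found by rewriting in an arbitrary group (\<open>RbarI\<close>).

  Lower bounds rest on one estimate: after cyclic reduction a word with \<open>m\<close> letters and exponent sum \<open>e\<close> has
  \<open>lam \<ge> m + \<bar>e\<bar>\<close> (\<open>lam_core_ge\<close>), since there are at most twice as
  many sign changes as positive letters, and as negative letters.
  It bounds \<open>lam\<close> from below by twice the absolute value of any sum of exponent sums, and it leaves a short list of words with \<open>lam < 6\<close>.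

  \<^item> For \<open>\<int>/n\<close> on one generator the relators have nonzero exponent sums divisible by \<open>n\<close>, so \<open>psi_at\<close> is at least \<open>4n\<close>.
    For \<open>n = 2, 3\<close> this is compatible with the bound in the definition of \<open>rho\<close>; for \<open>n = 5\<close> it is too big, and two
    generators have to be considered. There any two of the three relators have exponent sums with a determinant
    that is a nonzero multiple of five, while the determinant is at most the product of the halved lengths
    (\<open>det_le_lam\<close>). Hence the lengths add up to at least \<open>16\<close>.

  \<^item> For the infinite cyclic group the term \<open>6 * mu + 2 = 8\<close> dominates.

  \<^item> For the quaternion group no nonempty word with \<open>lam < 6\<close> is trivial in anticommuting
    square roots of \<open>-1\<close>, and for \<open>\<int>\<^sup>3\<close> no such word has exponent sums zero. So each relator counts
    at least \<open>6\<close>, and it remains to see that two or three nonempty relators are needed besides the extra one. For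
    the quaternion group this follows from the exponent sums. For \<open>\<int>\<^sup>3\<close>, where these vanish, it follows from the
    crossing numbers, which are the coordinates of the commutator subgroup modulo triple commutators.
\<close>

section \<open>Free groups\<close>

lemma inv_letter_inv_letter [simp]: "inv_letter (inv_letter a) = a"
  by (simp add: inv_letter_def)

lemma fst_inv_letter [simp]: "fst (inv_letter a) = fst a"
  and snd_inv_letter [simp]: "snd (inv_letter a) = (\<not> snd a)"
  by (simp_all add: inv_letter_def)

lemma inv_letter_neq [simp]: "inv_letter a \<noteq> a" "a \<noteq> inv_letter a"
  by (auto simp: inv_letter_def prod_eq_iff)

lemma reduced_Nil [simp]: "reduced []"
  by (simp add: reduced_def)

lemma reduced_Cons: "reduced (a # w) \<longleftrightarrow> reduced w \<and> (w \<noteq> [] \<longrightarrow> hd w \<noteq> inv_letter a)"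
  by (cases w) (auto simp: reduced_def)

lemma reduced_append:
  "reduced (u @ v) \<longleftrightarrow> reduced u \<and> reduced v \<and> (u \<noteq> [] \<and> v \<noteq> [] \<longrightarrow> hd v \<noteq> inv_letter (last u))"
  by (auto simp: reduced_def successively_append_iff)

lemma reduced_cancel_Cons: "reduced w \<Longrightarrow> reduced (cancel_Cons a w)"
  by (cases w) (auto simp: cancel_Cons_def reduced_Cons)

lemma reduced_foldr_cancel: "reduced w \<Longrightarrow> reduced (foldr cancel_Cons u w)"
  by (induction u) (auto simp: reduced_cancel_Cons)

lemma reduced_reduce [simp]: "reduced (reduce w)"
  by (simp add: reduce_def reduced_foldr_cancel)

lemma reduce_Nil [simp]: "reduce [] = []"
  by (simp add: reduce_def)

lemma reduce_Cons: "reduce (a # w) = cancel_Cons a (reduce w)"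
  by (simp add: reduce_def)

lemma reduce_reduced: "reduced w \<Longrightarrow> reduce w = w"
  by (induction w) (auto simp: reduce_Cons reduced_Cons cancel_Cons_def)

lemma reduce_append: "reduce (u @ v) = foldr cancel_Cons u (reduce v)"
  by (simp add: reduce_def)

text \<open>
  Cancelling from the left lets letters act on reduced words, and inverse letters act inversely. So
  a word acts like its reduced form (\<open>foldr_cancel_reduce\<close>), which makes the product of reduced words associative.
\<close>

lemma cancel_Cons_inv_letter:
  assumes "reduced w"
  shows "cancel_Cons (inv_letter a) (cancel_Cons a w) = w"
proof (cases "w \<noteq> [] \<and> hd w = inv_letter a")
  case True
  then obtain v where w: "w = inv_letter a # v"
    by (metis list.collapse)
  with assms have "v \<noteq> [] \<longrightarrow> hd v \<noteq> a"
    by (auto simp: reduced_Cons)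
  then show ?thesis
    by (auto simp: w cancel_Cons_def)
next
  case False
  then show ?thesis
    by (auto simp: cancel_Cons_def)
qed

lemma foldr_cancel_Cons:
  assumes "reduced w"
  shows "foldr cancel_Cons (cancel_Cons a u) w = cancel_Cons a (foldr cancel_Cons u w)"
proof (cases "u \<noteq> [] \<and> hd u = inv_letter a")
  case True
  then obtain v where u: "u = inv_letter a # v"
    by (metis list.collapse)
  show ?thesis
    using cancel_Cons_inv_letter[OF reduced_foldr_cancel[OF assms], of "inv_letter a" v]
    by (simp add: u cancel_Cons_def)
next
  case False
  then show ?thesis
    by (auto simp: cancel_Cons_def)
qed

lemma foldr_cancel_reduce:
  "reduced w \<Longrightarrow> foldr cancel_Cons (reduce u) w = foldr cancel_Cons u w"
  by (induction u) (auto simp: reduce_Cons foldr_cancel_Cons)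

lemma reduce_append_reduce_left: "reduce (reduce u @ v) = reduce (u @ v)"
  by (simp add: reduce_append foldr_cancel_reduce)

lemma reduce_append_reduce_right: "reduce (u @ reduce v) = reduce (u @ v)"
  by (simp add: reduce_append reduce_reduced)

definition word_inv :: "'a letter list \<Rightarrow> 'a letter list" where
  "word_inv w = rev (map inv_letter w)"

lemma word_inv_simps [simp]:
  "word_inv [] = []" "word_inv (a # w) = word_inv w @ [inv_letter a]"
  "word_inv (u @ v) = word_inv v @ word_inv u"
  by (simp_all add: word_inv_def)

lemma fst_set_word_inv [simp]: "fst ` set (word_inv w) = fst ` set w"
  by (auto simp: word_inv_def image_image)

lemma reduce_word_inv: "reduce (word_inv w @ w) = []"
proof (induction w)
  case (Cons a w)
  have "reduce (word_inv (a # w) @ a # w) =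
      foldr cancel_Cons (word_inv w) (cancel_Cons (inv_letter a) (cancel_Cons a (reduce w)))"
    by (simp add: reduce_append reduce_Cons)
  also have "\<dots> = reduce (word_inv w @ w)"
    by (simp add: cancel_Cons_inv_letter reduce_append)
  finally show ?case
    using Cons.IH by simp
qed simp

lemma set_cancel_Cons: "set (cancel_Cons a w) \<subseteq> insert a (set w)"
  by (auto simp: cancel_Cons_def dest: list.set_sel(2))

lemma set_reduce: "set (reduce w) \<subseteq> set w"
proof (induction w)
  case (Cons a w)
  then show ?case
    using set_cancel_Cons[of a "reduce w"] by (auto simp: reduce_Cons)
qed simp

lemma fst_set_reduce: "fst ` set w \<subseteq> S \<Longrightarrow> fst ` set (reduce w) \<subseteq> S"
  using set_reduce[of w] by (meson image_mono subset_trans)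

lemma carrier_free_group: "carrier (free_group S) = {w. reduced w \<and> fst ` set w \<subseteq> S}"
  and mult_free_group: "u \<otimes>\<^bsub>free_group S\<^esub> v = reduce (u @ v)"
  and one_free_group: "\<one>\<^bsub>free_group S\<^esub> = []"
  by (simp_all add: free_group_def)

lemma reduce_in_free_group: "fst ` set w \<subseteq> S \<Longrightarrow> reduce w \<in> carrier (free_group S)"
  using fst_set_reduce[of w S] by (simp add: carrier_free_group)

lemma group_free_group: "group (free_group S)"
proof (rule groupI)
  fix u v w
  assume uvw: "u \<in> carrier (free_group S)" "v \<in> carrier (free_group S)" "w \<in> carrier (free_group S)"
  show "u \<otimes>\<^bsub>free_group S\<^esub> v \<in> carrier (free_group S)"
    unfolding mult_free_group using uvw
    by (intro reduce_in_free_group) (auto simp: carrier_free_group)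
  show "u \<otimes>\<^bsub>free_group S\<^esub> v \<otimes>\<^bsub>free_group S\<^esub> w = u \<otimes>\<^bsub>free_group S\<^esub> (v \<otimes>\<^bsub>free_group S\<^esub> w)"
    by (simp add: mult_free_group reduce_append_reduce_left reduce_append_reduce_right)
next
  fix u
  assume u: "u \<in> carrier (free_group S)"
  show "\<exists>v\<in>carrier (free_group S). v \<otimes>\<^bsub>free_group S\<^esub> u = \<one>\<^bsub>free_group S\<^esub>"
  proof
    show "reduce (word_inv u) \<in> carrier (free_group S)"
      using u by (intro reduce_in_free_group) (auto simp: carrier_free_group)
    show "reduce (word_inv u) \<otimes>\<^bsub>free_group S\<^esub> u = \<one>\<^bsub>free_group S\<^esub>"
      by (simp add: mult_free_group one_free_group reduce_append_reduce_left reduce_word_inv)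
  qed
qed (auto simp: carrier_free_group mult_free_group one_free_group reduce_reduced)

lemma inv_free_group:
  assumes "w \<in> carrier (free_group S)"
  shows "inv\<^bsub>free_group S\<^esub> w = reduce (word_inv w)"
proof (rule group.inv_equality[OF group_free_group])
  show "reduce (word_inv w) \<in> carrier (free_group S)"
    using assms by (intro reduce_in_free_group) (auto simp: carrier_free_group)
qed (use assms in \<open>auto simp: mult_free_group one_free_group reduce_append_reduce_left reduce_word_inv\<close>)

definition letter_val :: "('h, 'm) monoid_scheme \<Rightarrow> ('a \<Rightarrow> 'h) \<Rightarrow> 'a letter \<Rightarrow> 'h" where
  "letter_val H f a = (if snd a then f (fst a) else inv\<^bsub>H\<^esub> f (fst a))"

definition word_val :: "('h, 'm) monoid_scheme \<Rightarrow> ('a \<Rightarrow> 'h) \<Rightarrow> 'a letter list \<Rightarrow> 'h" where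
  "word_val H f w = foldr (\<lambda>a h. letter_val H f a \<otimes>\<^bsub>H\<^esub> h) w \<one>\<^bsub>H\<^esub>"

lemma word_val_Nil [simp]: "word_val H f [] = \<one>\<^bsub>H\<^esub>"
  and word_val_Cons [simp]: "word_val H f (a # w) = letter_val H f a \<otimes>\<^bsub>H\<^esub> word_val H f w"
  by (simp_all add: word_val_def)

context group
begin

lemma letter_val_closed: "f \<in> S \<rightarrow> carrier G \<Longrightarrow> fst a \<in> S \<Longrightarrow> letter_val G f a \<in> carrier G"
  by (auto simp: letter_val_def)

lemma word_val_closed: "f \<in> S \<rightarrow> carrier G \<Longrightarrow> fst ` set w \<subseteq> S \<Longrightarrow> word_val G f w \<in> carrier G"
  using letter_val_closed[of f S] by (induction w) auto

lemma letter_val_inv_letter: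
  "f \<in> S \<rightarrow> carrier G \<Longrightarrow> fst a \<in> S \<Longrightarrow> letter_val G f (inv_letter a) = inv (letter_val G f a)"
  by (auto simp: letter_val_def Pi_iff)

lemma word_val_append:
  assumes "f \<in> S \<rightarrow> carrier G" "fst ` set u \<subseteq> S" "fst ` set v \<subseteq> S"
  shows "word_val G f (u @ v) = word_val G f u \<otimes> word_val G f v"
  using assms(2)
proof (induction u)
  case Nil
  then show ?case
    using word_val_closed[OF assms(1,3)] by simp
next
  case (Cons a u)
  then have "letter_val G f a \<in> carrier G" "word_val G f u \<in> carrier G"
    using letter_val_closed[OF assms(1)] word_val_closed[OF assms(1)] by auto
  then show ?case
    using Cons word_val_closed[OF assms(1,3)] by (simp add: m_assoc)
qed

lemma word_val_cancel_Cons: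
  assumes f: "f \<in> S \<rightarrow> carrier G" and a: "fst a \<in> S" and w: "fst ` set w \<subseteq> S"
  shows "word_val G f (cancel_Cons a w) = letter_val G f a \<otimes> word_val G f w"
proof (cases "w \<noteq> [] \<and> hd w = inv_letter a")
  case True
  then obtain v where v: "w = inv_letter a # v"
    by (metis list.collapse)
  have "word_val G f v \<in> carrier G" "letter_val G f a \<in> carrier G"
    using w f a word_val_closed[OF f, of v] letter_val_closed[OF f] by (auto simp: v)
  then show ?thesis
    by (simp add: v cancel_Cons_def letter_val_inv_letter[OF f a] m_assoc[symmetric])
qed (auto simp: cancel_Cons_def)

lemma word_val_reduce:
  assumes f: "f \<in> S \<rightarrow> carrier G" and "fst ` set w \<subseteq> S"
  shows "word_val G f (reduce w) = word_val G f w"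
  using assms(2)
proof (induction w)
  case (Cons a w)
  then have "fst a \<in> S" "fst ` set (reduce w) \<subseteq> S"
    using fst_set_reduce[of w S] by auto
  from word_val_cancel_Cons[OF f this] Cons show ?case
    by (simp add: reduce_Cons)
qed simp

lemma word_val_hom:
  assumes "f \<in> S \<rightarrow> carrier G"
  shows "word_val G f \<in> hom (free_group S) G"
proof (rule homI)
  fix u v
  assume "u \<in> carrier (free_group S)" "v \<in> carrier (free_group S)"
  then have uv: "fst ` set u \<subseteq> S" "fst ` set v \<subseteq> S"
    by (auto simp: carrier_free_group)
  then show "word_val G f u \<in> carrier G"
    using word_val_closed assms by blast
  have "fst ` set (u @ v) \<subseteq> S"
    using uv by (simp add: image_Un)
  from word_val_reduce[OF assms this] word_val_append[OF assms uv]
  show "word_val G f (u \<otimes>\<^bsub>free_group S\<^esub> v) = word_val G f u \<otimes> word_val G f v"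
    by (simp only: mult_free_group)
qed

lemma group_hom_word_val:
  assumes "f \<in> S \<rightarrow> carrier G"
  shows "group_hom (free_group S) G (word_val G f)"
  using word_val_hom[OF assms] group_free_group is_group
  by (simp add: group_hom_def group_hom_axioms_def)

end

lemma letter_in_free_group: "s \<in> S \<Longrightarrow> [(s, b)] \<in> carrier (free_group S)"
  by (auto simp: carrier_free_group reduced_Cons)

lemma inv_letter_free_group: "s \<in> S \<Longrightarrow> inv\<^bsub>free_group S\<^esub> [(s, True)] = [(s, False)]"
  by (simp add: inv_free_group letter_in_free_group inv_letter_def reduce_Cons cancel_Cons_def)

text \<open>
  A reduced word is the product of its first letter and the rest, and homomorphisms respect inverses. So an
  isomorphism from a presented group amounts to a choice of images of the generators.
\<close>

lemma hom_free_group_eq_word_val: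
  assumes H: "group H" and h: "h \<in> hom (free_group S) H" and w: "w \<in> carrier (free_group S)"
  shows "h w = word_val H (\<lambda>s. h [(s, True)]) w"
proof -
  interpret h: group_hom "free_group S" H h
    using assms group_free_group by (simp add: group_hom_def group_hom_axioms_def)
  show ?thesis
    using w
  proof (induction w)
    case Nil
    show ?case
      using h.hom_one by (simp add: one_free_group)
  next
    case (Cons a w)
    then have w: "w \<in> carrier (free_group S)" and a: "fst a \<in> S"
      by (auto simp: carrier_free_group reduced_Cons)
    obtain s b where sb: "a = (s, b)"
      by (cases a)
    have "[a] \<otimes>\<^bsub>free_group S\<^esub> w = a # w"
      using Cons.prems by (simp add: mult_free_group carrier_free_group reduce_reduced)
    then have "h (a # w) = h [a] \<otimes>\<^bsub>H\<^esub> h w"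
      using h.hom_mult[of "[a]" w] w a by (simp add: sb letter_in_free_group)
    moreover have "h [a] = letter_val H (\<lambda>s. h [(s, True)]) a"
      using a inv_letter_free_group[of s S] h.hom_inv[of "[(s, True)]"]
      by (auto simp: sb letter_val_def letter_in_free_group)
    ultimately show ?case
      using Cons.IH[OF w] by simp
  qed
qed

section \<open>Presentations\<close>

lemma normal_closure_subset: "R \<subseteq> normal_closure S R"
  by (auto simp: normal_closure_def)

lemma normal_closure_least: "H \<lhd> free_group S \<Longrightarrow> R \<subseteq> H \<Longrightarrow> normal_closure S R \<subseteq> H"
  by (auto simp: normal_closure_def)

lemma (in group) normal_carrier: "carrier G \<lhd> G"
  by (simp add: normal_inv_iff subgroup_self)

lemma normal_normal_closure:
  assumes "R \<subseteq> carrier (free_group S)"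
  shows "normal_closure S R \<lhd> free_group S"
proof -
  interpret group "free_group S"
    by (rule group_free_group)
  let ?A = "{H. H \<lhd> free_group S \<and> R \<subseteq> H}"
  have ne: "?A \<noteq> {}"
    using group.normal_carrier[OF group_free_group] assms by blast
  show ?thesis
    unfolding normal_closure_def
  proof (rule normal_invI)
    show "subgroup (\<Inter>?A) (free_group S)"
      using ne by (intro subgroups_Inter) (auto simp: normal_imp_subgroup)
    show "x \<otimes>\<^bsub>free_group S\<^esub> h \<otimes>\<^bsub>free_group S\<^esub> inv\<^bsub>free_group S\<^esub> x \<in> \<Inter>?A"
      if "x \<in> carrier (free_group S)" "h \<in> \<Inter>?A" for x h
      using that by (auto intro: normal.inv_op_closed2)
  qed
qed

lemma normal_closure_carrier:
  "R \<subseteq> carrier (free_group S) \<Longrightarrow> normal_closure S R \<subseteq> carrier (free_group S)"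
  using group.normal_carrier[OF group_free_group] normal_closure_least by blast

lemma normal_closure_mono:
  "R \<subseteq> normal_closure S R' \<Longrightarrow> R' \<subseteq> carrier (free_group S) \<Longrightarrow>
    normal_closure S R \<subseteq> normal_closure S R'"
  by (intro normal_closure_least normal_normal_closure)

text \<open>
  The quotient by the normal closure is a group in which the relators hold and in which only the elements of
  the normal closure become trivial. So membership in a normal closure turns into equational reasoning in an
  arbitrary group.
\<close>

lemma in_normal_closureI:
  fixes S :: "'a set"
  assumes R: "R \<subseteq> carrier (free_group S)" and w: "w \<in> carrier (free_group S)"
    and cons: "\<And>(Q :: 'a letter list set monoid) g. \<lbrakk>group Q; g \<in> S \<rightarrow> carrier Q;
      \<And>r. r \<in> R \<Longrightarrow> word_val Q g r = \<one>\<^bsub>Q\<^esub>\<rbrakk> \<Longrightarrow> word_val Q g w = \<one>\<^bsub>Q\<^esub>"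
  shows "w \<in> normal_closure S R"
proof -
  let ?N = "normal_closure S R" and ?Q = "presented_group S R"
  interpret N: normal ?N "free_group S"
    using normal_normal_closure[OF R] .
  have Q: "group ?Q"
    unfolding presented_group_def by (rule N.factorgroup_is_group)
  define h where "h = (\<lambda>w. ?N #>\<^bsub>free_group S\<^esub> w)"
  have h: "h \<in> hom (free_group S) ?Q"
    unfolding h_def presented_group_def by (rule N.r_coset_hom_Mod)
  have ker: "h v = \<one>\<^bsub>?Q\<^esub> \<longleftrightarrow> v \<in> ?N" if "v \<in> carrier (free_group S)" for v
    using that N.coset_join1[of ?N v] N.coset_join2[of v ?N] N.subgroup_axioms
    unfolding h_def presented_group_def one_FactGroup by blast
  have val: "word_val ?Q (\<lambda>s. h [(s, True)]) v = h v" if "v \<in> carrier (free_group S)" for v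
    using hom_free_group_eq_word_val[OF Q h that] by simp
  have "word_val ?Q (\<lambda>s. h [(s, True)]) w = \<one>\<^bsub>?Q\<^esub>"
  proof (rule cons[OF Q])
    show "(\<lambda>s. h [(s, True)]) \<in> S \<rightarrow> carrier ?Q"
      using h by (auto simp: hom_def letter_in_free_group)
    show "word_val ?Q (\<lambda>s. h [(s, True)]) r = \<one>\<^bsub>?Q\<^esub>" if "r \<in> R" for r
      using that R val[of r] ker[of r] normal_closure_subset[of R S] by auto
  qed
  then show ?thesis
    using val[OF w] ker[OF w] by simp
qed

text \<open>
  A marking of \<open>H\<close> by the presentation with generators \<open>S\<close> and relators \<open>R\<close>: a choice of images of
  the generators that identifies the presented group with \<open>H\<close>.
\<close>

definition marking :: "('h, 'm) monoid_scheme \<Rightarrow> 'a set \<Rightarrow> 'a letter list set \<Rightarrow> ('a \<Rightarrow> 'h) \<Rightarrow> bool" where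
  "marking H S R f \<longleftrightarrow>
     f \<in> S \<rightarrow> carrier H \<and> word_val H f ` carrier (free_group S) = carrier H \<and>
     normal_closure S R = {w \<in> carrier (free_group S). word_val H f w = \<one>\<^bsub>H\<^esub>}"

lemma markingD:
  assumes "marking H S R f"
  shows "f \<in> S \<rightarrow> carrier H"
    and "h \<in> carrier H \<Longrightarrow> \<exists>w\<in>carrier (free_group S). h = word_val H f w"
    and "w \<in> carrier (free_group S) \<Longrightarrow> w \<in> normal_closure S R \<longleftrightarrow> word_val H f w = \<one>\<^bsub>H\<^esub>"
  using assms by (auto simp: marking_def)

lemma presented_group_iso_imp_marking:
  assumes H: "group H" and R: "R \<subseteq> carrier (free_group S)" and iso: "presented_group S R \<cong> H"
  obtains f where "marking H S R f"
proof -
  let ?F = "free_group S" and ?N = "normal_closure S R" and ?Q = "presented_group S R"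
  interpret N: normal ?N ?F
    using normal_normal_closure[OF R] .
  have Q: "group ?Q"
    unfolding presented_group_def by (rule N.factorgroup_is_group)
  obtain i where i: "i \<in> iso ?Q H"
    using iso by (auto simp: is_iso_def)
  define h where "h = i \<circ> (\<lambda>w. ?N #>\<^bsub>?F\<^esub> w)"
  have c: "(\<lambda>w. ?N #>\<^bsub>?F\<^esub> w) \<in> hom ?F ?Q"
    unfolding presented_group_def by (rule N.r_coset_hom_Mod)
  have h: "h \<in> hom ?F H"
    unfolding h_def using c i by (auto intro: hom_compose simp: iso_def)
  define f where "f = (\<lambda>s. h [(s, True)])"
  have f: "f \<in> S \<rightarrow> carrier H"
    using h by (auto simp: f_def hom_def letter_in_free_group)
  have val: "word_val H f w = h w" if "w \<in> carrier ?F" for w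
    using hom_free_group_eq_word_val[OF H h that] by (simp add: f_def)
  have "h ` carrier ?F = carrier H"
  proof -
    have "(\<lambda>w. ?N #>\<^bsub>?F\<^esub> w) ` carrier ?F = carrier ?Q"
      by (auto simp: presented_group_def FactGroup_def RCOSETS_def)
    moreover have "i ` carrier ?Q = carrier H"
      using i by (simp add: iso_iff)
    ultimately show ?thesis
      unfolding h_def image_comp[symmetric] by simp
  qed
  then have surj: "word_val H f ` carrier ?F = carrier H"
    using val by (simp cong: image_cong)
  have ker: "w \<in> ?N \<longleftrightarrow> word_val H f w = \<one>\<^bsub>H\<^esub>" if w: "w \<in> carrier ?F" for w
  proof -
    have "?N #>\<^bsub>?F\<^esub> w \<in> carrier ?Q"
      using c w by (auto simp: hom_def)
    moreover have "i \<one>\<^bsub>?Q\<^esub> = \<one>\<^bsub>H\<^esub>"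
      using hom_one[of i ?Q H] i Q H by (auto simp: iso_def)
    moreover have "inj_on i (carrier ?Q)"
      using i by (simp add: iso_iff)
    moreover have "\<one>\<^bsub>?Q\<^esub> \<in> carrier ?Q"
      using Q group.is_monoid monoid.one_closed by blast
    ultimately have "h w = \<one>\<^bsub>H\<^esub> \<longleftrightarrow> ?N #>\<^bsub>?F\<^esub> w = \<one>\<^bsub>?Q\<^esub>"
      by (metis comp_apply h_def inj_onD)
    also have "\<dots> \<longleftrightarrow> w \<in> ?N"
      using w N.coset_join1[of ?N w] N.coset_join2[of w ?N] N.subgroup_axioms
      unfolding presented_group_def one_FactGroup by blast
    finally show ?thesis
      using val[OF w] by simp
  qed
  have "marking H S R f"
    unfolding marking_def using f surj ker normal_closure_carrier[OF R] by blast
  then show thesis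
    by (rule that)
qed

lemma marking_imp_presented_group_iso:
  assumes H: "group H" and f: "marking H S R f"
  shows "presented_group S R \<cong> H"
proof -
  have "group_hom (free_group S) H (word_val H f)"
    using group.group_hom_word_val[OF H markingD(1)[OF f]] .
  moreover have "word_val H f ` carrier (free_group S) = carrier H"
    using f by (simp add: marking_def)
  ultimately have "free_group S Mod kernel (free_group S) H (word_val H f) \<cong> H"
    by (rule group_hom.FactGroup_iso)
  moreover have "kernel (free_group S) H (word_val H f) = normal_closure S R"
    using f by (simp add: marking_def kernel_def)
  ultimately show ?thesis
    by (simp add: presented_group_def)
qed

text \<open>
  By induction on a word, \<open>nf\<close> maps its value in \<open>H\<close> to its value in any group in which the relators
  hold. So a word with trivial value in \<open>H\<close> is a consequence of the relators.
\<close>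

lemma markingI_normal_form:
  fixes S :: "'a set" and nf :: "'a letter list set monoid \<Rightarrow> ('a \<Rightarrow> 'a letter list set) \<Rightarrow> 'h \<Rightarrow> 'a letter list set"
  assumes H: "group H" and f: "f \<in> S \<rightarrow> carrier H" and R: "R \<subseteq> carrier (free_group S)"
    and rel: "\<And>r. r \<in> R \<Longrightarrow> word_val H f r = \<one>\<^bsub>H\<^esub>"
    and surj: "\<And>h. h \<in> carrier H \<Longrightarrow> \<exists>w. fst ` set w \<subseteq> S \<and> h = word_val H f w"
    and nf_one: "\<And>Q g. \<lbrakk>group Q; g \<in> S \<rightarrow> carrier Q; \<And>r. r \<in> R \<Longrightarrow> word_val Q g r = \<one>\<^bsub>Q\<^esub>\<rbrakk>
      \<Longrightarrow> nf Q g \<one>\<^bsub>H\<^esub> = \<one>\<^bsub>Q\<^esub>"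
    and nf: "\<And>Q g s h. \<lbrakk>group Q; g \<in> S \<rightarrow> carrier Q; \<And>r. r \<in> R \<Longrightarrow> word_val Q g r = \<one>\<^bsub>Q\<^esub>;
        s \<in> S; h \<in> carrier H\<rbrakk>
      \<Longrightarrow> nf Q g h \<in> carrier Q \<and> g s \<otimes>\<^bsub>Q\<^esub> nf Q g h = nf Q g (f s \<otimes>\<^bsub>H\<^esub> h)"
  shows "marking H S R f"
proof -
  interpret H: group H by (rule H)
  let ?F = "free_group S"
  have "kernel ?F H (word_val H f) \<lhd> ?F"
    using H.group_hom_word_val[OF f] by (rule group_hom.normal_kernel)
  then have 1: "normal_closure S R \<subseteq> kernel ?F H (word_val H f)"
    using R rel by (intro normal_closure_least) (auto simp: kernel_def)
  have 2: "w \<in> normal_closure S R" if w: "w \<in> carrier ?F" and val: "word_val H f w = \<one>\<^bsub>H\<^esub>" for w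
  proof (rule in_normal_closureI[OF R w])
    fix Q :: "'a letter list set monoid" and g
    assume Q: "group Q" and g: "g \<in> S \<rightarrow> carrier Q"
      and rels: "\<And>r. r \<in> R \<Longrightarrow> word_val Q g r = \<one>\<^bsub>Q\<^esub>"
    interpret Q: group Q by (rule Q)
    have n1: "nf Q g \<one>\<^bsub>H\<^esub> = \<one>\<^bsub>Q\<^esub>"
      by (rule nf_one[OF Q g rels])
    have n2: "nf Q g h \<in> carrier Q" "g s \<otimes>\<^bsub>Q\<^esub> nf Q g h = nf Q g (f s \<otimes>\<^bsub>H\<^esub> h)"
      if "s \<in> S" "h \<in> carrier H" for s h
      using nf[OF Q g rels that] by auto
    have "word_val Q g u = nf Q g (word_val H f u)" if "fst ` set u \<subseteq> S" for u
      using that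
    proof (induction u)
      case Nil
      then show ?case
        using n1 by simp
    next
      case (Cons a u)
      obtain s b where a: "a = (s, b)"
        by (cases a)
      have s: "s \<in> S" and u: "fst ` set u \<subseteq> S"
        using Cons.prems by (auto simp: a)
      have fs: "f s \<in> carrier H" and gs: "g s \<in> carrier Q" and hu: "word_val H f u \<in> carrier H"
        using s f g H.word_val_closed[OF f u] by auto
      show ?case
      proof (cases b)
        case True
        then show ?thesis
          using n2[OF s hu] Cons.IH[OF u] by (simp add: a letter_val_def)
      next
        case False
        let ?k = "inv\<^bsub>H\<^esub> f s \<otimes>\<^bsub>H\<^esub> word_val H f u"
        have k: "?k \<in> carrier H" "f s \<otimes>\<^bsub>H\<^esub> ?k = word_val H f u"
          using fs hu by (simp_all add: H.m_assoc[symmetric])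
        have "nf Q g ?k \<in> carrier Q" "g s \<otimes>\<^bsub>Q\<^esub> nf Q g ?k = word_val Q g u"
          using n2[OF s k(1)] k(2) Cons.IH[OF u] by auto
        then have "inv\<^bsub>Q\<^esub> g s \<otimes>\<^bsub>Q\<^esub> word_val Q g u = nf Q g ?k"
          using gs Q.inv_solve_left' Q.word_val_closed[OF g u] by metis
        then show ?thesis
          using False by (simp add: a letter_val_def)
      qed
    qed
    then show "word_val Q g w = \<one>\<^bsub>Q\<^esub>"
      using w val n1 by (simp add: carrier_free_group)
  qed
  have "word_val H f ` carrier ?F = carrier H"
  proof
    show "word_val H f ` carrier ?F \<subseteq> carrier H"
      using H.word_val_closed[OF f] by (auto simp: carrier_free_group)
    show "carrier H \<subseteq> word_val H f ` carrier ?F"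
    proof
      fix h
      assume "h \<in> carrier H"
      then obtain w where "fst ` set w \<subseteq> S" "h = word_val H f w"
        using surj by blast
      then show "h \<in> word_val H f ` carrier ?F"
        using H.word_val_reduce[OF f] reduce_in_free_group[of w S] by (metis image_eqI)
    qed
  qed
  moreover have "normal_closure S R = {w \<in> carrier ?F. word_val H f w = \<one>\<^bsub>H\<^esub>}"
    using 1 2 normal_closure_carrier[OF R] by (auto simp: kernel_def)
  ultimately show ?thesis
    using f by (simp add: marking_def)
qed

lemma normal_closure_eqI:
  fixes S :: "'a set"
  assumes R: "R \<subseteq> carrier (free_group S)" and R': "R' \<subseteq> carrier (free_group S)"
    and "\<And>(Q :: 'a letter list set monoid) g. \<lbrakk>group Q; g \<in> S \<rightarrow> carrier Q\<rbrakk> \<Longrightarrow>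
      (\<forall>r\<in>R. word_val Q g r = \<one>\<^bsub>Q\<^esub>) \<longleftrightarrow> (\<forall>r\<in>R'. word_val Q g r = \<one>\<^bsub>Q\<^esub>)"
  shows "normal_closure S R = normal_closure S R'"
proof
  have "r \<in> normal_closure S R'" if "r \<in> R" for r
    using that R assms(3) by (intro in_normal_closureI[OF R']) blast+
  then show "normal_closure S R \<subseteq> normal_closure S R'"
    by (intro normal_closure_mono R') blast
  have "r \<in> normal_closure S R" if "r \<in> R'" for r
    using that R' assms(3) by (intro in_normal_closureI[OF R]) blast+
  then show "normal_closure S R' \<subseteq> normal_closure S R"
    by (intro normal_closure_mono R) blast
qed

section \<open>The element completing a presentation\<close>

lemma Rbar_carrier: "R \<subseteq> carrier (free_group S) \<Longrightarrow> w \<in> Rbar S R \<Longrightarrow> w \<in> carrier (free_group S)"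
  using normal_closure_carrier by (auto simp: Rbar_def)

lemma marking_exchange:
  assumes "marking H S R f" "w \<in> Rbar S R" "r \<in> R"
  shows "marking H S (insert w (R - {r})) f"
  using assms by (auto simp: Rbar_def marking_def)

text \<open>
  By \<open>in_normal_closureI\<close>, the conditions on normal closures in the definition of \<open>Rbar\<close> are implications
  between equations in an arbitrary group.
\<close>

lemma RbarI:
  fixes S :: "'a set"
  assumes R: "R \<subseteq> carrier (free_group S)" and w: "w \<in> carrier (free_group S)"
    and consequence: "\<And>(Q :: 'a letter list set monoid) g. \<lbrakk>group Q; g \<in> S \<rightarrow> carrier Q;
      \<forall>r\<in>R. word_val Q g r = \<one>\<^bsub>Q\<^esub>\<rbrakk> \<Longrightarrow> word_val Q g w = \<one>\<^bsub>Q\<^esub>"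
    and exchange: "\<And>(Q :: 'a letter list set monoid) g r. \<lbrakk>group Q; g \<in> S \<rightarrow> carrier Q; r \<in> R;
      \<forall>s\<in>R - {r}. word_val Q g s = \<one>\<^bsub>Q\<^esub>; word_val Q g w = \<one>\<^bsub>Q\<^esub>\<rbrakk> \<Longrightarrow> word_val Q g r = \<one>\<^bsub>Q\<^esub>"
  shows "w \<in> Rbar S R"
proof -
  have "w \<in> normal_closure S R"
    by (rule in_normal_closureI[OF R w]) (use consequence in blast)
  moreover have "normal_closure S (R - {r} \<union> {w}) = normal_closure S R" if r: "r \<in> R" for r
  proof (rule normal_closure_eqI[OF _ R])
    show "R - {r} \<union> {w} \<subseteq> carrier (free_group S)"
      using R w by auto
    show "(\<forall>s\<in>R - {r} \<union> {w}. word_val Q g s = \<one>\<^bsub>Q\<^esub>) \<longleftrightarrow> (\<forall>s\<in>R. word_val Q g s = \<one>\<^bsub>Q\<^esub>)"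
      if Q: "group Q" "g \<in> S \<rightarrow> carrier Q" for Q :: "'a letter list set monoid" and g
      using consequence[OF Q] exchange[OF Q r] by blast
  qed
  ultimately show ?thesis
    unfolding Rbar_def by blast
qed

text \<open>
  The minimum in the definition of \<open>phi\<close> ranges over a nonempty set, because the product of all
  relators can replace any one of them.
\<close>

lemma Rbar_nonempty:
  assumes "finite R" and R: "R \<subseteq> carrier (free_group S)"
  shows "Rbar S R \<noteq> {}"
proof -
  obtain rs where rs: "set rs = R" "distinct rs"
    using finite_distinct_list[OF \<open>finite R\<close>] by blast
  have fst: "fst ` set r \<subseteq> S" if "r \<in> R" for r
    using R that by (auto simp: carrier_free_group)
  have letters: "fst ` set (concat rs') \<subseteq> S" if "set rs' \<subseteq> R" for rs'
    using fst that by fastforce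
  have one: "word_val Q g (concat rs') = \<one>\<^bsub>Q\<^esub>"
    if Q: "group Q" and g: "g \<in> S \<rightarrow> carrier Q" and sub: "set rs' \<subseteq> R"
      and rels: "\<And>r. r \<in> set rs' \<Longrightarrow> word_val Q g r = \<one>\<^bsub>Q\<^esub>"
    for Q :: "'a letter list set monoid" and g rs'
    using sub rels
  proof (induction rs')
    case (Cons r rs')
    then have r: "fst ` set r \<subseteq> S" and rs': "fst ` set (concat rs') \<subseteq> S"
      using fst letters[of rs'] by auto
    have "word_val Q g (concat (r # rs')) = word_val Q g r \<otimes>\<^bsub>Q\<^esub> word_val Q g (concat rs')"
      using group.word_val_append[OF Q g r rs'] by simp
    also have "\<dots> = \<one>\<^bsub>Q\<^esub> \<otimes>\<^bsub>Q\<^esub> \<one>\<^bsub>Q\<^esub>"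
      using Cons by simp
    finally show ?case
      using group.is_monoid[OF Q] monoid.l_one monoid.one_closed by metis
  qed simp
  have "reduce (concat rs) \<in> Rbar S R"
  proof (rule RbarI[OF R])
    show "reduce (concat rs) \<in> carrier (free_group S)"
      by (intro reduce_in_free_group letters) (simp add: rs)
    fix Q :: "'a letter list set monoid" and g
    assume Q: "group Q" and g: "g \<in> S \<rightarrow> carrier Q"
    interpret Q: group Q by (rule Q)
    have red: "word_val Q g (reduce (concat rs)) = word_val Q g (concat rs)"
      using Q.word_val_reduce[OF g letters[OF eq_refl[OF rs(1)]]] .
    show "word_val Q g (reduce (concat rs)) = \<one>\<^bsub>Q\<^esub>" if "\<forall>r\<in>R. word_val Q g r = \<one>\<^bsub>Q\<^esub>"
      unfolding red using that rs(1) by (intro one[OF Q g]) auto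
    fix r
    assume r: "r \<in> R" and others: "\<forall>s\<in>R - {r}. word_val Q g s = \<one>\<^bsub>Q\<^esub>"
      and w: "word_val Q g (reduce (concat rs)) = \<one>\<^bsub>Q\<^esub>"
    obtain us vs where split: "rs = us @ r # vs"
      using r rs(1) split_list[of r rs] by auto
    have uv: "set us \<subseteq> R" "set vs \<subseteq> R" "r \<notin> set us" "r \<notin> set vs"
      using split rs by auto
    note lu = letters[OF uv(1)] and lv = letters[OF uv(2)] and lr = fst[OF r]
    have rv: "fst ` set (r @ concat vs) \<subseteq> S"
      using lr lv by (simp add: image_Un)
    have "word_val Q g (concat us) = \<one>\<^bsub>Q\<^esub>" "word_val Q g (concat vs) = \<one>\<^bsub>Q\<^esub>"
      using uv others by (auto intro!: one[OF Q g])
    moreover have "word_val Q g (concat rs) =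
        word_val Q g (concat us) \<otimes>\<^bsub>Q\<^esub> (word_val Q g r \<otimes>\<^bsub>Q\<^esub> word_val Q g (concat vs))"
      by (simp only: split concat_append concat.simps Q.word_val_append[OF g lu rv]
          Q.word_val_append[OF g lr lv])
    ultimately show "word_val Q g r = \<one>\<^bsub>Q\<^esub>"
      using w red Q.word_val_closed[OF g lr] by simp
  qed
  then show ?thesis
    by blast
qed

lemma phi_attained:
  assumes "finite R" "R \<subseteq> carrier (free_group S)"
  obtains w where "w \<in> Rbar S R" "phi S R = (\<Sum>r\<in>R. lam r) + lam w + 2 * (card S - card R)"
proof -
  let ?P = "\<lambda>n. \<exists>w\<in>Rbar S R. n = lam w"
  have "\<exists>n. ?P n"
    using Rbar_nonempty[OF assms] by blast
  then have "?P (LEAST n. ?P n)"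
    by (rule LeastI_ex)
  then show thesis
    using that by (auto simp: phi_def)
qed

lemma phi_le:
  assumes "w \<in> Rbar S R"
  shows "phi S R \<le> (\<Sum>r\<in>R. lam r) + lam w + 2 * (card S - card R)"
  unfolding phi_def by (simp, rule Least_le, use assms in blast)

text \<open>
  Exchanging relators gives presentations of the same group, so a bound for the relators of all of them also
  bounds the additional one.
\<close>

lemma phi_ge:
  assumes m: "marking H S R f" and R: "finite R" "R \<noteq> {}" "R \<subseteq> carrier (free_group S)"
    and lam: "\<And>R' r. \<lbrakk>marking H S R' f; finite R'; card R' \<le> card R; R' \<subseteq> carrier (free_group S); r \<in> R'\<rbrakk>
      \<Longrightarrow> c \<le> lam r"
  shows "c * (card R + 1) \<le> phi S R"
proof -
  obtain w where w: "w \<in> Rbar S R" "phi S R = (\<Sum>r\<in>R. lam r) + lam w + 2 * (card S - card R)"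
    using phi_attained[OF R(1,3)] by blast
  obtain r where r: "r \<in> R"
    using R(2) by blast
  have "c \<le> lam w"
  proof (rule lam[OF marking_exchange[OF m w(1) r]])
    show "card (insert w (R - {r})) \<le> card R"
      using R(1) r card_Suc_Diff1[OF R(1) r] by (simp add: card_insert_if)
    show "insert w (R - {r}) \<subseteq> carrier (free_group S)"
      using R(3) Rbar_carrier[OF R(3) w(1)] by blast
  qed (use R(1) in auto)
  moreover have "card R * c \<le> (\<Sum>r\<in>R. lam r)"
    using sum_bounded_below[of R c lam] lam[OF m R(1) _ R(3)] by simp
  ultimately show ?thesis
    using w(2) by (simp add: mult.commute)
qed

section \<open>Weight as an invariant\<close>

lemma presentations_iff:
  assumes "group H"
  shows "(S, R) \<in> presentations H q \<longleftrightarrow>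
    finite S \<and> finite R \<and> R \<subseteq> carrier (free_group S) \<and> card R \<le> card S \<and> card S \<le> q \<and>
    (\<exists>f. marking H S R f)"
proof -
  have "presented_group S R \<cong> H \<longleftrightarrow> (\<exists>f. marking H S R f)" if "R \<subseteq> carrier (free_group S)"
    using presented_group_iso_imp_marking[OF assms that] marking_imp_presented_group_iso[OF assms]
    by metis
  then show ?thesis
    by (auto simp: presentations_def)
qed

lemma weight_cong:
  assumes H: "group H" and iso: "H \<cong> G"
  shows "weight G = weight H"
proof -
  have "presented_group S R \<cong> G \<longleftrightarrow> presented_group S R \<cong> H"
    if "R \<subseteq> carrier (free_group S)" for S and R :: "nat letter list set"
  proof -
    have "G \<cong> H"
      using iso group.iso_sym[OF H] by blast
    then show ?thesis
      using iso_trans[OF _ iso, of "presented_group S R"] iso_trans[of "presented_group S R" G H] by blast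
  qed
  then have "presentations G = presentations H"
    by (auto simp: presentations_def fun_eq_iff)
  then show ?thesis
    by (simp add: weight_def rho_def psi_at_def mu_def)
qed

lemma psi_at_le: "(S, R) \<in> presentations H q \<Longrightarrow> psi_at H q \<le> phi S R"
  unfolding psi_at_def by (rule Least_le, rule bexI[of _ "(S, R)"]) simp_all

lemma psi_at_ge:
  assumes "presentations H q \<noteq> {}" "\<And>S R. (S, R) \<in> presentations H q \<Longrightarrow> n \<le> phi S R"
  shows "n \<le> psi_at H q"
proof -
  let ?P = "\<lambda>n. \<exists>(S, R) \<in> presentations H q. n = phi S R"
  obtain S R where "(S, R) \<in> presentations H q"
    using assms(1) by fastforce
  then have "?P (phi S R)"
    by (intro bexI[of _ "(S, R)"]) simp_all
  then have "?P (psi_at H q)"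
    unfolding psi_at_def by (rule LeastI)
  then obtain S R where "(S, R) \<in> presentations H q" "psi_at H q = phi S R"
    by (elim bexE) (simp split: prod.splits)
  then show ?thesis
    using assms(2) by simp
qed

lemma mu_eqI:
  assumes "presentations H q \<noteq> {}" "\<And>p. p < q \<Longrightarrow> presentations H p = {}"
  shows "mu H = q"
  unfolding mu_def using assms by (intro Least_equality) (auto simp: not_less[symmetric])

lemma weight_eqI:
  assumes "mu H = m" "m \<le> q" "psi_at H q \<le> 6 * (q + 1)"
    "\<And>p. m \<le> p \<Longrightarrow> p < q \<Longrightarrow> 6 * (p + 1) < psi_at H p"
  shows "weight H = max (psi_at H q) (6 * m + 2)"
proof -
  have "rho H = q"
    unfolding rho_def using assms by (intro Least_equality) (auto simp: not_le[symmetric])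
  then show ?thesis
    using assms(1) by (simp add: weight_def)
qed

text \<open>
  When the least number \<open>n\<close> of generators already satisfies the inequality that defines \<open>rho\<close>, both \<open>mu\<close> and \<open>rho\<close> are
  \<open>n\<close>, so no presentation with more generators has to be considered.
\<close>

lemma weight_of_optimal_presentation:
  assumes P: "(S\<^sub>0, R\<^sub>0) \<in> presentations H n" and c: "phi S\<^sub>0 R\<^sub>0 \<le> c" "c \<le> 6 * (n + 1)"
    and lower: "\<And>S R q. \<lbrakk>(S, R) \<in> presentations H q; q \<le> n\<rbrakk> \<Longrightarrow> card S = n \<and> c \<le> phi S R"
  shows "weight H = max c (6 * n + 2)"
proof -
  have ne: "presentations H n \<noteq> {}"
    using P by blast
  have "c \<le> psi_at H n"
    using lower by (intro psi_at_ge[OF ne]) blast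
  then have psi: "psi_at H n = c"
    using psi_at_le[OF P] c(1) by linarith
  have "mu H = n"
  proof (rule mu_eqI[OF ne])
    fix p
    assume p: "p < n"
    show "presentations H p = {}"
    proof (rule ccontr)
      assume "presentations H p \<noteq> {}"
      then obtain S R where SR: "(S, R) \<in> presentations H p"
        by fastforce
      then have "card S \<le> p"
        by (simp add: presentations_def)
      then show False
        using lower[OF SR] p by linarith
    qed
  qed
  then show ?thesis
    using weight_eqI[of H n n] psi c(2) by simp
qed

section \<open>Exponent sums\<close>

definition expsum :: "'a \<Rightarrow> 'a letter list \<Rightarrow> int" where
  "expsum x w = (\<Sum>a\<leftarrow>w. if fst a = x then exponent a else 0)"

lemma expsum_simps [simp]:
  "expsum x [] = 0"
  "expsum x (a # w) = (if fst a = x then exponent a else 0) + expsum x w"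
  "expsum x (u @ v) = expsum x u + expsum x v"
  by (simp_all add: expsum_def)

lemma exponent_inv_letter [simp]: "exponent (inv_letter a) = - exponent a"
  by (simp add: exponent_def)

lemma exponent_Pair [simp]: "exponent (x, True) = 1" "exponent (x, False) = -1"
  by (simp_all add: exponent_def)

lemma expsum_word_inv [simp]: "expsum x (word_inv w) = - expsum x w"
  by (induction w) auto

lemma expsum_cancel_Cons: "expsum x (cancel_Cons a w) = expsum x (a # w)"
proof (cases "w \<noteq> [] \<and> hd w = inv_letter a")
  case True
  then obtain v where "w = inv_letter a # v"
    by (metis list.collapse)
  then show ?thesis
    by (simp add: cancel_Cons_def)
qed (auto simp: cancel_Cons_def)

lemma expsum_reduce [simp]: "expsum x (reduce w) = expsum x w"
  by (induction w) (simp_all add: reduce_Cons expsum_cancel_Cons)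

lemma expsum_eq_0: "x \<notin> fst ` set w \<Longrightarrow> expsum x w = 0"
  by (induction w) auto

text \<open>
  The elements of \<open>K\<close> with such coefficients form a normal subgroup that contains \<open>R\<close>. Exponent sums are
  invariants of this kind on the whole free group; crossing numbers become additive only on words with exponent sums zero,
  hence the subgroup \<open>K\<close>.
\<close>

lemma normal_closure_combination:
  fixes q :: "'i \<Rightarrow> 'a letter list \<Rightarrow> int"
  assumes "finite R" and RK: "R \<subseteq> K" and K: "K \<lhd> free_group S"
    and add: "\<And>i u v. u \<in> K \<Longrightarrow> v \<in> K \<Longrightarrow> q i (u \<otimes>\<^bsub>free_group S\<^esub> v) = q i u + q i v"
    and conj: "\<And>i x u. x \<in> carrier (free_group S) \<Longrightarrow> u \<in> K \<Longrightarrow>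
      q i (x \<otimes>\<^bsub>free_group S\<^esub> u \<otimes>\<^bsub>free_group S\<^esub> inv\<^bsub>free_group S\<^esub> x) = q i u"
    and w: "w \<in> normal_closure S R"
  shows "\<exists>c. \<forall>i. q i w = (\<Sum>r\<in>R. c r * q i r)"
proof -
  let ?F = "free_group S"
  interpret F: group ?F by (rule group_free_group)
  interpret K: normal K ?F by (rule K)
  let ?H = "{w \<in> K. \<exists>c. \<forall>i. q i w = (\<Sum>r\<in>R. c r * q i r)}"
  have one: "q i \<one>\<^bsub>?F\<^esub> = 0" for i
    using add[of "\<one>\<^bsub>?F\<^esub>" "\<one>\<^bsub>?F\<^esub>" i] K.one_closed by simp
  have inv: "q i (inv\<^bsub>?F\<^esub> u) = - q i u" if "u \<in> K" for i u
  proof -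
    have "u \<in> carrier ?F"
      using that K.subset by blast
    then show ?thesis
      using add[of "inv\<^bsub>?F\<^esub> u" u i] one[of i] that K.m_inv_closed[OF that] F.l_inv by simp
  qed
  have sub: "subgroup ?H ?F"
  proof (rule F.subgroupI)
    show "?H \<subseteq> carrier ?F"
      using K.subset by blast
    have "\<forall>i. q i \<one>\<^bsub>?F\<^esub> = (\<Sum>r\<in>R. 0 * q i r)"
      using one by simp
    then show "?H \<noteq> {}"
      using K.one_closed by fast
  next
    fix u
    assume "u \<in> ?H"
    then obtain c where u: "u \<in> K" "\<forall>i. q i u = (\<Sum>r\<in>R. c r * q i r)"
      by fast
    then have "\<forall>i. q i (inv\<^bsub>?F\<^esub> u) = (\<Sum>r\<in>R. (- c r) * q i r)"
      using inv by (simp add: sum_negf)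
    then show "inv\<^bsub>?F\<^esub> u \<in> ?H"
      using K.m_inv_closed[OF u(1)] by fast
  next
    fix u v
    assume "u \<in> ?H" "v \<in> ?H"
    then obtain c d where u: "u \<in> K" "\<forall>i. q i u = (\<Sum>r\<in>R. c r * q i r)"
      and v: "v \<in> K" "\<forall>i. q i v = (\<Sum>r\<in>R. d r * q i r)"
      by fast
    then have "\<forall>i. q i (u \<otimes>\<^bsub>?F\<^esub> v) = (\<Sum>r\<in>R. (c r + d r) * q i r)"
      using add by (simp add: distrib_right sum.distrib)
    then show "u \<otimes>\<^bsub>?F\<^esub> v \<in> ?H"
      using K.m_closed[OF u(1) v(1)] by fast
  qed
  have "?H \<lhd> ?F"
  proof (rule F.normal_invI[OF sub])
    fix x u
    assume x: "x \<in> carrier ?F" and "u \<in> ?H"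
    then obtain c where u: "u \<in> K" "\<forall>i. q i u = (\<Sum>r\<in>R. c r * q i r)"
      by fast
    have "x \<otimes>\<^bsub>?F\<^esub> u \<otimes>\<^bsub>?F\<^esub> inv\<^bsub>?F\<^esub> x \<in> K"
      using K.inv_op_closed2[OF x u(1)] .
    moreover have "\<forall>i. q i (x \<otimes>\<^bsub>?F\<^esub> u \<otimes>\<^bsub>?F\<^esub> inv\<^bsub>?F\<^esub> x) = (\<Sum>r\<in>R. c r * q i r)"
      using conj[OF x u(1)] u(2) by simp
    ultimately show "x \<otimes>\<^bsub>?F\<^esub> u \<otimes>\<^bsub>?F\<^esub> inv\<^bsub>?F\<^esub> x \<in> ?H"
      by fast
  qed
  moreover have "R \<subseteq> ?H"
  proof
    fix r
    assume r: "r \<in> R"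
    have "\<forall>i. q i r = (\<Sum>s\<in>R. (if s = r then 1 else 0) * q i s)"
    proof
      fix i
      have "(\<Sum>s\<in>R. (if s = r then 1 else 0) * q i s) = (\<Sum>s\<in>R. if s = r then q i s else 0)"
        by (intro sum.cong) auto
      then show "q i r = (\<Sum>s\<in>R. (if s = r then 1 else 0) * q i s)"
        using r \<open>finite R\<close> by simp
    qed
    then show "r \<in> ?H"
      using r RK by fast
  qed
  ultimately have "normal_closure S R \<subseteq> ?H"
    by (rule normal_closure_least)
  then show ?thesis
    using w by fast
qed

lemma expsum_conj:
  assumes "x \<in> carrier (free_group S)"
  shows "expsum y (x \<otimes>\<^bsub>free_group S\<^esub> u \<otimes>\<^bsub>free_group S\<^esub> inv\<^bsub>free_group S\<^esub> x) = expsum y u"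
  using assms by (simp add: inv_free_group mult_free_group)

lemma normal_closure_expsum:
  assumes "finite R" "R \<subseteq> carrier (free_group S)" "w \<in> normal_closure S R"
  shows "\<exists>c. \<forall>x. expsum x w = (\<Sum>r\<in>R. c r * expsum x r)"
  by (rule normal_closure_combination[OF assms(1,2) group.normal_carrier[OF group_free_group] _ _ assms(3)])
    (simp add: mult_free_group, rule expsum_conj)

section \<open>Lower bounds for the length\<close>

text \<open>
  Unfolding the recursive clause of \<open>lam\<close> strips a word down to a cyclically reduced conjugate.
\<close>

lemma cyclic_core:
  assumes "reduced w" "w \<noteq> []"
  shows "\<exists>u c. w = u @ c @ word_inv u \<and> c \<noteq> [] \<and> reduced c \<and> last c \<noteq> inv_letter (hd c) \<and>
    lam w = nat (2 * int (length c) - eps c div 2)"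
  using assms
proof (induction w rule: lam.induct)
  case (2 a v)
  show ?case
  proof (cases "last (a # v) = inv_letter a")
    case True
    then have "v \<noteq> []"
      by auto
    then have v: "v = butlast v @ [inv_letter a]"
      using True by (metis append_butlast_last_id last_ConsR)
    have "reduced v" and hd: "hd v \<noteq> inv_letter a"
      using 2(2) \<open>v \<noteq> []\<close> by (auto simp: reduced_Cons)
    then have red: "reduced (butlast v)"
      by (metis v reduced_append)
    have "butlast v \<noteq> []"
      using hd v by (metis append_Nil list.sel(1))
    with 2(1)[OF True red] obtain u c where uc: "butlast v = u @ c @ word_inv u" "c \<noteq> []" "reduced c"
      "last c \<noteq> inv_letter (hd c)" "lam (butlast v) = nat (2 * int (length c) - eps c div 2)"
      by blast
    have "a # v = (a # u) @ c @ word_inv (a # u)"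
      using v uc(1) by simp
    then show ?thesis
      using uc True by (metis lam.simps(2))
  next
    case False
    then have "a # v = [] @ (a # v) @ word_inv []" "last (a # v) \<noteq> inv_letter (hd (a # v))"
      by simp_all
    then show ?thesis
      using 2(2) False by (metis lam.simps(2) list.distinct(1))
  qed
qed simp

lemma sum_cyclic_shift:
  fixes x :: "nat \<Rightarrow> int"
  assumes "0 < m"
  shows "(\<Sum>i<m. x (Suc i mod m)) = (\<Sum>i<m. x i)"
proof -
  obtain k where m: "m = Suc k"
    using assms gr0_implies_Suc by blast
  have "(\<Sum>i<m. x (Suc i mod m)) = (\<Sum>i<k. x (Suc i)) + x 0"
    unfolding m by (simp add: mod_less)
  also have "\<dots> = (\<Sum>i<m. x i)"
    unfolding m by (simp add: sum.lessThan_Suc_shift del: sum.lessThan_Suc)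
  finally show ?thesis .
qed

lemma exponent_cases: "exponent a = 1 \<or> exponent a = -1"
  by (simp add: exponent_def)

lemma exponent_nth_sum: "(\<Sum>i<length c. exponent (c ! i)) = (\<Sum>a\<leftarrow>c. exponent a)"
  by (simp add: sum_list_sum_nth atLeast0LessThan)

lemma abs_exponent_diff_le:
  "\<bar>exponent a - exponent b\<bar> \<le> (1 - exponent a) + (1 - exponent b)"
  "\<bar>exponent a - exponent b\<bar> \<le> (1 + exponent a) + (1 + exponent b)"
  by (auto simp: exponent_def)

text \<open>
  Each sign change around a cyclic word involves a negative letter and a positive letter, and no
  letter takes part in more than two changes.
\<close>

lemma eps_le:
  assumes "c \<noteq> []"
  shows "eps c \<le> 2 * (int (length c) - \<bar>\<Sum>a\<leftarrow>c. exponent a\<bar>)"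
proof (cases "length c \<le> 1")
  case True
  then obtain a where "c = [a]"
    using assms by (cases c) auto
  then show ?thesis
    using exponent_cases[of a] by (auto simp: eps_def)
next
  case False
  let ?m = "length c" and ?x = "\<lambda>i. exponent (c ! i)"
  have shift: "(\<Sum>i<?m. ?x (Suc i mod ?m)) = (\<Sum>i<?m. ?x i)"
    using assms by (intro sum_cyclic_shift) auto
  have eps: "eps c = (\<Sum>i<?m. \<bar>?x i - ?x (Suc i mod ?m)\<bar>)"
    using False by (simp add: eps_def)
  have "eps c \<le> (\<Sum>i<?m. (1 - ?x i) + (1 - ?x (Suc i mod ?m)))"
    unfolding eps by (intro sum_mono abs_exponent_diff_le)
  also have "\<dots> = 2 * int ?m - 2 * (\<Sum>i<?m. ?x i)"
    by (simp add: sum.distrib sum_subtractf sum_negf shift)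
  finally have 1: "eps c \<le> 2 * int ?m - 2 * (\<Sum>a\<leftarrow>c. exponent a)"
    by (simp add: exponent_nth_sum)
  have "eps c \<le> (\<Sum>i<?m. (1 + ?x i) + (1 + ?x (Suc i mod ?m)))"
    unfolding eps by (intro sum_mono abs_exponent_diff_le)
  also have "\<dots> = 2 * int ?m + 2 * (\<Sum>i<?m. ?x i)"
    by (simp add: sum.distrib sum_negf shift)
  finally have 2: "eps c \<le> 2 * int ?m + 2 * (\<Sum>a\<leftarrow>c. exponent a)"
    by (simp add: exponent_nth_sum)
  show ?thesis
    using 1 2 by (simp add: abs_if)
qed

lemma lam_core_ge:
  assumes "c \<noteq> []" "l = nat (2 * int (length c) - eps c div 2)"
  shows "int (length c) + \<bar>\<Sum>a\<leftarrow>c. exponent a\<bar> \<le> int l"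
proof -
  have "eps c div 2 \<le> int (length c) - \<bar>\<Sum>a\<leftarrow>c. exponent a\<bar>"
    using eps_le[OF assms(1)] by simp
  then show ?thesis
    unfolding assms(2) using int_nat_eq[of "2 * int (length c) - eps c div 2"] by linarith
qed

lemma expsum_sum:
  assumes "finite T"
  shows "(\<Sum>x\<in>T. expsum x c) = (\<Sum>a\<leftarrow>c. if fst a \<in> T then exponent a else 0)"
  using assms by (induction c) (auto simp: sum.distrib)

lemma expsum_le_length:
  "finite T \<Longrightarrow> 2 * \<bar>\<Sum>x\<in>T. expsum x c\<bar> \<le> int (length c) + \<bar>\<Sum>a\<leftarrow>c. exponent a\<bar>"
proof -
  assume T: "finite T"
  have "2 * (\<Sum>a\<leftarrow>c. if fst a \<in> T then exponent a else 0) \<le> int (length c) + (\<Sum>a\<leftarrow>c. exponent a)"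
    by (induction c) (auto simp: exponent_def)
  moreover have "- 2 * (\<Sum>a\<leftarrow>c. if fst a \<in> T then exponent a else 0) \<le> int (length c) - (\<Sum>a\<leftarrow>c. exponent a)"
    by (induction c) (auto simp: exponent_def)
  ultimately show ?thesis
    unfolding expsum_sum[OF T] by (simp add: abs_if)
qed

lemma lam_ge_expsum:
  assumes "reduced w" "finite T"
  shows "2 * \<bar>\<Sum>x\<in>T. expsum x w\<bar> \<le> int (lam w)"
proof (cases "w = []")
  case False
  then obtain u c where uc: "w = u @ c @ word_inv u" "c \<noteq> []"
    "lam w = nat (2 * int (length c) - eps c div 2)"
    using cyclic_core[OF assms(1)] by blast
  then have "expsum x w = expsum x c" for x
    by simp
  then show ?thesis
    using lam_core_ge[OF uc(2,3)] expsum_le_length[OF assms(2), of c] by simp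
qed simp

lemma lam_ge_expsum1: "reduced w \<Longrightarrow> 2 * \<bar>expsum x w\<bar> \<le> int (lam w)"
  using lam_ge_expsum[of w "{x}"] by simp

lemma lam_ge_expsum2: "reduced w \<Longrightarrow> x \<noteq> y \<Longrightarrow> 2 * \<bar>expsum x w + expsum y w\<bar> \<le> int (lam w)"
  using lam_ge_expsum[of w "{x, y}"] by simp

lemma even_exponent_sum: "even (int (length c) - (\<Sum>a\<leftarrow>c. exponent a))"
  by (induction c) (auto simp: exponent_def)

text \<open>
  The number of letters plus the absolute value of the exponent sum is at most \<open>lam\<close>, so there are at most five
  letters; five letters have an odd exponent sum, which brings the total to six. Four letters give less than
  six only with four sign changes.
\<close>

lemma lam_less_6:
  assumes "reduced w" "w \<noteq> []" "lam w < 6"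
  shows "\<exists>u c. w = u @ c @ word_inv u \<and> c \<noteq> [] \<and> reduced c \<and> last c \<noteq> inv_letter (hd c) \<and>
    length c \<le> 4 \<and> (length c = 4 \<longrightarrow> (\<forall>i<3. snd (c ! i) \<noteq> snd (c ! Suc i)))"
proof -
  obtain u c where uc: "w = u @ c @ word_inv u" "c \<noteq> []" "reduced c" "last c \<noteq> inv_letter (hd c)"
    "lam w = nat (2 * int (length c) - eps c div 2)"
    using cyclic_core[OF assms(1,2)] by blast
  have "int (length c) + \<bar>\<Sum>a\<leftarrow>c. exponent a\<bar> < 6"
    using lam_core_ge[OF uc(2,5)] assms(3) by linarith
  moreover have "length c \<noteq> 5"
  proof
    assume "length c = 5"
    with calculation have "(\<Sum>a\<leftarrow>c. exponent a) = 0"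
      by linarith
    with even_exponent_sum[of c] \<open>length c = 5\<close> show False
      by simp
  qed
  ultimately have 4: "length c \<le> 4"
    by linarith
  have "snd (c ! i) \<noteq> snd (c ! Suc i)" if len: "length c = 4" and i: "i < 3" for i
  proof -
    obtain a1 a2 a3 a4 where c: "c = [a1, a2, a3, a4]"
    proof -
      have "length c = Suc (Suc (Suc (Suc 0)))"
        using len by simp
      then show thesis
        using that by (auto simp: length_Suc_conv)
    qed
    have "eps c = \<bar>exponent a1 - exponent a2\<bar> + \<bar>exponent a2 - exponent a3\<bar> +
      \<bar>exponent a3 - exponent a4\<bar> + \<bar>exponent a4 - exponent a1\<bar>"
      by (simp add: c eps_def)
    moreover have "eps c \<ge> 6"
      using assms(3) uc(5) len by linarith
    ultimately have "snd a1 \<noteq> snd a2 \<and> snd a2 \<noteq> snd a3 \<and> snd a3 \<noteq> snd a4"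
      by (auto simp: exponent_def split: if_splits)
    moreover have "i = 0 \<or> i = 1 \<or> i = 2"
      using i by linarith
    ultimately show ?thesis
      by (auto simp: c)
  qed
  then show ?thesis
    using uc 4 by blast
qed

section \<open>Cyclic groups\<close>

lemma word_val_integer_mod_group:
  assumes f: "f \<in> S \<rightarrow> carrier (integer_mod_group n)" and w: "fst ` set w \<subseteq> S"
  shows "word_val (integer_mod_group n) f w = (\<Sum>a\<leftarrow>w. exponent a * f (fst a)) mod int n"
  using w
proof (induction w)
  case (Cons a w)
  then have "f (fst a) \<in> carrier (integer_mod_group n)"
    using f by auto
  then have "letter_val (integer_mod_group n) f a = (exponent a * f (fst a)) mod int n"
    by (auto simp: letter_val_def exponent_def carrier_integer_mod_group split: if_splits)
  then show ?case
    using Cons by (simp add: mod_simps)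
qed simp

lemma exponent_weighted_sum:
  assumes "finite S" "fst ` set w \<subseteq> S"
  shows "(\<Sum>a\<leftarrow>w. exponent a * f (fst a)) = (\<Sum>x\<in>S. expsum x w * f x)"
  using assms(2)
proof (induction w)
  case (Cons a w)
  have "(\<Sum>x\<in>S. expsum x (a # w) * f x) =
      (\<Sum>x\<in>S. if x = fst a then exponent a * f x else 0) + (\<Sum>x\<in>S. expsum x w * f x)"
    unfolding sum.distrib[symmetric] by (intro sum.cong) (auto simp: distrib_right)
  then show ?case
    using Cons assms(1) by simp
qed simp

lemma marking_integer_mod_group:
  assumes "marking (integer_mod_group n) S R f" "finite S"
  shows "w \<in> carrier (free_group S) \<Longrightarrow>
      w \<in> normal_closure S R \<longleftrightarrow> int n dvd (\<Sum>x\<in>S. expsum x w * f x)"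
    and "\<exists>w\<in>carrier (free_group S). (\<Sum>x\<in>S. expsum x w * f x) mod int n = 1 mod int n"
proof -
  note m = markingD[OF assms(1)]
  have val: "word_val (integer_mod_group n) f w = (\<Sum>x\<in>S. expsum x w * f x) mod int n"
    if "w \<in> carrier (free_group S)" for w
    using word_val_integer_mod_group[OF m(1)] exponent_weighted_sum[OF assms(2)] that
    by (simp add: carrier_free_group)
  show "w \<in> normal_closure S R \<longleftrightarrow> int n dvd (\<Sum>x\<in>S. expsum x w * f x)"
    if "w \<in> carrier (free_group S)"
    using m(3)[OF that] val[OF that] by (simp add: dvd_eq_mod_eq_0)
  have "1 mod int n \<in> carrier (integer_mod_group n)"
    by (simp add: carrier_integer_mod_group)
  from m(2)[OF this]
  show "\<exists>w\<in>carrier (free_group S). (\<Sum>x\<in>S. expsum x w * f x) mod int n = 1 mod int n"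
    using val by force
qed

lemma power_in_free_group: "x \<in> S \<Longrightarrow> replicate k (x, True) \<in> carrier (free_group S)"
  by (induction k) (auto simp: carrier_free_group reduced_Cons inv_letter_def)

lemma expsum_replicate [simp]: "expsum y (replicate k (x, True)) = (if x = y then int k else 0)"
  by (induction k) auto

text \<open>
  On one generator, a relator of a finite cyclic group of order \<open>n\<close> has an exponent sum divisible by \<open>n\<close>, and not
  zero because the \<open>n\<close>-th power of the generator is a consequence of it.
\<close>

lemma cyclic_one_generator:
  assumes m: "marking (integer_mod_group n) S R f" and n: "2 \<le> n" and S: "finite S" "card S \<le> 1"
    and R: "finite R" "card R \<le> 1" "R \<subseteq> carrier (free_group S)"
  obtains r where "R = {r}" "2 * n \<le> lam r"
proof -
  have "S \<noteq> {}"
    using marking_integer_mod_group(2)[OF m S(1)] n by auto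
  then obtain x where x: "S = {x}"
    using S by (metis One_nat_def card_1_singletonE card_gt_0_iff le_Suc_eq le_zero_eq less_numeral_extra(3))
  have pow: "replicate n (x, True) \<in> normal_closure S R"
    using marking_integer_mod_group(1)[OF m S(1) power_in_free_group] by (simp add: x)
  then obtain c where "\<forall>y. expsum y (replicate n (x, True)) = (\<Sum>r\<in>R. c r * expsum y r)"
    using normal_closure_expsum[OF R(1,3)] by blast
  then have c: "int n = (\<Sum>r\<in>R. c r * expsum x r)"
    by (metis expsum_replicate)
  then have "R \<noteq> {}"
    using n by auto
  then obtain r where r: "R = {r}"
    using R by (metis One_nat_def card_1_singletonE card_gt_0_iff le_Suc_eq le_zero_eq less_numeral_extra(3))
  have "r \<in> normal_closure S R" "r \<in> carrier (free_group S)"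
    using normal_closure_subset[of R S] R r by auto
  then have "int n dvd expsum x r * f x"
    using marking_integer_mod_group(1)[OF m S(1)] by (simp add: x)
  moreover obtain w where "(expsum x w * f x) mod int n = 1 mod int n"
    using marking_integer_mod_group(2)[OF m S(1)] by (auto simp: x)
  then have "int n dvd expsum x w * f x - 1"
    by (simp add: mod_eq_dvd_iff)
  then have "coprime (f x) (int n)"
  proof (intro coprimeI)
    fix d
    assume n: "int n dvd expsum x w * f x - 1" and d: "d dvd f x" "d dvd int n"
    have "d dvd expsum x w * f x - (expsum x w * f x - 1)"
      using d by (intro dvd_diff dvd_mult dvd_trans[OF _ n])
    then show "d dvd 1"
      by simp
  qed
  ultimately have "int n dvd expsum x r"
    by (metis coprime_commute coprime_dvd_mult_left_iff)
  moreover have "expsum x r \<noteq> 0"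
    using c n by (auto simp: r)
  ultimately have "int n \<le> \<bar>expsum x r\<bar>"
    using dvd_imp_le_int[of "expsum x r" "int n"] by simp
  moreover have "reduced r"
    using R r by (simp add: carrier_free_group)
  ultimately have "2 * n \<le> lam r"
    using lam_ge_expsum1[of r x] by linarith
  then show thesis
    using r that by blast
qed

lemma phi_cyclic_one_generator_ge:
  assumes m: "marking (integer_mod_group n) S R f" and n: "2 \<le> n" and S: "finite S" "card S \<le> 1"
    and R: "finite R" "card R \<le> 1" "R \<subseteq> carrier (free_group S)"
  shows "4 * n \<le> phi S R"
proof -
  obtain r where r: "R = {r}"
    using cyclic_one_generator[OF assms] by blast
  have "2 * n * (card R + 1) \<le> phi S R"
  proof (rule phi_ge[OF m R(1) _ R(3)])
    fix R' s
    assume R': "marking (integer_mod_group n) S R' f" "finite R'" "card R' \<le> card R" "R' \<subseteq> carrier (free_group S)"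
      and s: "s \<in> R'"
    have "card R' \<le> 1"
      using R'(3) R(2) by linarith
    then obtain r' where "R' = {r'}" "2 * n \<le> lam r'"
      using cyclic_one_generator[OF R'(1) n S R'(2) _ R'(4)] by blast
    then show "2 * n \<le> lam s"
      using s by simp
  qed (simp add: r)
  then show ?thesis
    by (simp add: r)
qed

lemma word_val_replicate:
  assumes "group Q" "g x \<in> carrier Q"
  shows "word_val Q g (replicate k (x, True)) = g x [^]\<^bsub>Q\<^esub> k"
proof -
  interpret group Q by (rule assms)
  show ?thesis
  proof (induction k)
    case (Suc k)
    then show ?case
      using nat_pow_Suc2[OF assms(2), of k] by (simp add: letter_val_def)
  qed simp
qed

lemma (in group) int_pow_mod:
  assumes "x \<in> carrier G" "x [^] n = \<one>"
  shows "x [^] (k mod int n) = x [^] k"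
proof -
  have "x [^] (int n * (k div int n)) = (x [^] int n) [^] (k div int n)"
    using assms(1) by (simp add: int_pow_pow)
  also have "\<dots> = \<one>"
    using assms(2) by (simp add: int_pow_int)
  finally have "x [^] k = \<one> \<otimes> x [^] (k mod int n)"
    using int_pow_mult[OF assms(1), of "int n * (k div int n)" "k mod int n"] by simp
  then show ?thesis
    using assms(1) by simp
qed

text \<open>
  The powers of \<open>x\<close> serve as normal forms. With \<open>n = 0\<close> the infinite cyclic group is included.
\<close>

lemma marking_cyclic:
  assumes f: "f \<in> S \<rightarrow> carrier (integer_mod_group n)" and R: "R \<subseteq> carrier (free_group S)"
    and rel: "\<And>r. r \<in> R \<Longrightarrow> word_val (integer_mod_group n) f r = 0"
    and x: "x \<in> S" "f x = 1 mod int n"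
    and pow: "\<And>(Q :: 'a letter list set monoid) g s. \<lbrakk>group Q; g \<in> S \<rightarrow> carrier Q;
        \<And>r. r \<in> R \<Longrightarrow> word_val Q g r = \<one>\<^bsub>Q\<^esub>\<rbrakk>
      \<Longrightarrow> g x [^]\<^bsub>Q\<^esub> n = \<one>\<^bsub>Q\<^esub> \<and> (s \<in> S \<longrightarrow> g s = g x [^]\<^bsub>Q\<^esub> f s)"
  shows "marking (integer_mod_group n) S (R :: 'a letter list set) f"
proof (rule markingI_normal_form[where nf = "\<lambda>Q g h. g x [^]\<^bsub>Q\<^esub> h"])
  show "\<exists>w. fst ` set w \<subseteq> S \<and> h = word_val (integer_mod_group n) f w"
    if "h \<in> carrier (integer_mod_group n)" for h
  proof -
    let ?w = "replicate (nat \<bar>h\<bar>) (x, 0 \<le> h)"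
    have "fst ` set ?w \<subseteq> S"
      using x by (auto simp: set_replicate_conv_if)
    moreover have "(\<Sum>a\<leftarrow>?w. exponent a * f (fst a)) = h * f x"
      by (simp add: sum_list_replicate exponent_def)
    moreover have "(h * f x) mod int n = h"
      using that x(2) by (auto simp: carrier_integer_mod_group mod_simps split: if_splits)
    ultimately show ?thesis
      using word_val_integer_mod_group[OF f] by metis
  qed
next
  fix Q :: "'a letter list set monoid" and g s h
  assume Q: "group Q" and g: "g \<in> S \<rightarrow> carrier Q"
    and rels: "\<And>r. r \<in> R \<Longrightarrow> word_val Q g r = \<one>\<^bsub>Q\<^esub>" and s: "s \<in> S"
  interpret Q: group Q by (rule Q)
  have gx: "g x \<in> carrier Q"
    using g x by auto
  have 1: "g x [^]\<^bsub>Q\<^esub> n = \<one>\<^bsub>Q\<^esub>" and 2: "g s = g x [^]\<^bsub>Q\<^esub> f s"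
    using pow[OF Q g rels, of s] s by auto
  show "g x [^]\<^bsub>Q\<^esub> h \<in> carrier Q \<and>
      g s \<otimes>\<^bsub>Q\<^esub> g x [^]\<^bsub>Q\<^esub> h = g x [^]\<^bsub>Q\<^esub> (f s \<otimes>\<^bsub>integer_mod_group n\<^esub> h)"
    using gx 1 2 by (simp add: Q.int_pow_mod Q.int_pow_mult)
qed (use f R rel in auto)

lemma marking_one_relator_cyclic:
  "marking (integer_mod_group n) {x} {replicate n (x, True)} (\<lambda>_. 1 mod int n)"
proof (rule marking_cyclic[where x = x])
  show f: "(\<lambda>_. 1 mod int n) \<in> {x} \<rightarrow> carrier (integer_mod_group n)"
    by (auto simp: carrier_integer_mod_group)
  show "word_val (integer_mod_group n) (\<lambda>_. 1 mod int n) r = 0" if "r \<in> {replicate n (x, True)}" for r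
    using that word_val_integer_mod_group[OF f, of r]
    by (auto simp: sum_list_replicate set_replicate_conv_if mod_simps split: if_splits)
  fix Q :: "'a letter list set monoid" and g s
  assume Q: "group Q" and g: "g \<in> {x} \<rightarrow> carrier Q"
    and rel: "\<And>r. r \<in> {replicate n (x, True)} \<Longrightarrow> word_val Q g r = \<one>\<^bsub>Q\<^esub>"
  interpret Q: group Q by (rule Q)
  have gx: "g x \<in> carrier Q"
    using g by auto
  have 1: "g x [^]\<^bsub>Q\<^esub> n = \<one>\<^bsub>Q\<^esub>"
    using rel word_val_replicate[of Q g x n] Q gx by simp
  then show "g x [^]\<^bsub>Q\<^esub> n = \<one>\<^bsub>Q\<^esub> \<and> (s \<in> {x} \<longrightarrow> g s = g x [^]\<^bsub>Q\<^esub> (1 mod int n))"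
    using gx by (simp add: Q.int_pow_mod)
qed (auto simp: power_in_free_group)

lemma lam_power:
  assumes "0 < n"
  shows "lam (replicate n (x, True)) = 2 * n"
proof -
  obtain k where n: "n = Suc k"
    using assms gr0_implies_Suc by blast
  have "eps (replicate n (x, True)) = 0"
    using assms by (simp add: eps_def)
  moreover have "last (replicate n (x, True)) \<noteq> inv_letter (x, True)"
    using assms by (simp add: inv_letter_def)
  ultimately show ?thesis
    by (simp add: n)
qed

lemma phi_one_relator_cyclic:
  assumes "0 < n"
  shows "phi {x} {replicate n (x, True)} \<le> 4 * n"
proof -
  have "replicate n (x, True) \<in> Rbar {x} {replicate n (x, True)}"
    using normal_closure_subset[of "{replicate n (x, True)}" "{x}"] by (simp add: Rbar_def)
  from phi_le[OF this] show ?thesis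
    by (simp add: lam_power[OF assms])
qed

lemma one_relator_presentation:
  "1 \<le> q \<Longrightarrow> ({x}, {replicate n (x, True)}) \<in> presentations (integer_mod_group n) q"
  unfolding presentations_iff[OF group_integer_mod_group]
  using marking_one_relator_cyclic[of n x] by (auto simp: power_in_free_group)

lemma mu_cyclic:
  assumes "n \<noteq> 1"
  shows "mu (integer_mod_group n) = 1"
proof (rule mu_eqI)
  show "presentations (integer_mod_group n) 1 \<noteq> {}"
    using one_relator_presentation[of 1] by blast
  fix p :: nat
  assume "p < 1"
  show "presentations (integer_mod_group n) p = {}"
  proof (rule ccontr)
    assume "presentations (integer_mod_group n) p \<noteq> {}"
    then obtain S R where "(S, R) \<in> presentations (integer_mod_group n) p"
      by fastforce
    then obtain f where S: "finite S" "card S \<le> p" and "marking (integer_mod_group n) S R f"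
      unfolding presentations_iff[OF group_integer_mod_group] by blast
    from marking_integer_mod_group(2)[OF this(3,1)] show False
      using S \<open>p < 1\<close> assms by (auto simp: zmod_eq_0_iff zmult_eq_1_iff)
  qed
qed

lemma psi_at_cyclic_le: "0 < n \<Longrightarrow> psi_at (integer_mod_group n) 1 \<le> 4 * n"
  using psi_at_le[OF one_relator_presentation[of 1 0 n]] phi_one_relator_cyclic[of n "0 :: nat"] by linarith

lemma psi_at_cyclic_ge:
  assumes "2 \<le> n"
  shows "4 * n \<le> psi_at (integer_mod_group n) 1"
proof (rule psi_at_ge)
  show "presentations (integer_mod_group n) 1 \<noteq> {}"
    using one_relator_presentation[of 1] by blast
  fix S and R :: "nat letter list set"
  assume "(S, R) \<in> presentations (integer_mod_group n) 1"
  then show "4 * n \<le> phi S R"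
    unfolding presentations_iff[OF group_integer_mod_group]
    using phi_cyclic_one_generator_ge[of n S R] assms by auto
qed

lemma weight_cyclic:
  assumes "2 \<le> n" "n \<le> 3"
  shows "weight (integer_mod_group n) = 4 * n"
proof -
  have "psi_at (integer_mod_group n) 1 = 4 * n"
    using psi_at_cyclic_le[of n] psi_at_cyclic_ge[of n] assms by simp
  moreover have "mu (integer_mod_group n) = 1"
    using assms by (intro mu_cyclic) simp
  ultimately show ?thesis
    using assms weight_eqI[of "integer_mod_group n" 1 1] by simp
qed

text \<open>For the infinite cyclic group the bound \<open>6 * mu + 2\<close> dominates.\<close>

lemma weight_integer_group: "weight integer_group = 8"
proof -
  have Z: "integer_group = integer_mod_group 0"
    by (simp add: integer_mod_group_def)
  have m: "marking (integer_mod_group 0) {0 :: nat} {} (\<lambda>_. 1)"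
    by (rule marking_cyclic[where x = 0])
      (simp_all add: carrier_integer_mod_group group.int_pow_1)
  have R: "({0}, {}) \<in> presentations (integer_mod_group 0) 1"
    unfolding presentations_iff[OF group_integer_mod_group] using m by auto
  have "[] \<in> normal_closure {0 :: nat} {}"
    using in_normal_closureI[of "{}" "{0 :: nat}" "[]"] by (simp add: carrier_free_group)
  then have "[] \<in> Rbar {0 :: nat} {}"
    by (simp add: Rbar_def)
  from phi_le[OF this] have "psi_at (integer_mod_group 0) 1 \<le> 4"
    using psi_at_le[OF R] by simp
  then show ?thesis
    unfolding Z using weight_eqI[of "integer_mod_group 0" 1 1] mu_cyclic[of 0] by simp
qed

section \<open>The cyclic group of order five\<close>

text \<open>
  The exponent sums of a relator \<open>w\<close> lie in the hexagon \<open>\<bar>a\<bar>, \<bar>b\<bar>, \<bar>a + b\<bar> \<le> lam w div 2\<close>; two vectors in the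
  hexagon of size one span a parallelogram of area at most one.
\<close>

lemma hexagon_det_le:
  fixes a b c d h k :: int
  assumes "\<bar>a\<bar> \<le> h" "\<bar>b\<bar> \<le> h" "\<bar>a + b\<bar> \<le> h" "\<bar>c\<bar> \<le> k" "\<bar>d\<bar> \<le> k" "\<bar>c + d\<bar> \<le> k"
  shows "\<bar>a * d - b * c\<bar> \<le> h * k"
proof -
  have k: "0 \<le> k"
    using assms(4) by linarith
  have combine: "u * s + v * t \<le> h * k"
    if "0 \<le> u" "0 \<le> v" "u + v \<le> h" "s \<le> k" "t \<le> k" for u v s t :: int
  proof -
    have "u * s + v * t \<le> u * k + v * k"
      using that by (intro add_mono mult_left_mono)
    also have "\<dots> = (u + v) * k"
      by (simp add: distrib_right)
    also have "\<dots> \<le> h * k"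
      using that k by (intro mult_right_mono)
    finally show ?thesis .
  qed
  have upper: "a * d - b * c \<le> h * k"
    if "\<bar>a\<bar> \<le> h" "\<bar>b\<bar> \<le> h" "\<bar>a + b\<bar> \<le> h" for a b
  proof -
    \<comment> \<open>In each sector, \<open>(a, b)\<close> is a nonnegative combination of two adjacent vertices of the hexagon.\<close>
    consider "0 \<le> a" "0 \<le> b" | "a \<le> 0" "b \<le> 0" | "0 \<le> a" "b \<le> 0" "0 \<le> a + b" | "0 \<le> a" "b \<le> 0" "a + b \<le> 0"
      | "a \<le> 0" "0 \<le> b" "0 \<le> a + b" | "a \<le> 0" "0 \<le> b" "a + b \<le> 0"
      by linarith
    then show ?thesis
    proof cases
      case 1
      then show ?thesis
        using combine[of a b d "- c"] that assms(4,5) by (simp add: algebra_simps)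
    next
      case 2
      then show ?thesis
        using combine[of "- a" "- b" "- d" c] that assms(4,5) by (simp add: algebra_simps)
    next
      case 3
      then show ?thesis
        using combine[of "a + b" "- b" d "c + d"] that assms(5,6) by (simp add: algebra_simps)
    next
      case 4
      then show ?thesis
        using combine[of a "- (a + b)" "c + d" c] that assms(4,6) by (simp add: algebra_simps)
    next
      case 5
      then show ?thesis
        using combine[of "- a" "a + b" "- (c + d)" "- c"] that assms(4,6) by (simp add: algebra_simps)
    next
      case 6
      then show ?thesis
        using combine[of "- (a + b)" b "- d" "- (c + d)"] that assms(5,6) by (simp add: algebra_simps)
    qed
  qed
  have "- (a * d - b * c) \<le> h * k"
    using upper[of "- a" "- b"] assms(1-3) by simp
  then show ?thesis
    using upper[OF assms(1-3)] by linarith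
qed

lemma det_le_lam:
  assumes "reduced r" "reduced s" "x \<noteq> y"
  shows "\<bar>expsum x r * expsum y s - expsum y r * expsum x s\<bar> \<le> int (lam r div 2 * (lam s div 2))"
proof -
  have half: "2 * \<bar>z\<bar> \<le> int l \<Longrightarrow> \<bar>z\<bar> \<le> int (l div 2)" for z :: int and l
    by linarith
  show ?thesis
    unfolding of_nat_mult
    by (intro hexagon_det_le half lam_ge_expsum1 lam_ge_expsum2 assms)
qed

lemma sum_two_elements:
  assumes "R \<subseteq> {r, s}"
  shows "\<exists>\<alpha> \<beta>. \<forall>g :: 'b \<Rightarrow> int. (\<Sum>t\<in>R. c t * g t) = \<alpha> * g r + \<beta> * g s"
proof -
  consider "R = {}" | "R = {r}" | "R = {s}" | "R = {r, s}" "r \<noteq> s"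
    using assms by blast
  then show ?thesis
  proof cases
    case 1
    then show ?thesis
      by (intro exI[of _ 0]) simp
  next
    case 2
    then show ?thesis
      by (intro exI[of _ "c r"] exI[of _ 0]) simp
  next
    case 3
    then show ?thesis
      by (intro exI[of _ 0] exI[of _ "c s"]) simp
  next
    case 4
    then show ?thesis
      by (intro exI[of _ "c r"] exI[of _ "c s"]) simp
  qed
qed

text \<open>
  The words \<open>x\<^sup>n\<close> and \<open>y\<^sup>n\<close> have the exponent sums \<open>(n, 0)\<close> and \<open>(0, n)\<close>, so the exponent sums of the relators span
  the plane.
\<close>

lemma two_relators_det_nonzero:
  assumes R: "R \<subseteq> carrier (free_group S)" "R \<subseteq> {r, s}" and "x \<noteq> y" and "0 < n"
    and "replicate n (x, True) \<in> normal_closure S R" "replicate n (y, True) \<in> normal_closure S R"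
  shows "expsum x r * expsum y s - expsum y r * expsum x s \<noteq> 0"
proof
  assume det: "expsum x r * expsum y s - expsum y r * expsum x s = 0"
  have fin: "finite R"
    using R(2) finite_subset by blast
  have comb: "\<exists>\<alpha> \<beta>. \<forall>z. expsum z w = \<alpha> * expsum z r + \<beta> * expsum z s"
    if w: "w \<in> normal_closure S R" for w
  proof -
    obtain c where c: "\<forall>z. expsum z w = (\<Sum>t\<in>R. c t * expsum z t)"
      using normal_closure_expsum[OF fin R(1) w] by blast
    obtain \<alpha> \<beta> where "\<forall>g :: _ \<Rightarrow> int. (\<Sum>t\<in>R. c t * g t) = \<alpha> * g r + \<beta> * g s"
      using sum_two_elements[OF R(2)] by blast
    then show ?thesis
      using c by auto
  qed
  obtain \<alpha> \<beta> where 1: "\<forall>z. expsum z (replicate n (x, True)) = \<alpha> * expsum z r + \<beta> * expsum z s"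
    using comb assms(5) by blast
  obtain \<gamma> \<delta> where 2: "\<forall>z. expsum z (replicate n (y, True)) = \<gamma> * expsum z r + \<delta> * expsum z s"
    using comb assms(6) by blast
  have e: "int n = \<alpha> * expsum x r + \<beta> * expsum x s" "0 = \<alpha> * expsum y r + \<beta> * expsum y s"
     "0 = \<gamma> * expsum x r + \<delta> * expsum x s" "int n = \<gamma> * expsum y r + \<delta> * expsum y s"
    using 1[rule_format, of x] 1[rule_format, of y] 2[rule_format, of x] 2[rule_format, of y] \<open>x \<noteq> y\<close>
    by simp_all
  have "(\<alpha> * expsum x r + \<beta> * expsum x s) * (\<gamma> * expsum y r + \<delta> * expsum y s) -
      (\<alpha> * expsum y r + \<beta> * expsum y s) * (\<gamma> * expsum x r + \<delta> * expsum x s) =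
      (\<alpha> * \<delta> - \<beta> * \<gamma>) * (expsum x r * expsum y s - expsum y r * expsum x s)"
    by algebra
  then show False
    using det \<open>0 < n\<close> unfolding e[symmetric] by simp
qed

lemma card_relators_ge_2:
  assumes "R \<subseteq> carrier (free_group S)" "finite R" and "x \<noteq> y" and "0 < n"
    and "replicate n (x, True) \<in> normal_closure S R" "replicate n (y, True) \<in> normal_closure S R"
  shows "2 \<le> card R"
proof (rule ccontr)
  assume "\<not> 2 \<le> card R"
  then have "card R = 0 \<or> card R = 1"
    by linarith
  then obtain r where "R \<subseteq> {r, r}"
    using assms(2) by (auto simp: card_1_singleton_iff)
  from two_relators_det_nonzero[OF assms(1) this assms(3-6)] show False
    by simp
qed

lemma power_in_normal_closure_cyclic:
  assumes "marking (integer_mod_group n) S R f" "finite S" "x \<in> S"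
  shows "replicate n (x, True) \<in> normal_closure S R"
proof -
  have "(\<Sum>z\<in>S. expsum z (replicate n (x, True)) * f z) = (\<Sum>z\<in>S. if z = x then int n * f z else 0)"
    by (intro sum.cong) auto
  then show ?thesis
    using marking_integer_mod_group(1)[OF assms(1,2) power_in_free_group[OF assms(3)]] assms(2,3)
    by simp
qed

text \<open>
  The exponent sums of relators are orthogonal modulo \<open>n\<close> to the nonzero vector of the images of the generators;
  so \<open>n\<close> divides their determinant, and the estimate \<open>det_le_lam\<close> applies to a multiple of \<open>n\<close> that is not zero.
\<close>

lemma prime_cyclic_two_generators:
  assumes m: "marking (integer_mod_group n) {x, y} R f" and n: "prime n" and xy: "x \<noteq> y"
    and R: "R \<subseteq> carrier (free_group {x, y})" "R \<subseteq> {r, s}"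
    and rs: "r \<in> normal_closure {x, y} R" "s \<in> normal_closure {x, y} R"
  shows "expsum x r * expsum y s - expsum y r * expsum x s \<noteq> 0" (is "?det \<noteq> 0")
    and "n \<le> lam r div 2 * (lam s div 2)"
proof -
  have n0: "0 < n"
    using n prime_gt_0_nat by blast
  note ker = marking_integer_mod_group(1)[OF m]
  have sum: "(\<Sum>z\<in>{x, y}. expsum z w * f z) = expsum x w * f x + expsum y w * f y" for w
    using xy by simp
  have "replicate n (z, True) \<in> normal_closure {x, y} R" if "z \<in> {x, y}" for z
    using power_in_normal_closure_cyclic[OF m _ that] by simp
  then show det: "?det \<noteq> 0"
    using two_relators_det_nonzero[OF R xy n0] by blast
  have F: "r \<in> carrier (free_group {x, y})" "s \<in> carrier (free_group {x, y})"
    using normal_closure_carrier[OF R(1)] rs by auto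
  have 1: "int n dvd expsum x r * f x + expsum y r * f y" "int n dvd expsum x s * f x + expsum y s * f y"
    using ker[OF _ F(1)] ker[OF _ F(2)] rs by (simp_all add: sum)
  have "int n dvd expsum y s * (expsum x r * f x + expsum y r * f y)
      - expsum y r * (expsum x s * f x + expsum y s * f y)"
    using 1 by (intro dvd_diff dvd_mult)
  then have 2: "int n dvd ?det * f x"
    by (simp add: algebra_simps)
  have "int n dvd expsum x r * (expsum x s * f x + expsum y s * f y)
      - expsum x s * (expsum x r * f x + expsum y r * f y)"
    using 1 by (intro dvd_diff dvd_mult)
  then have 3: "int n dvd ?det * f y"
    by (simp add: algebra_simps)
  have "int n dvd ?det"
  proof (rule ccontr)
    assume "\<not> int n dvd ?det"
    moreover have "prime (int n)"
      using n by simp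
    ultimately have "int n dvd f x" "int n dvd f y"
      using 2 3 prime_dvd_mult_iff by blast+
    then have *: "int n dvd expsum x w * f x + expsum y w * f y" for w
      by (intro dvd_add dvd_mult)
    obtain w where "(\<Sum>z\<in>{x, y}. expsum z w * f z) mod int n = 1 mod int n"
      using marking_integer_mod_group(2)[OF m] by auto
    then have "(expsum x w * f x + expsum y w * f y) mod int n = 1 mod int n"
      by (simp only: sum)
    then show False
      using *[of w] n prime_gt_1_nat[OF n] by (simp add: dvd_eq_mod_eq_0)
  qed
  then have "int n \<le> \<bar>?det\<bar>"
    using dvd_imp_le_int[OF det, of "int n"] by simp
  moreover have "reduced r" "reduced s"
    using F by (auto simp: carrier_free_group)
  ultimately show "n \<le> lam r div 2 * (lam s div 2)"
    using det_le_lam[of r s x y] xy by linarith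
qed

lemma pairwise_products_ge_5:
  fixes a b c :: nat
  assumes "5 \<le> a * b" "5 \<le> a * c" "5 \<le> b * c"
  shows "8 \<le> a + b + c"
proof -
  have pair: "5 \<le> u + v" if "5 \<le> u * v" for u v :: nat
  proof (rule ccontr)
    assume "\<not> 5 \<le> u + v"
    then have "u \<le> 4" "v \<le> 4 - u"
      by linarith+
    then have "u * v \<le> u * (4 - u)"
      by simp
    also have "u = 0 \<or> u = 1 \<or> u = 2 \<or> u = 3 \<or> u = 4"
      using \<open>u \<le> 4\<close> by linarith
    then have "u * (4 - u) \<le> 4"
      by auto
    finally show False
      using that by simp
  qed
  show ?thesis
    using pair[OF assms(1)] pair[OF assms(2)] pair[OF assms(3)] by linarith
qed

lemma phi_five_two_generators_ge:
  assumes m: "marking (integer_mod_group 5) S R f" and S: "finite S" "card S \<le> 2"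
    and R: "finite R" "card R \<le> card S" "R \<subseteq> carrier (free_group S)"
  shows "16 \<le> phi S R"
proof (cases "card S \<le> 1")
  case True
  then show ?thesis
    using phi_cyclic_one_generator_ge[OF m _ S(1) _ R(1) _ R(3)] R(2) by simp
next
  case False
  then obtain x y where S2: "S = {x, y}" and xy: "x \<noteq> y"
    using S(2) by (metis card_2_iff le_antisym not_less_eq_eq numeral_2_eq_2 One_nat_def)
  have "prime (5 :: nat)"
  proof -
    have "\<not> k dvd 5" if "k \<in> {2..<5}" for k :: nat
    proof -
      have "k = 2 \<or> k = 3 \<or> k = 4"
        using that by auto
      then show ?thesis
        by auto
    qed
    then show ?thesis
      by (simp add: prime_nat_iff')
  qed
  note two = prime_cyclic_two_generators[OF _ this xy]
  obtain w where w: "w \<in> Rbar S R" "phi S R = (\<Sum>r\<in>R. lam r) + lam w + 2 * (card S - card R)"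
    using phi_attained[OF R(1,3)] by blast
  have "2 \<le> card R"
    using card_relators_ge_2[OF R(3,1) xy, of 5] power_in_normal_closure_cyclic[OF m S(1)] by (simp add: S2)
  then have "card R = 2"
    using R(2) S(2) by linarith
  then obtain a b where ab: "R = {a, b}" "a \<noteq> b"
    by (metis card_2_iff)
  have F: "a \<in> carrier (free_group S)" "b \<in> carrier (free_group S)" "w \<in> carrier (free_group S)"
    using R(3) Rbar_carrier[OF R(3) w(1)] by (auto simp: ab)
  have le: "5 \<le> lam u div 2 * (lam v div 2)"
    if "marking (integer_mod_group 5) S {u, v} f" "u \<in> carrier (free_group S)" "v \<in> carrier (free_group S)" for u v
    using two(2)[of "{u, v}" f u v] that normal_closure_subset[of "{u, v}" "{x, y}"] by (simp add: S2)
  have "marking (integer_mod_group 5) S {w, b} f" "marking (integer_mod_group 5) S {w, a} f"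
    using marking_exchange[OF m w(1), of a] marking_exchange[OF m w(1), of b] ab
    by (simp_all add: insert_Diff_if)
  then have "8 \<le> lam a div 2 + lam b div 2 + lam w div 2"
    using le[of a b] le[of w b] le[of w a] m F ab
    by (intro pairwise_products_ge_5) (simp_all add: mult.commute)
  then show ?thesis
    using w(2) ab by simp
qed

text \<open>
  The relations are \<open>y = x\<^sup>2\<close>, \<open>x = y\<^sup>3\<close> and \<open>y\<^sup>2 x = 1\<close>. Any two of them imply the third: they amount to
  \<open>y = x\<^sup>2\<close> and \<open>x\<^sup>5 = 1\<close>.
\<close>

lemma (in group) five_relations:
  assumes x: "x \<in> carrier G" and y: "y \<in> carrier G"
  shows "x \<otimes> (x \<otimes> (inv y \<otimes> \<one>)) = \<one> \<longleftrightarrow> y = x [^] (2 :: nat)"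
    and "inv x \<otimes> (y \<otimes> (y \<otimes> (y \<otimes> \<one>))) = \<one> \<longleftrightarrow> x = y [^] (3 :: nat)"
    and "y \<otimes> (y \<otimes> (x \<otimes> \<one>)) = \<one> \<longleftrightarrow> y [^] (2 :: nat) \<otimes> x = \<one>"
    and "y = x [^] (2 :: nat) \<Longrightarrow> y [^] (2 :: nat) \<otimes> x = \<one> \<longleftrightarrow> x [^] (5 :: nat) = \<one>"
    and "y = x [^] (2 :: nat) \<Longrightarrow> x = y [^] (3 :: nat) \<longleftrightarrow> x [^] (5 :: nat) = \<one>"
    and "x = y [^] (3 :: nat) \<Longrightarrow> y [^] (2 :: nat) \<otimes> x = \<one> \<Longrightarrow> y = x [^] (2 :: nat)"
proof -
  have "x \<otimes> (x \<otimes> (inv y \<otimes> \<one>)) = x [^] (2 :: nat) \<otimes> inv y"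
    using x y by (simp add: m_assoc numeral_2_eq_2)
  then show "x \<otimes> (x \<otimes> (inv y \<otimes> \<one>)) = \<one> \<longleftrightarrow> y = x [^] (2 :: nat)"
    using x y by (metis inv_closed inv_equality inv_inv nat_pow_closed r_inv)
  have "y \<otimes> (y \<otimes> (y \<otimes> \<one>)) = y [^] (3 :: nat)"
    using y by (simp add: m_assoc numeral_3_eq_3)
  then show "inv x \<otimes> (y \<otimes> (y \<otimes> (y \<otimes> \<one>))) = \<one> \<longleftrightarrow> x = y [^] (3 :: nat)"
    using x y by (metis inv_closed inv_equality inv_inv l_inv nat_pow_closed)
  show "y \<otimes> (y \<otimes> (x \<otimes> \<one>)) = \<one> \<longleftrightarrow> y [^] (2 :: nat) \<otimes> x = \<one>"
    using x y by (simp add: m_assoc numeral_2_eq_2)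
  show "y [^] (2 :: nat) \<otimes> x = \<one> \<longleftrightarrow> x [^] (5 :: nat) = \<one>" if "y = x [^] (2 :: nat)"
  proof -
    have "y [^] (2 :: nat) \<otimes> x = x [^] (5 :: nat)"
      using x nat_pow_mult[OF x, of 4 1] by (simp add: that nat_pow_pow)
    then show ?thesis
      by simp
  qed
  show "x = y [^] (3 :: nat) \<longleftrightarrow> x [^] (5 :: nat) = \<one>" if "y = x [^] (2 :: nat)"
  proof -
    have "y [^] (3 :: nat) = x \<otimes> x [^] (5 :: nat)"
      using x nat_pow_mult[OF x, of 1 5] by (simp add: that nat_pow_pow)
    then show ?thesis
      using x by (metis nat_pow_closed r_cancel_one' r_one l_cancel_one')
  qed
  show "y = x [^] (2 :: nat)" if "x = y [^] (3 :: nat)" "y [^] (2 :: nat) \<otimes> x = \<one>"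
  proof -
    have "y [^] (5 :: nat) = \<one>"
      using that y nat_pow_mult[OF y, of 2 3] by simp
    then have "x [^] (2 :: nat) = \<one> \<otimes> y"
      using that y nat_pow_mult[OF y, of 5 1] by (simp add: nat_pow_pow)
    then show ?thesis
      using y by simp
  qed
qed

lemma five_presentation:
  defines "a \<equiv> [(0, True), (0, True), (1, False)]"
    and "b \<equiv> [(1, True), (1, True), (0, True)]"
    and "w \<equiv> [(0, False), (1, True), (1, True), (1, True)]"
  shows "marking (integer_mod_group 5) {0, 1 :: nat} {a, b} (\<lambda>s. if s = 0 then 1 else 2)" (is "marking _ ?S _ ?f")
    and "w \<in> Rbar {0, 1 :: nat} {a, b}"
proof -
  have F: "a \<in> carrier (free_group ?S)" "b \<in> carrier (free_group ?S)" "w \<in> carrier (free_group ?S)"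
    by (auto simp: a_def b_def w_def carrier_free_group reduced_Cons inv_letter_def)
  have rel: "word_val Q g a = \<one>\<^bsub>Q\<^esub> \<longleftrightarrow> g 1 = g 0 [^]\<^bsub>Q\<^esub> (2 :: nat)"
      "word_val Q g w = \<one>\<^bsub>Q\<^esub> \<longleftrightarrow> g 0 = g 1 [^]\<^bsub>Q\<^esub> (3 :: nat)"
      "word_val Q g b = \<one>\<^bsub>Q\<^esub> \<longleftrightarrow> g 1 [^]\<^bsub>Q\<^esub> (2 :: nat) \<otimes>\<^bsub>Q\<^esub> g 0 = \<one>\<^bsub>Q\<^esub>"
    if "group Q" "g \<in> ?S \<rightarrow> carrier Q" for Q :: "nat letter list set monoid" and g
    using that group.five_relations(1-3)[of Q "g 0" "g 1"]
    by (auto simp: a_def b_def w_def letter_val_def)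
  show "w \<in> Rbar ?S {a, b}"
  proof (rule RbarI)
    fix Q :: "nat letter list set monoid" and g
    assume Q: "group Q" and g: "g \<in> ?S \<rightarrow> carrier Q"
    then have c: "g 0 \<in> carrier Q" "g 1 \<in> carrier Q"
      by auto
    let ?h = "\<lambda>r. word_val Q g r = \<one>\<^bsub>Q\<^esub>"
    have iff: "?h a \<and> ?h b \<longleftrightarrow> ?h b \<and> ?h w" "?h a \<and> ?h b \<longleftrightarrow> ?h a \<and> ?h w"
      unfolding rel[OF Q g] using group.five_relations(4-6)[OF Q c] by blast+
    then show "?h w" if "\<forall>r\<in>{a, b}. ?h r"
      using that by blast
    have "a \<noteq> b"
      by (simp add: a_def b_def)
    then show "?h r" if "r \<in> {a, b}" "\<forall>s\<in>{a, b} - {r}. ?h s" "?h w" for r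
      using that iff by blast
  qed (use F in auto)
  show "marking (integer_mod_group 5) ?S {a, b} ?f"
  proof (rule marking_cyclic[where x = 0])
    show f: "?f \<in> ?S \<rightarrow> carrier (integer_mod_group 5)"
      by (simp add: carrier_integer_mod_group)
    show "{a, b} \<subseteq> carrier (free_group ?S)"
      using F by simp
    show "word_val (integer_mod_group 5) ?f r = 0" if "r \<in> {a, b}" for r
      using that word_val_integer_mod_group[OF f, of r] by (auto simp: a_def b_def)
    fix Q :: "nat letter list set monoid" and g s
    assume Q: "group Q" and g: "g \<in> ?S \<rightarrow> carrier Q"
      and rels: "\<And>r. r \<in> {a, b} \<Longrightarrow> word_val Q g r = \<one>\<^bsub>Q\<^esub>"
    then have c: "g 0 \<in> carrier Q" "g 1 \<in> carrier Q"
      by auto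
    have 1: "g 1 = g 0 [^]\<^bsub>Q\<^esub> (2 :: nat)" "g 0 [^]\<^bsub>Q\<^esub> (5 :: nat) = \<one>\<^bsub>Q\<^esub>"
      using rels[of a] rels[of b] rel[OF Q g] group.five_relations(4)[OF Q c] by blast+
    have "g 0 [^]\<^bsub>Q\<^esub> (1 :: int) = g 0"
      using group.int_pow_1[OF Q c(1)] .
    moreover have "g 0 [^]\<^bsub>Q\<^esub> (2 :: int) = g 1"
      using 1(1) int_pow_int[of Q "g 0" 2] by simp
    ultimately show "g 0 [^]\<^bsub>Q\<^esub> (5 :: nat) = \<one>\<^bsub>Q\<^esub> \<and> (s \<in> ?S \<longrightarrow> g s = g 0 [^]\<^bsub>Q\<^esub> ?f s)"
      using 1 by auto
  qed auto
qed

lemma weight_five: "weight (integer_mod_group 5) = 16"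
proof -
  let ?a = "[(0, True), (0, True), (1, False)] :: nat letter list"
    and ?b = "[(1, True), (1, True), (0, True)] :: nat letter list"
    and ?w = "[(0, False), (1, True), (1, True), (1, True)] :: nat letter list"
  have P: "({0, 1}, {?a, ?b}) \<in> presentations (integer_mod_group 5) 2"
    unfolding presentations_iff[OF group_integer_mod_group] using five_presentation(1)
    by (auto simp: carrier_free_group reduced_Cons inv_letter_def)
  have "lam ?a = 4" "lam ?b = 6" "lam ?w = 6"
    by (simp_all add: eps_def inv_letter_def)
  then have "phi {0, 1} {?a, ?b} \<le> 16"
    using phi_le[OF five_presentation(2)] by simp
  then have "psi_at (integer_mod_group 5) 2 \<le> 16"
    using psi_at_le[OF P] by linarith
  moreover have "16 \<le> psi_at (integer_mod_group 5) 2"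
  proof (rule psi_at_ge)
    show "presentations (integer_mod_group 5) 2 \<noteq> {}"
      using P by blast
    fix S and R :: "nat letter list set"
    assume "(S, R) \<in> presentations (integer_mod_group 5) 2"
    then show "16 \<le> phi S R"
      unfolding presentations_iff[OF group_integer_mod_group]
      using phi_five_two_generators_ge[of S R] by blast
  qed
  moreover have "6 * (p + 1) < psi_at (integer_mod_group 5) p" if "1 \<le> p" "p < 2" for p
  proof -
    have "p = 1"
      using that by linarith
    then show ?thesis
      using psi_at_cyclic_ge[of 5] by simp
  qed
  ultimately show ?thesis
    using weight_eqI[of "integer_mod_group 5" 1 2] mu_cyclic[of 5] by simp
qed

section \<open>The quaternion group\<close>

text \<open>
  Its action on \<open>S3\<close> by multiplication is the one that defines \<open>S3_mod_Q8\<close>.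
\<close>

definition quat_group :: "(complex \<times> complex) monoid" where
  "quat_group = \<lparr>carrier = Q8, monoid.mult = quat_mult, one = (1, 0)\<rparr>"

lemma quat_group_simps [simp]:
  "carrier quat_group = Q8" "p \<otimes>\<^bsub>quat_group\<^esub> q = quat_mult p q" "\<one>\<^bsub>quat_group\<^esub> = (1, 0)"
  by (simp_all add: quat_group_def)

lemma quat_mult_assoc: "quat_mult (quat_mult p q) r = quat_mult p (quat_mult q r)"
  by (cases p; cases q; cases r) (simp add: quat_mult_def algebra_simps)

lemma quat_mult_one [simp]: "quat_mult (1, 0) p = p" "quat_mult p (1, 0) = p"
  by (cases p; simp add: quat_mult_def)+

lemma quat_mult_minus [simp]: "quat_mult (- p) q = - quat_mult p q" "quat_mult p (- q) = - quat_mult p q"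
  by (cases p; cases q; simp add: quat_mult_def)+

lemma quat_mult_minus_one [simp]: "quat_mult (-1, 0) p = - p" "quat_mult p (-1, 0) = - p"
  by (cases p; simp add: quat_mult_def)+

lemma imaginary_unit_neq:
  "\<i> \<noteq> -1" "\<i> \<noteq> 1" "- \<i> \<noteq> 1" "- \<i> \<noteq> -1" "- \<i> \<noteq> \<i>" "-1 \<noteq> \<i>" "1 \<noteq> \<i>"
  "1 \<noteq> - \<i>" "-1 \<noteq> - \<i>" "\<i> \<noteq> - \<i>"
  by (simp_all add: complex_eq_iff)

lemma Q8_cases:
  "p \<in> Q8 \<Longrightarrow> p = (1, 0) \<or> p = (-1, 0) \<or> p = (\<i>, 0) \<or> p = (-\<i>, 0) \<or>
    p = (0, 1) \<or> p = (0, -1) \<or> p = (0, \<i>) \<or> p = (0, -\<i>)"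
  by (simp add: Q8_def)

lemma quat_mult_Q8: "p \<in> Q8 \<Longrightarrow> q \<in> Q8 \<Longrightarrow> quat_mult p q \<in> Q8"
  by (drule Q8_cases, drule Q8_cases, elim disjE) (simp_all add: Q8_def quat_mult_def)

lemma group_quat_group: "group quat_group"
proof (rule groupI)
  show "\<exists>q\<in>carrier quat_group. q \<otimes>\<^bsub>quat_group\<^esub> p = \<one>\<^bsub>quat_group\<^esub>" if "p \<in> carrier quat_group" for p
  proof
    have p: "p \<in> Q8"
      using that by simp
    show "(cnj (fst p), - snd p) \<in> carrier quat_group"
      using Q8_cases[OF p] by (elim disjE) (simp_all add: Q8_def)
    show "(cnj (fst p), - snd p) \<otimes>\<^bsub>quat_group\<^esub> p = \<one>\<^bsub>quat_group\<^esub>"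
      using Q8_cases[OF p] by (elim disjE) (simp_all add: quat_mult_def)
  qed
qed (auto simp: quat_mult_Q8 quat_mult_assoc, simp add: Q8_def)

text \<open>
  Elements of \<open>Q8\<close> that do not commute are, up to sign, two different ones among the quaternion units. These facts are the rules by
  which short words in such elements are evaluated.
\<close>

lemma Q8_noncommuting:
  assumes "p \<in> Q8" "q \<in> Q8" "quat_mult p q \<noteq> quat_mult q p"
  shows "quat_mult p p = - (1, 0)" "quat_mult q q = - (1, 0)" "quat_mult q p = - quat_mult p q"
    "p \<noteq> (1, 0)" "- p \<noteq> (1, 0)" "q \<noteq> (1, 0)" "- q \<noteq> (1, 0)"
    "quat_mult p q \<noteq> (1, 0)" "- quat_mult p q \<noteq> (1, 0)"
    "inv\<^bsub>quat_group\<^esub> p = - p" "inv\<^bsub>quat_group\<^esub> q = - q"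
proof -
  interpret group quat_group
    by (rule group_quat_group)
  show sq: "quat_mult p p = - (1, 0)" "quat_mult q q = - (1, 0)" "quat_mult q p = - quat_mult p q"
    and "p \<noteq> (1, 0)" "- p \<noteq> (1, 0)" "q \<noteq> (1, 0)" "- q \<noteq> (1, 0)"
    "quat_mult p q \<noteq> (1, 0)" "- quat_mult p q \<noteq> (1, 0)"
    using Q8_cases[OF assms(1)] Q8_cases[OF assms(2)] assms(3)
    by (elim disjE; simp add: quat_mult_def imaginary_unit_neq)+
  have neg: "- p \<in> Q8" if "p \<in> Q8" for p
    using Q8_cases[OF that] by (elim disjE) (simp_all add: Q8_def)
  show "inv\<^bsub>quat_group\<^esub> p = - p" "inv\<^bsub>quat_group\<^esub> q = - q"
    using assms(1,2) sq neg[of p] neg[of q] by (auto intro!: inv_equality)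
qed

lemma (in group) word_val_commute:
  assumes f: "f \<in> S \<rightarrow> carrier G" and comm: "\<And>s t. s \<in> S \<Longrightarrow> t \<in> S \<Longrightarrow> f s \<otimes> f t = f t \<otimes> f s"
    and u: "fst ` set u \<subseteq> S" and v: "fst ` set v \<subseteq> S"
  shows "word_val G f u \<otimes> word_val G f v = word_val G f v \<otimes> word_val G f u"
proof -
  have inv: "inv x \<otimes> y = y \<otimes> inv x" if "x \<in> carrier G" "y \<in> carrier G" "x \<otimes> y = y \<otimes> x" for x y
    using that by (metis inv_closed inv_solve_left inv_solve_right m_assoc m_closed)
  have letter: "letter_val G f a \<otimes> y = y \<otimes> letter_val G f a"
    if "fst a \<in> S" "y \<in> carrier G" "f (fst a) \<otimes> y = y \<otimes> f (fst a)" for a y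
    using that f inv[of "f (fst a)" y] by (auto simp: letter_val_def)
  have word: "word_val G f w \<otimes> y = y \<otimes> word_val G f w"
    if "fst ` set w \<subseteq> S" and y: "y \<in> carrier G" and "\<And>s. s \<in> S \<Longrightarrow> f s \<otimes> y = y \<otimes> f s" for w y
    using that(1)
  proof (induction w)
    case (Cons a w)
    then have a: "fst a \<in> S" "letter_val G f a \<in> carrier G" and w: "word_val G f w \<in> carrier G"
        "word_val G f w \<otimes> y = y \<otimes> word_val G f w"
      using f letter_val_closed[OF f] word_val_closed[OF f] by auto
    have "letter_val G f a \<otimes> y = y \<otimes> letter_val G f a"
      using letter[OF a(1) y that(3)[OF a(1)]] .
    then show ?case
      using a(2) w y by (metis m_assoc word_val_Cons)
  qed (use y in simp)
  have "f s \<otimes> word_val G f v = word_val G f v \<otimes> f s" if "s \<in> S" for s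
    using word[OF v, of "f s"] that f comm by fastforce
  then show ?thesis
    using word[OF u word_val_closed[OF f v]] by simp
qed

lemma quat_marking_noncommuting:
  assumes "marking quat_group S R f"
  shows "\<exists>s\<in>S. \<exists>t\<in>S. quat_mult (f s) (f t) \<noteq> quat_mult (f t) (f s)"
proof (rule ccontr)
  assume *: "\<not> ?thesis"
  interpret group quat_group
    by (rule group_quat_group)
  note m = markingD[OF assms]
  have "(\<i>, 0) \<in> Q8" "(0, 1) \<in> Q8"
    by (auto simp: Q8_def)
  then obtain u v where u: "fst ` set u \<subseteq> S" "(\<i>, 0) = word_val quat_group f u"
    and v: "fst ` set v \<subseteq> S" "(0, 1) = word_val quat_group f v"
    using m(2)[of "(\<i>, 0)"] m(2)[of "(0, 1)"] by (auto simp: carrier_free_group)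
  have "quat_mult (\<i>, 0) (0, 1) = quat_mult (0, 1) (\<i>, 0)"
    using word_val_commute[OF m(1) _ u(1) v(1)] * u(2) v(2) by simp
  then show False
    by (simp add: quat_mult_def complex_eq_iff)
qed

lemma (in group) word_val_word_inv:
  assumes "f \<in> S \<rightarrow> carrier G" "fst ` set u \<subseteq> S"
  shows "word_val G f (word_inv u) = inv (word_val G f u)"
  using assms(2)
proof (induction u)
  case (Cons a u)
  then have u: "fst ` set (word_inv u) \<subseteq> S" "word_val G f u \<in> carrier G" and a: "fst ` set [inv_letter a] \<subseteq> S"
    "letter_val G f a \<in> carrier G"
    using word_val_closed[OF assms(1)] letter_val_closed[OF assms(1)] by auto
  have "word_val G f (word_inv (a # u)) = word_val G f (word_inv u) \<otimes> word_val G f [inv_letter a]"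
    using word_val_append[OF assms(1) u(1) a(1)] by simp
  also have "word_val G f [inv_letter a] = inv (letter_val G f a)"
    using letter_val_inv_letter[OF assms(1), of a] Cons.prems a(2) by simp
  finally show ?case
    using Cons u a by (simp add: inv_mult_group)
qed simp

lemma (in group) word_val_core:
  assumes f: "f \<in> S \<rightarrow> carrier G" and w: "fst ` set (u @ c @ word_inv u) \<subseteq> S"
    and val: "word_val G f (u @ c @ word_inv u) = \<one>"
  shows "word_val G f c = \<one>"
proof -
  have u: "fst ` set u \<subseteq> S" and c: "fst ` set c \<subseteq> S" and i: "fst ` set (word_inv u) \<subseteq> S"
    and ci: "fst ` set (c @ word_inv u) \<subseteq> S"
    using w by (simp_all add: image_Un)
  have cl: "word_val G f u \<in> carrier G" "word_val G f c \<in> carrier G"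
    using word_val_closed[OF f] u c by auto
  have "word_val G f u \<otimes> (word_val G f c \<otimes> inv (word_val G f u)) = \<one>"
    using val unfolding word_val_append[OF f u ci] word_val_append[OF f c i] word_val_word_inv[OF f u] .
  then show ?thesis
    using cl by (metis inv_closed inv_comm inv_solve_right' l_one m_closed r_one)
qed

text \<open>
  The images of the generators do not commute. In words in such elements, a product of one or three letters is
  one of the elements up to sign, a reduced product of two letters is \<open>-1\<close> or, up to sign, the
  product of the two elements, and an alternating word with four letters is \<open>-1\<close>. None of these is \<open>1\<close>.
\<close>

lemma quat_relator_lam_ge:
  assumes m: "marking quat_group {x, y} R f" and w: "w \<in> carrier (free_group {x, y})"
    and val: "word_val quat_group f w = \<one>\<^bsub>quat_group\<^esub>" and "w \<noteq> []"
  shows "6 \<le> lam w"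
proof (rule ccontr)
  assume "\<not> 6 \<le> lam w"
  then obtain u c where uc: "w = u @ c @ word_inv u" "c \<noteq> []" "reduced c" "last c \<noteq> inv_letter (hd c)"
    "length c \<le> 4" "length c = 4 \<longrightarrow> (\<forall>i<3. snd (c ! i) \<noteq> snd (c ! Suc i))"
    using lam_less_6[of w] w \<open>w \<noteq> []\<close> by (auto simp: carrier_free_group)
  interpret group quat_group
    by (rule group_quat_group)
  note f = markingD(1)[OF m]
  have fw: "fst ` set (u @ c @ word_inv u) \<subseteq> {x, y}"
    using w uc(1) by (auto simp: carrier_free_group)
  then have c: "word_val quat_group f c = (1, 0)"
    using word_val_core[OF f fw] val uc(1) by simp
  let ?p = "f x" and ?q = "f y"
  have Q: "?p \<in> Q8" "?q \<in> Q8"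
    using f by auto
  have "quat_mult ?p ?q \<noteq> quat_mult ?q ?p"
    using quat_marking_noncommuting[OF m] by auto
  note q = Q8_noncommuting[OF Q this]
  have pq: "quat_mult ?p (quat_mult ?p z) = - z" "quat_mult ?q (quat_mult ?q z) = - z"
    "quat_mult ?q (quat_mult ?p z) = - quat_mult ?p (quat_mult ?q z)" for z
    by (simp_all add: quat_mult_assoc[symmetric] q)
  have gen: "fst a = x \<or> fst a = y" if "a \<in> set c" for a
    using fw that by auto
  have "length c = 1 \<or> length c = 2 \<or> length c = 3 \<or> length c = 4"
    using uc(2,5) by (cases "length c") auto
  then show False
  proof (elim disjE)
    assume "length c = 1"
    then obtain s1 b1 where ca: "c = [(s1, b1)]"
      by (auto simp: length_Suc_conv)
    have "s1 = x \<or> s1 = y"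
      using gen[of "(s1, b1)"] by (simp add: ca)
    then show False
      by (elim disjE; cases b1; insert c; simp add: ca letter_val_def q)
  next
    assume "length c = 2"
    then obtain s1 b1 s2 b2 where ca: "c = [(s1, b1), (s2, b2)]"
      by (auto simp: length_Suc_conv numeral_2_eq_2)
    have "s1 = x \<or> s1 = y" "s2 = x \<or> s2 = y"
      using gen[of "(s1, b1)"] gen[of "(s2, b2)"] by (simp_all add: ca)
    then show False
      by (elim disjE; cases b1; cases b2; insert c uc(3);
          simp add: ca letter_val_def q reduced_Cons inv_letter_def)
  next
    assume "length c = 3"
    then obtain s1 b1 s2 b2 s3 b3 where ca: "c = [(s1, b1), (s2, b2), (s3, b3)]"
      by (auto simp: length_Suc_conv numeral_3_eq_3)
    have "s1 = x \<or> s1 = y" "s2 = x \<or> s2 = y" "s3 = x \<or> s3 = y"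
      using gen[of "(s1, b1)"] gen[of "(s2, b2)"] gen[of "(s3, b3)"] by (simp_all add: ca)
    then show False
      by (elim disjE; cases b1; cases b2; cases b3; insert c; simp add: ca letter_val_def q pq)
  next
    assume 4: "length c = 4"
    then have "length c = Suc (Suc (Suc (Suc 0)))"
      by simp
    then obtain s1 b1 s2 b2 s3 b3 s4 b4 where ca: "c = [(s1, b1), (s2, b2), (s3, b3), (s4, b4)]"
      by (auto simp: length_Suc_conv)
    have b: "b2 = (\<not> b1)" "b3 = b1" "b4 = (\<not> b1)"
      using uc(6)[rule_format, OF 4, of 0] uc(6)[rule_format, OF 4, of 1] uc(6)[rule_format, OF 4, of 2]
      by (auto simp: ca)
    then have "s1 \<noteq> s2" "s2 \<noteq> s3" "s3 \<noteq> s4"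
      using uc(3) by (auto simp: ca reduced_Cons inv_letter_def)
    moreover have "s1 = x \<or> s1 = y" "s2 = x \<or> s2 = y" "s3 = x \<or> s3 = y" "s4 = x \<or> s4 = y"
      using gen[of "(s1, b1)"] gen[of "(s2, b2)"] gen[of "(s3, b3)"] gen[of "(s4, b4)"] by (simp_all add: ca)
    ultimately have "s1 = x \<and> s2 = y \<and> s3 = x \<and> s4 = y \<or> s1 = y \<and> s2 = x \<and> s3 = y \<and> s4 = x"
      by blast
    then show False
      by (elim disjE; cases b1; insert c; simp add: ca b letter_val_def q pq)
  qed
qed

text \<open>
  Any two of \<open>x y x = y\<close>, \<open>y x y = x\<close>, \<open>x\<^sup>2 = y\<^sup>2\<close> imply the third, as one sees from \<open>x y x y\<close>. The first two
  are the relators of the presentation, and the last one is the additional relator. The other conclusions are the rewrite rules for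
  the normal forms.
\<close>

lemma (in group) quat_relations:
  assumes x: "x \<in> carrier G" and y: "y \<in> carrier G"
  shows "x \<otimes> (y \<otimes> (x \<otimes> (inv y \<otimes> \<one>))) = \<one> \<longleftrightarrow> x \<otimes> (y \<otimes> x) = y"
    and "x \<otimes> (x \<otimes> (inv y \<otimes> (inv y \<otimes> \<one>))) = \<one> \<longleftrightarrow> x \<otimes> x = y \<otimes> y"
    and "x \<otimes> (y \<otimes> x) = y \<Longrightarrow> y \<otimes> (x \<otimes> y) = x \<longleftrightarrow> x \<otimes> x = y \<otimes> y"
    and "x \<otimes> (y \<otimes> x) = y \<Longrightarrow> x \<otimes> x = y \<otimes> y \<Longrightarrow> x \<otimes> (x \<otimes> (x \<otimes> x)) = \<one>"
    and "x \<otimes> (y \<otimes> x) = y \<Longrightarrow> x \<otimes> x = y \<otimes> y \<Longrightarrow> y \<otimes> x = x \<otimes> (x \<otimes> (x \<otimes> y))"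
proof -
  have "x \<otimes> (y \<otimes> (x \<otimes> (inv y \<otimes> \<one>))) = (x \<otimes> (y \<otimes> x)) \<otimes> inv y"
    using x y by (simp add: m_assoc)
  then show "x \<otimes> (y \<otimes> (x \<otimes> (inv y \<otimes> \<one>))) = \<one> \<longleftrightarrow> x \<otimes> (y \<otimes> x) = y"
    using x y by (metis inv_closed inv_equality inv_inv m_closed r_inv)
  have "x \<otimes> (x \<otimes> (inv y \<otimes> (inv y \<otimes> \<one>))) = (x \<otimes> x) \<otimes> inv (y \<otimes> y)"
    using x y by (simp add: m_assoc inv_mult_group)
  then show "x \<otimes> (x \<otimes> (inv y \<otimes> (inv y \<otimes> \<one>))) = \<one> \<longleftrightarrow> x \<otimes> x = y \<otimes> y"
    using x y by (metis inv_closed inv_equality inv_inv m_closed r_inv)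
  assume xyx: "x \<otimes> (y \<otimes> x) = y"
  have "x \<otimes> (y \<otimes> (x \<otimes> y)) = (x \<otimes> (y \<otimes> x)) \<otimes> y"
    using x y by (simp add: m_assoc)
  then have "x \<otimes> (y \<otimes> (x \<otimes> y)) = y \<otimes> y"
    by (simp add: xyx)
  then show "y \<otimes> (x \<otimes> y) = x \<longleftrightarrow> x \<otimes> x = y \<otimes> y"
    using x y by (metis Units_eq Units_l_cancel m_closed)
  assume xx: "x \<otimes> x = y \<otimes> y"
  have "x \<otimes> (x \<otimes> (y \<otimes> (x \<otimes> x))) = x \<otimes> ((x \<otimes> (y \<otimes> x)) \<otimes> x)"
    using x y by (simp add: m_assoc)
  also have "\<dots> = y"
    by (simp add: xyx)
  also have "y \<otimes> (x \<otimes> x) = (x \<otimes> x) \<otimes> y"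
    using x y by (simp add: xx m_assoc)
  finally have "(x \<otimes> (x \<otimes> (x \<otimes> x))) \<otimes> y = \<one> \<otimes> y"
    using x y by (simp add: m_assoc)
  then show x4: "x \<otimes> (x \<otimes> (x \<otimes> x)) = \<one>"
    using x y by (metis m_closed one_closed right_cancel)
  have "(x \<otimes> (x \<otimes> (x \<otimes> x))) \<otimes> (y \<otimes> x) = x \<otimes> (x \<otimes> (x \<otimes> (x \<otimes> (y \<otimes> x))))"
    using x y by (simp add: m_assoc)
  then show "y \<otimes> x = x \<otimes> (x \<otimes> (x \<otimes> y))"
    using x y by (simp add: xyx x4)
qed

text \<open>
  The power \<open>x\<^sup>m\<close> where \<open>c = \<i>\<^sup>m\<close>. The quaternions \<open>(c, 0)\<close> and \<open>(0, c)\<close> then have the normal forms \<open>x\<^sup>m\<close> and \<open>x\<^sup>m y\<close>.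
\<close>

definition quat_power :: "('q, 'm) monoid_scheme \<Rightarrow> 'q \<Rightarrow> complex \<Rightarrow> 'q" where
  "quat_power Q x c = (if c = 1 then \<one>\<^bsub>Q\<^esub> else if c = \<i> then x
     else if c = -1 then x \<otimes>\<^bsub>Q\<^esub> x else x \<otimes>\<^bsub>Q\<^esub> (x \<otimes>\<^bsub>Q\<^esub> x))"

definition quat_normal_form :: "('q, 'm) monoid_scheme \<Rightarrow> 'q \<Rightarrow> 'q \<Rightarrow> complex \<times> complex \<Rightarrow> 'q" where
  "quat_normal_form Q x y h =
     (if snd h = 0 then quat_power Q x (fst h) else quat_power Q x (snd h) \<otimes>\<^bsub>Q\<^esub> y)"

lemma (in group) quat_normal_form_mult:
  assumes x: "x \<in> carrier G" and y: "y \<in> carrier G"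
    and xyx: "x \<otimes> (y \<otimes> x) = y" and xx: "x \<otimes> x = y \<otimes> y" and h: "h \<in> Q8"
  shows "quat_normal_form G x y h \<in> carrier G"
    and "x \<otimes> quat_normal_form G x y h = quat_normal_form G x y (quat_mult (\<i>, 0) h)"
    and "y \<otimes> quat_normal_form G x y h = quat_normal_form G x y (quat_mult (0, 1) h)"
proof -
  note i = imaginary_unit_neq
  note x4 = quat_relations(4)[OF x y xyx xx] and yx = quat_relations(5)[OF x y xyx xx]
  have x4': "x \<otimes> (x \<otimes> (x \<otimes> (x \<otimes> z))) = z" if "z \<in> carrier G" for z
  proof -
    have "x \<otimes> (x \<otimes> (x \<otimes> (x \<otimes> z))) = (x \<otimes> (x \<otimes> (x \<otimes> x))) \<otimes> z"
      using x that by (simp add: m_assoc)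
    then show ?thesis
      using that by (simp add: x4)
  qed
  have yx': "y \<otimes> (x \<otimes> z) = x \<otimes> (x \<otimes> (x \<otimes> (y \<otimes> z)))" if "z \<in> carrier G" for z
  proof -
    have "y \<otimes> (x \<otimes> z) = (y \<otimes> x) \<otimes> z"
      using x y that by (simp add: m_assoc)
    then show ?thesis
      using x y that by (simp add: yx m_assoc)
  qed
  note h8 = Q8_cases[OF h]
  show "quat_normal_form G x y h \<in> carrier G"
    using x y by (simp add: quat_normal_form_def quat_power_def)
  show "x \<otimes> quat_normal_form G x y h = quat_normal_form G x y (quat_mult (\<i>, 0) h)"
    using h8 x y
    by (elim disjE)
      (simp_all add: quat_normal_form_def quat_power_def quat_mult_def i m_assoc x4 x4')
  show "y \<otimes> quat_normal_form G x y h = quat_normal_form G x y (quat_mult (0, 1) h)"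
    using h8 x y
    by (elim disjE)
      (simp_all add: quat_normal_form_def quat_power_def quat_mult_def i m_assoc x4 x4' yx yx' xx[symmetric])
qed

lemma quat_presentation:
  defines "a \<equiv> [(0, True), (1, True), (0, True), (1, False)]"
    and "b \<equiv> [(1, True), (0, True), (1, True), (0, False)]"
    and "w \<equiv> [(0, True), (0, True), (1, False), (1, False)]"
  shows "marking quat_group {0, 1 :: nat} {a, b} (\<lambda>s. if s = 0 then (\<i>, 0) else (0, 1))" (is "marking _ ?S _ ?f")
    and "w \<in> Rbar {0, 1 :: nat} {a, b}"
proof -
  have F: "a \<in> carrier (free_group ?S)" "b \<in> carrier (free_group ?S)" "w \<in> carrier (free_group ?S)"
    by (auto simp: a_def b_def w_def carrier_free_group reduced_Cons inv_letter_def)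
  have rel: "word_val Q g a = \<one>\<^bsub>Q\<^esub> \<longleftrightarrow> g 0 \<otimes>\<^bsub>Q\<^esub> (g 1 \<otimes>\<^bsub>Q\<^esub> g 0) = g 1"
      "word_val Q g b = \<one>\<^bsub>Q\<^esub> \<longleftrightarrow> g 1 \<otimes>\<^bsub>Q\<^esub> (g 0 \<otimes>\<^bsub>Q\<^esub> g 1) = g 0"
      "word_val Q g w = \<one>\<^bsub>Q\<^esub> \<longleftrightarrow> g 0 \<otimes>\<^bsub>Q\<^esub> g 0 = g 1 \<otimes>\<^bsub>Q\<^esub> g 1"
    if "group Q" "g 0 \<in> carrier Q" "g 1 \<in> carrier Q" for Q :: "('q, 'm) monoid_scheme" and g
    using group.quat_relations(1,2)[OF that] group.quat_relations(1)[OF that(1,3,2)]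
    by (simp_all add: a_def b_def w_def letter_val_def)
  show "w \<in> Rbar ?S {a, b}"
  proof (rule RbarI)
    fix Q :: "nat letter list set monoid" and g
    assume Q: "group Q" and g: "g \<in> ?S \<rightarrow> carrier Q"
    then have c: "g 0 \<in> carrier Q" "g 1 \<in> carrier Q"
      by auto
    let ?h = "\<lambda>r. word_val Q g r = \<one>\<^bsub>Q\<^esub>"
    have iff: "?h a \<and> ?h b \<longleftrightarrow> ?h b \<and> ?h w" "?h a \<and> ?h b \<longleftrightarrow> ?h a \<and> ?h w"
      unfolding rel[OF Q c]
      using group.quat_relations(3)[OF Q c] group.quat_relations(3)[OF Q c(2,1)] by metis+
    then show "?h w" if "\<forall>r\<in>{a, b}. ?h r"
      using that by blast
    have "a \<noteq> b"
      by (simp add: a_def b_def)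
    then show "?h r" if "r \<in> {a, b}" "\<forall>s\<in>{a, b} - {r}. ?h s" "?h w" for r
      using that iff by blast
  qed (use F in auto)
  have i: "(\<i>, 0) \<in> Q8" "(0, 1) \<in> Q8"
    by (auto simp: Q8_def)
  show "marking quat_group ?S {a, b} ?f"
  proof (rule markingI_normal_form[OF group_quat_group, where nf = "\<lambda>Q g. quat_normal_form Q (g 0) (g 1)"])
    show "?f \<in> ?S \<rightarrow> carrier quat_group"
      using i by auto
    show "{a, b} \<subseteq> carrier (free_group ?S)"
      using F by simp
    show "word_val quat_group ?f r = \<one>\<^bsub>quat_group\<^esub>" if "r \<in> {a, b}" for r
      using that rel(1,2)[OF group_quat_group, of ?f] i by (auto simp: quat_mult_def)
    show "\<exists>w. fst ` set w \<subseteq> ?S \<and> h = word_val quat_group ?f w" if h: "h \<in> carrier quat_group" for h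
    proof -
      let ?i = "(0 :: nat, True)" and ?j = "(1 :: nat, True)"
      have "h \<in> word_val quat_group ?f ` {[], [?i], [?i, ?i], [?i, ?i, ?i], [?j], [?i, ?j], [?i, ?i, ?j], [?i, ?i, ?i, ?j]}"
        using h by (simp add: Q8_def letter_val_def quat_mult_def) blast
      then obtain w where w: "h = word_val quat_group ?f w"
        "w \<in> {[], [?i], [?i, ?i], [?i, ?i, ?i], [?j], [?i, ?j], [?i, ?i, ?j], [?i, ?i, ?i, ?j]}"
        by blast
      from w(2) have "fst ` set w \<subseteq> ?S"
        by auto
      then show ?thesis
        using w(1) by blast
    qed
    fix Q :: "nat letter list set monoid" and g s h
    assume Q: "group Q" and g: "g \<in> ?S \<rightarrow> carrier Q"
      and rels: "\<And>r. r \<in> {a, b} \<Longrightarrow> word_val Q g r = \<one>\<^bsub>Q\<^esub>"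
    then have c: "g 0 \<in> carrier Q" "g 1 \<in> carrier Q"
      by auto
    show "quat_normal_form Q (g 0) (g 1) \<one>\<^bsub>quat_group\<^esub> = \<one>\<^bsub>Q\<^esub>"
      by (simp add: quat_normal_form_def quat_power_def)
    assume s: "s \<in> ?S" and h: "h \<in> carrier quat_group"
    have 1: "g 0 \<otimes>\<^bsub>Q\<^esub> (g 1 \<otimes>\<^bsub>Q\<^esub> g 0) = g 1" "g 1 \<otimes>\<^bsub>Q\<^esub> (g 0 \<otimes>\<^bsub>Q\<^esub> g 1) = g 0"
      using rels[of a] rels[of b] rel[OF Q c] by blast+
    then have 2: "g 0 \<otimes>\<^bsub>Q\<^esub> g 0 = g 1 \<otimes>\<^bsub>Q\<^esub> g 1"
      using group.quat_relations(3)[OF Q c] by blast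
    show "quat_normal_form Q (g 0) (g 1) h \<in> carrier Q \<and>
        g s \<otimes>\<^bsub>Q\<^esub> quat_normal_form Q (g 0) (g 1) h = quat_normal_form Q (g 0) (g 1) (?f s \<otimes>\<^bsub>quat_group\<^esub> h)"
      using group.quat_normal_form_mult[OF Q c 1(1) 2, of h] s h by (elim insertE) simp_all
  qed
qed

lemma quat_fourth_power:
  assumes "p \<in> Q8"
  shows "p [^]\<^bsub>quat_group\<^esub> (4 :: nat) = (1, 0)"
  using Q8_cases[OF assms] by (elim disjE) (simp_all add: numeral_eq_Suc quat_mult_def)

text \<open>
  The exponent sums of any two relators are linearly independent, so there are two nonempty relators in
  each presentation, including those that arise by exchange.
\<close>

lemma phi_quat_ge:
  assumes m: "marking quat_group S R f" and S: "finite S" "card S \<le> 2"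
    and R: "finite R" "card R \<le> card S" "R \<subseteq> carrier (free_group S)"
  shows "card S = 2 \<and> 18 \<le> phi S R"
proof -
  obtain x y where xy: "x \<in> S" "y \<in> S" "quat_mult (f x) (f y) \<noteq> quat_mult (f y) (f x)"
    using quat_marking_noncommuting[OF m] by blast
  then have ne: "x \<noteq> y"
    by auto
  then have "card {x, y} = 2"
    by simp
  then have S2: "S = {x, y}"
    using S xy card_seteq[of S "{x, y}"] by auto
  have pow: "replicate 4 (z, True) \<in> normal_closure S R" if "z \<in> S" for z
  proof -
    have "f z \<in> carrier quat_group"
      using markingD(1)[OF m] that by auto
    then have "word_val quat_group f (replicate 4 (z, True)) = \<one>\<^bsub>quat_group\<^esub>"
      using word_val_replicate[OF group_quat_group, of f z 4] quat_fourth_power by simp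
    then show ?thesis
      using markingD(3)[OF m power_in_free_group[OF that]] by simp
  qed
  have "2 \<le> card R"
    using card_relators_ge_2[OF R(3,1) ne, of 4] pow xy by simp
  then have "card R = 2" and cS: "card S = 2"
    using R(2) S(2) by auto
  have "6 * (card R + 1) \<le> phi S R"
  proof (rule phi_ge[OF m R(1) _ R(3)])
    fix R' u
    assume m': "marking quat_group S R' f" and R': "finite R'" "card R' \<le> card R" "R' \<subseteq> carrier (free_group S)"
      and u: "u \<in> R'"
    have "card (R' - {u}) \<le> 1"
      using R' u \<open>card R = 2\<close> by simp
    then obtain v where v: "R' \<subseteq> {u, v}"
      using R'(1) card_le_Suc0_iff_eq[of "R' - {u}"] by (cases "R' - {u} = {}") auto
    have pow': "replicate 4 (z, True) \<in> normal_closure S R'" if "z \<in> S" for z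
      using pow[OF that] markingD(3)[OF m power_in_free_group[OF that]]
        markingD(3)[OF m' power_in_free_group[OF that]] by simp
    have "expsum x u * expsum y v - expsum y u * expsum x v \<noteq> 0"
      using two_relators_det_nonzero[OF R'(3) v ne, of 4] pow'[OF xy(1)] pow'[OF xy(2)] by simp
    then have "u \<noteq> []"
      by auto
    moreover have uF: "u \<in> carrier (free_group S)"
      using u R'(3) by blast
    moreover have "word_val quat_group f u = \<one>\<^bsub>quat_group\<^esub>"
      using markingD(3)[OF m' uF] normal_closure_subset[of R' S] u by blast
    ultimately show "6 \<le> lam u"
      using quat_relator_lam_ge[of x y R' f u] m' by (simp add: S2)
  qed (use \<open>card R = 2\<close> in auto)
  then show ?thesis
    using cS \<open>card R = 2\<close> by simp
qed

lemma weight_quat_group: "weight quat_group = 18"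
proof -
  let ?a = "[(0, True), (1, True), (0, True), (1, False)] :: nat letter list"
    and ?b = "[(1, True), (0, True), (1, True), (0, False)] :: nat letter list"
    and ?w = "[(0, True), (0, True), (1, False), (1, False)] :: nat letter list"
  have P: "({0, 1}, {?a, ?b}) \<in> presentations quat_group 2"
    unfolding presentations_iff[OF group_quat_group] using quat_presentation(1)
    by (auto simp: carrier_free_group reduced_Cons inv_letter_def)
  have "lam ?a = 6" "lam ?b = 6" "lam ?w = 6"
    by (simp_all add: eps_def inv_letter_def)
  then have "phi {0, 1} {?a, ?b} \<le> 18"
    using phi_le[OF quat_presentation(2)] by simp
  moreover have "card S = 2 \<and> 18 \<le> phi S R"
    if "(S, R) \<in> presentations quat_group q" "q \<le> 2" for S R q
    using that phi_quat_ge[of S R] unfolding presentations_iff[OF group_quat_group] by (meson order_trans)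
  ultimately have "weight quat_group = max 18 (6 * 2 + 2)"
    by (intro weight_of_optimal_presentation[OF P]) simp_all
  then show ?thesis
    by simp
qed

section \<open>The free abelian group of rank three\<close>

definition lattice3 :: "(int \<times> int \<times> int) monoid" where
  "lattice3 = \<lparr>carrier = UNIV, monoid.mult = (+), one = 0\<rparr>"

lemma lattice3_simps [simp]:
  "carrier lattice3 = UNIV" "u \<otimes>\<^bsub>lattice3\<^esub> v = u + v" "\<one>\<^bsub>lattice3\<^esub> = 0"
  by (simp_all add: lattice3_def)

lemma group_lattice3: "group lattice3"
proof (rule groupI)
  show "\<exists>v\<in>carrier lattice3. v \<otimes>\<^bsub>lattice3\<^esub> u = \<one>\<^bsub>lattice3\<^esub>" for u
    by (intro bexI[of _ "- u"]) simp_all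
qed (simp_all add: add.assoc)

lemma inv_lattice3 [simp]: "inv\<^bsub>lattice3\<^esub> u = - u"
  by (rule group.inv_equality[OF group_lattice3]) simp_all

definition coord3 :: "3 \<Rightarrow> int \<times> int \<times> int \<Rightarrow> int" where
  "coord3 i u = (if i = 1 then fst u else if i = 2 then fst (snd u) else snd (snd u))"

lemma coord3_add [simp]: "coord3 i (u + v) = coord3 i u + coord3 i v"
  and coord3_minus [simp]: "coord3 i (- u) = - coord3 i u"
  and coord3_zero [simp]: "coord3 i 0 = 0"
  by (simp_all add: coord3_def)

lemma coord3_eqI: "(\<And>i. coord3 i u = coord3 i v) \<Longrightarrow> u = v"
proof -
  assume "\<And>i. coord3 i u = coord3 i v"
  from this[of 1] this[of 2] this[of 3] show ?thesis
    by (simp add: coord3_def prod_eq_iff)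
qed

lemma coord3_surj: "\<exists>u. \<forall>i. coord3 i u = c i"
  by (rule exI[of _ "(c 1, c 2, c 3)"]) (simp add: coord3_def forall_3)

lemma coord3_word_val: "coord3 i (word_val lattice3 f w) = (\<Sum>a\<leftarrow>w. exponent a * coord3 i (f (fst a)))"
  by (induction w) (auto simp: letter_val_def exponent_def)

lemma coord3_word_val_indexed:
  fixes x :: "3 \<Rightarrow> 'a"
  assumes "inj x" "fst ` set w \<subseteq> range x"
  shows "coord3 i (word_val lattice3 f w) = (\<Sum>j\<in>UNIV. expsum (x j) w * coord3 i (f (x j)))"
  using exponent_weighted_sum[of "range x" w "\<lambda>s. coord3 i (f s)"] assms
  by (simp add: coord3_word_val sum.reindex)

text \<open>
  Three generators map onto \<open>\<int>\<^sup>3\<close> only if their matrix is invertible, so all three are needed and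
  a relator has exponent sums zero.
\<close>

lemma lattice3_marking:
  fixes x :: "3 \<Rightarrow> 'a"
  assumes m: "marking lattice3 S R f" and x: "inj x" "S \<subseteq> range x"
  shows "S = range x"
    and "w \<in> normal_closure S R \<Longrightarrow> w \<in> carrier (free_group S) \<Longrightarrow> expsum s w = 0"
proof -
  note md = markingD[OF m]
  have sub: "fst ` set w \<subseteq> range x" if "w \<in> carrier (free_group S)" for w
    using that x(2) by (auto simp: carrier_free_group)
  let ?A = "\<chi> i j. real_of_int (coord3 i (f (x j)))"
  have "\<exists>w\<in>carrier (free_group S). \<forall>i. coord3 i (word_val lattice3 f w) = (if i = k then 1 else 0)" for k
  proof -
    obtain u where u: "\<forall>i. coord3 i u = (if i = k then 1 else 0)"
      using coord3_surj[of "\<lambda>i. if i = k then 1 else 0"] by blast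
    have "u \<in> carrier lattice3"
      by simp
    from md(2)[OF this] obtain w where "w \<in> carrier (free_group S)" "u = word_val lattice3 f w"
      by blast
    then show ?thesis
      using u by blast
  qed
  then obtain W where W: "\<And>k. W k \<in> carrier (free_group S)"
    "\<And>k i. coord3 i (word_val lattice3 f (W k)) = (if i = k then 1 else 0)"
    by metis
  \<comment> \<open>Column \<open>k\<close> describes a word with the \<open>k\<close>-th basis vector as its value, which gives a right inverse.\<close>
  let ?P = "\<chi> j k. real_of_int (expsum (x j) (W k))"
  have "?A ** ?P = mat 1"
  proof -
    have "(\<Sum>j\<in>UNIV. real_of_int (coord3 i (f (x j))) * real_of_int (expsum (x j) (W k))) = (if i = k then 1 else 0)"
      for i k
    proof -
      have "(\<Sum>j\<in>UNIV. real_of_int (coord3 i (f (x j))) * real_of_int (expsum (x j) (W k))) =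
          real_of_int (\<Sum>j\<in>UNIV. expsum (x j) (W k) * coord3 i (f (x j)))"
        by (simp add: mult.commute)
      also have "(\<Sum>j\<in>UNIV. expsum (x j) (W k) * coord3 i (f (x j))) = (if i = k then 1 else 0)"
        using coord3_word_val_indexed[OF x(1) sub[OF W(1)], of i f k] W(2)[of i k] by simp
      also have "real_of_int (if i = k then 1 else 0) = (if i = k then 1 else 0)"
        by simp
      finally show ?thesis .
    qed
    then show ?thesis
      by (simp add: matrix_matrix_mult_def mat_def vec_eq_iff)
  qed
  then have PA: "?P ** ?A = mat 1"
    by (simp add: matrix_left_right_inverse)
  show "S = range x"
  proof (rule ccontr)
    assume "S \<noteq> range x"
    then obtain j where "x j \<notin> S"
      using x(2) by blast
    then have "expsum (x j) (W k) = 0" for k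
      using W(1)[of k] by (intro expsum_eq_0) (auto simp: carrier_free_group)
    then have "(?P ** ?A) $ j $ j = 0"
      by (simp add: matrix_matrix_mult_def)
    then show False
      by (simp add: PA mat_def)
  qed
  show "expsum s w = 0" if w: "w \<in> normal_closure S R" and wF: "w \<in> carrier (free_group S)"
  proof -
    let ?v = "\<chi> j. real_of_int (expsum (x j) w)"
    have "word_val lattice3 f w = 0"
      using md(3)[OF wF] w by simp
    then have *: "(\<Sum>j\<in>UNIV. expsum (x j) w * coord3 i (f (x j))) = 0" for i
      using coord3_word_val_indexed[OF x(1) sub[OF wF], of i f] by simp
    have "(\<Sum>j\<in>UNIV. real_of_int (coord3 i (f (x j))) * real_of_int (expsum (x j) w)) = 0" for i
    proof -
      have "(\<Sum>j\<in>UNIV. real_of_int (coord3 i (f (x j))) * real_of_int (expsum (x j) w)) =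
          real_of_int (\<Sum>j\<in>UNIV. expsum (x j) w * coord3 i (f (x j)))"
        by (simp add: mult.commute)
      then show ?thesis
        using * by simp
    qed
    then have "?A *v ?v = 0"
      by (simp add: matrix_vector_mult_def vec_eq_iff)
    then have "(?P ** ?A) *v ?v = 0"
      unfolding matrix_vector_mul_assoc[symmetric] by (simp only: matrix_vector_mult_0_right)
    then have v: "?v = 0"
      by (simp only: PA matrix_vector_mul_lid)
    have "expsum (x j) w = 0" for j
      using v by (simp add: vec_eq_iff)
    moreover have "expsum s w = 0" if "s \<notin> range x"
      using that sub[OF wF] by (intro expsum_eq_0) blast
    ultimately show "expsum s w = 0"
      by (cases "s \<in> range x") auto
  qed
qed

text \<open>
  A set of fewer than three generators is enlarged to three, which contradicts that all three are needed.
\<close>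

lemma lattice3_generators:
  fixes S :: "nat set"
  assumes m: "marking lattice3 S R f" and S: "finite S" "card S \<le> 3"
  obtains x :: "3 \<Rightarrow> nat" where "inj x" "S = range x"
proof -
  obtain B where B: "finite B" "card B = 3 - card S" "B \<subseteq> UNIV - S"
    using infinite_arbitrarily_large[of "UNIV - S"] S(1) by (metis Diff_infinite_finite infinite_UNIV_nat)
  have "card (S \<union> B) = card S + card B"
    using S(1) B by (intro card_Un_disjoint) auto
  then have "card (S \<union> B) = 3"
    using S(2) B(2) by simp
  then obtain x :: "3 \<Rightarrow> nat" where x: "bij_betw x UNIV (S \<union> B)"
    using finite_same_card_bij[of "UNIV :: 3 set" "S \<union> B"] S(1) B(1) by auto
  then have "inj x" "S \<subseteq> range x"
    by (auto simp: bij_betw_def)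
  then show thesis
    using that lattice3_marking(1)[OF m] by blast
qed

subsection \<open>Crossing numbers\<close>

text \<open>
  The signed number of pairs of a letter \<open>x\<close> and a later letter \<open>y\<close>; this is the central coordinate of the
  image of a word in the Heisenberg group. It is additive on words with exponent sums zero.
\<close>

primrec crossing :: "'a \<Rightarrow> 'a \<Rightarrow> 'a letter list \<Rightarrow> int" where
  "crossing x y [] = 0"
| "crossing x y (a # w) = (if fst a = x then exponent a else 0) * expsum y w + crossing x y w"

lemma crossing_append: "crossing x y (u @ v) = crossing x y u + crossing x y v + expsum x u * expsum y v"
  by (induction u) (auto simp: algebra_simps)

lemma crossing_cancel_Cons:
  assumes "x \<noteq> y"
  shows "crossing x y (cancel_Cons a w) = crossing x y (a # w)"
proof (cases "w \<noteq> [] \<and> hd w = inv_letter a")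
  case True
  then obtain v where "w = inv_letter a # v"
    by (metis list.collapse)
  then show ?thesis
    using assms by (auto simp: cancel_Cons_def algebra_simps)
qed (auto simp: cancel_Cons_def)

lemma crossing_reduce:
  assumes "x \<noteq> y"
  shows "crossing x y (reduce w) = crossing x y w"
  by (induction w) (simp_all add: reduce_Cons crossing_cancel_Cons[OF assms])

definition exponent_free :: "'a set \<Rightarrow> 'a letter list set" where
  "exponent_free S = {w \<in> carrier (free_group S). \<forall>s. expsum s w = 0}"

lemma normal_exponent_free: "exponent_free S \<lhd> free_group S"
proof -
  interpret group "free_group S"
    by (rule group_free_group)
  have "subgroup (exponent_free S) (free_group S)"
  proof (rule subgroupI)
    have "\<one>\<^bsub>free_group S\<^esub> \<in> exponent_free S"
      using one_closed by (simp add: exponent_free_def one_free_group)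
    then show "exponent_free S \<noteq> {}"
      by blast
    show "inv\<^bsub>free_group S\<^esub> u \<in> exponent_free S" if "u \<in> exponent_free S" for u
    proof -
      have "u \<in> carrier (free_group S)"
        using that by (simp add: exponent_free_def)
      then show ?thesis
        using that inv_closed[of u] inv_free_group[of u S] by (simp add: exponent_free_def)
    qed
    show "u \<otimes>\<^bsub>free_group S\<^esub> v \<in> exponent_free S" if "u \<in> exponent_free S" "v \<in> exponent_free S" for u v
      using that m_closed[of u v] by (simp add: exponent_free_def mult_free_group)
  qed (auto simp: exponent_free_def)
  then show ?thesis
    by (rule normal_invI) (simp add: exponent_free_def expsum_conj)
qed

lemma crossing_conj:
  assumes "x \<noteq> y" "g \<in> carrier (free_group S)" "u \<in> exponent_free S"
  shows "crossing x y (g \<otimes>\<^bsub>free_group S\<^esub> u \<otimes>\<^bsub>free_group S\<^esub> inv\<^bsub>free_group S\<^esub> g) = crossing x y u"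
proof -
  have "crossing x y (reduce (word_inv g @ g)) = 0"
    by (simp add: reduce_word_inv)
  then have "crossing x y (word_inv g) + crossing x y g = expsum x g * expsum y g"
    by (simp add: crossing_reduce[OF assms(1)] crossing_append)
  moreover have "expsum s u = 0" for s
    using assms(3) by (simp add: exponent_free_def)
  ultimately show ?thesis
    by (simp add: mult_free_group inv_free_group[OF assms(2)] crossing_reduce[OF assms(1)]
        crossing_append)
qed

text \<open>
  The crossing numbers of the three commutators of the generators form an identity matrix, which two relators
  cannot generate.
\<close>

lemma lattice3_three_relators:
  assumes m: "marking lattice3 S R f" and x: "inj (x :: 3 \<Rightarrow> 'a)" "S = range x"
    and R: "finite R" "R \<subseteq> carrier (free_group S)"
  shows "\<not> R - {[]} \<subseteq> {r, s}"
proof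
  assume sub: "R - {[]} \<subseteq> {r, s}"
  \<comment> \<open>The number of crossings of a generator with itself changes under cancellation, hence the value \<open>0\<close>.\<close>
  let ?q = "\<lambda>(i, j) w. if x i = x j then 0 else crossing (x i) (x j) w"
  have "expsum s w = 0" if "w \<in> normal_closure S R" "w \<in> carrier (free_group S)" for s w
    using lattice3_marking(2)[OF m x(1) _ that] x(2) by blast
  then have RK: "R \<subseteq> exponent_free S"
    using R(2) normal_closure_subset[of R S] by (auto simp: exponent_free_def)
  let ?F = "free_group S"
  have comb: "\<exists>\<alpha> \<beta>. \<forall>i. ?q i w = \<alpha> * ?q i r + \<beta> * ?q i s" if w: "w \<in> normal_closure S R" for w
  proof -
    have "\<exists>c. \<forall>i. ?q i w = (\<Sum>r\<in>R. c r * ?q i r)"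
    proof (rule normal_closure_combination[OF R(1) RK normal_exponent_free _ _ w])
      show "?q i (u \<otimes>\<^bsub>?F\<^esub> v) = ?q i u + ?q i v" if "u \<in> exponent_free S" "v \<in> exponent_free S" for i u v
        using that by (auto simp: mult_free_group crossing_reduce crossing_append exponent_free_def split: prod.splits)
      show "?q i (g \<otimes>\<^bsub>?F\<^esub> u \<otimes>\<^bsub>?F\<^esub> inv\<^bsub>?F\<^esub> g) = ?q i u"
        if "g \<in> carrier ?F" "u \<in> exponent_free S" for i g u
        using crossing_conj[OF _ that] by (auto split: prod.splits)
    qed
    then obtain c where c: "\<forall>i. ?q i w = (\<Sum>r\<in>R. c r * ?q i r)"
      by blast
    have "(\<Sum>r\<in>R. c r * ?q i r) = (\<Sum>r\<in>R - {[]}. c r * ?q i r)" for i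
      using R(1) by (intro sum.mono_neutral_right) (auto split: prod.splits)
    moreover obtain \<alpha> \<beta> where "\<forall>g :: _ \<Rightarrow> int. (\<Sum>t\<in>R - {[]}. c t * g t) = \<alpha> * g r + \<beta> * g s"
      using sum_two_elements[OF sub] by blast
    ultimately show ?thesis
      using c by auto
  qed
  let ?c = "\<lambda>i j. [(x i, True), (x j, True), (x i, False), (x j, False)]"
  have c: "?c i j \<in> normal_closure S R" if "i \<noteq> j" for i j
  proof -
    have ne: "x i \<noteq> x j"
      using x(1) that by (simp add: inj_eq)
    have "?c i j \<in> carrier ?F"
      using x(2) ne by (auto simp: carrier_free_group reduced_Cons inv_letter_def)
    moreover have "word_val lattice3 f (?c i j) = 0"
      by (simp add: letter_val_def)
    ultimately show ?thesis
      using markingD(3)[OF m] by simp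
  qed
  have ne: "x 1 \<noteq> x 2" "x 1 \<noteq> x 3" "x 2 \<noteq> x 3"
    using x(1) by (simp_all add: inj_eq)
  obtain a1 b1 where 1: "\<forall>i. ?q i (?c 1 2) = a1 * ?q i r + b1 * ?q i s"
    using comb[OF c[of 1 2]] by auto
  obtain a2 b2 where 2: "\<forall>i. ?q i (?c 1 3) = a2 * ?q i r + b2 * ?q i s"
    using comb[OF c[of 1 3]] by auto
  obtain a3 b3 where 3: "\<forall>i. ?q i (?c 2 3) = a3 * ?q i r + b3 * ?q i s"
    using comb[OF c[of 2 3]] by auto
  define r1 r2 r3 where "r1 = crossing (x 1) (x 2) r" and "r2 = crossing (x 1) (x 3) r" and "r3 = crossing (x 2) (x 3) r"
  define s1 s2 s3 where "s1 = crossing (x 1) (x 2) s" and "s2 = crossing (x 1) (x 3) s" and "s3 = crossing (x 2) (x 3) s"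
  note d = r1_def[symmetric] r2_def[symmetric] r3_def[symmetric] s1_def[symmetric] s2_def[symmetric] s3_def[symmetric]
  have e: "1 = a1 * r1 + b1 * s1" "0 = a1 * r2 + b1 * s2" "0 = a1 * r3 + b1 * s3"
    "0 = a2 * r1 + b2 * s1" "1 = a2 * r2 + b2 * s2" "0 = a2 * r3 + b2 * s3"
    "0 = a3 * r1 + b3 * s1" "0 = a3 * r2 + b3 * s2" "1 = a3 * r3 + b3 * s3"
    using 1[rule_format, of "(1, 2)"] 1[rule_format, of "(1, 3)"] 1[rule_format, of "(2, 3)"]
      2[rule_format, of "(1, 2)"] 2[rule_format, of "(1, 3)"] 2[rule_format, of "(2, 3)"]
      3[rule_format, of "(1, 2)"] 3[rule_format, of "(1, 3)"] 3[rule_format, of "(2, 3)"]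
      ne ne[symmetric]
    by (simp_all add: d)
  have "(a1 * r1 + b1 * s1) * ((a2 * r2 + b2 * s2) * (a3 * r3 + b3 * s3) - (a2 * r3 + b2 * s3) * (a3 * r2 + b3 * s2))
      - (a1 * r2 + b1 * s2) * ((a2 * r1 + b2 * s1) * (a3 * r3 + b3 * s3) - (a2 * r3 + b2 * s3) * (a3 * r1 + b3 * s1))
      + (a1 * r3 + b1 * s3) * ((a2 * r1 + b2 * s1) * (a3 * r2 + b3 * s2) - (a2 * r2 + b2 * s2) * (a3 * r1 + b3 * s1)) = 0"
    by algebra
  then show False
    unfolding e[symmetric] by simp
qed

text \<open>
  In a cyclically reduced alternating word of four letters, the neighbours of a letter \<open>x\<close> are inverses of other
  generators, so the exponent sum of \<open>x\<close> does not vanish.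
\<close>

lemma exponent_free_lam_ge:
  assumes w: "reduced w" "w \<noteq> []" and e: "\<And>s. expsum s w = 0"
  shows "6 \<le> lam w"
proof (rule ccontr)
  assume "\<not> 6 \<le> lam w"
  then obtain u c where uc: "w = u @ c @ word_inv u" "c \<noteq> []" "reduced c" "last c \<noteq> inv_letter (hd c)"
    "length c \<le> 4" "length c = 4 \<longrightarrow> (\<forall>i<3. snd (c ! i) \<noteq> snd (c ! Suc i))"
    using lam_less_6[of w] w by auto
  have c: "expsum s c = 0" for s
    using e[of s] by (simp add: uc(1))
  have "length c = 1 \<or> length c = 2 \<or> length c = 3 \<or> length c = 4"
    using uc(2,5) by (cases "length c") auto
  then show False
  proof (elim disjE)
    assume "length c = 1"
    then obtain s1 b1 where ca: "c = [(s1, b1)]"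
      by (auto simp: length_Suc_conv)
    show False
      using c[of s1] by (cases b1) (simp_all add: ca)
  next
    assume "length c = 2"
    then obtain s1 b1 s2 b2 where ca: "c = [(s1, b1), (s2, b2)]"
      by (auto simp: length_Suc_conv numeral_2_eq_2)
    show False
      using c[of s1] uc(3)
      by (cases b1; cases b2; cases "s2 = s1") (simp_all add: ca reduced_Cons inv_letter_def)
  next
    assume "length c = 3"
    then obtain s1 b1 s2 b2 s3 b3 where ca: "c = [(s1, b1), (s2, b2), (s3, b3)]"
      by (auto simp: length_Suc_conv numeral_3_eq_3)
    show False
      using c[of s1] c[of s2] c[of s3]
      by (cases b1; cases b2; cases b3; cases "s2 = s1"; cases "s3 = s1"; cases "s3 = s2") (simp_all add: ca)
  next
    assume 4: "length c = 4"
    then have "length c = Suc (Suc (Suc (Suc 0)))"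
      by simp
    then obtain s1 b1 s2 b2 s3 b3 s4 b4 where ca: "c = [(s1, b1), (s2, b2), (s3, b3), (s4, b4)]"
      by (auto simp: length_Suc_conv)
    have b: "b2 = (\<not> b1)" "b3 = b1" "b4 = (\<not> b1)"
      using uc(6)[rule_format, OF 4, of 0] uc(6)[rule_format, OF 4, of 1] uc(6)[rule_format, OF 4, of 2]
      by (auto simp: ca)
    then have "s2 \<noteq> s1" "s4 \<noteq> s1"
      using uc(3,4) by (auto simp: ca reduced_Cons inv_letter_def)
    then show False
      using c[of s1] by (cases b1; cases "s3 = s1") (simp_all add: ca b)
  qed
qed

lemma phi_lattice3_ge:
  fixes S :: "nat set"
  assumes m: "marking lattice3 S R f" and S: "finite S" "card S \<le> 3"
    and R: "finite R" "card R \<le> card S" "R \<subseteq> carrier (free_group S)"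
  shows "card S = 3 \<and> 24 \<le> phi S R"
proof -
  obtain x :: "3 \<Rightarrow> nat" where x: "inj x" "S = range x"
    using lattice3_generators[OF m S] by blast
  have cS: "card S = 3"
    using x by (simp add: card_image)
  have relators: "card R' = 3 \<and> [] \<notin> R'"
    if m': "marking lattice3 S R' f" and R': "finite R'" "card R' \<le> 3" "R' \<subseteq> carrier (free_group S)" for R'
  proof -
    have "2 < card (R' - {[]})"
    proof (rule ccontr)
      assume "\<not> 2 < card (R' - {[]})"
      then have "card (R' - {[]}) = 0 \<or> card (R' - {[]}) = 1 \<or> card (R' - {[]}) = 2"
        by linarith
      then obtain r s where "R' - {[]} \<subseteq> {r, s}"
        using R'(1) by (auto simp: card_1_singleton_iff card_2_iff)
      then show False
        using lattice3_three_relators[OF m' x R'(1,3)] by blast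
    qed
    moreover have "card (R' - {[]}) \<le> card R'"
      using R'(1) by (intro card_mono) auto
    moreover have "card (R' - {[]}) < card R'" if "[] \<in> R'"
      using R'(1) that by (intro card_Diff1_less)
    ultimately show ?thesis
      using R'(2) by fastforce
  qed
  have cR: "card R = 3"
    using relators[OF m R(1) _ R(3)] R(2) cS by simp
  have "6 * (card R + 1) \<le> phi S R"
  proof (rule phi_ge[OF m R(1) _ R(3)])
    fix R' r
    assume m': "marking lattice3 S R' f" and R': "finite R'" "card R' \<le> card R" "R' \<subseteq> carrier (free_group S)"
      and r: "r \<in> R'"
    have rF: "r \<in> carrier (free_group S)"
      using r R'(3) by blast
    show "6 \<le> lam r"
    proof (rule exponent_free_lam_ge)
      show "reduced r"
        using rF by (simp add: carrier_free_group)
      show "r \<noteq> []"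
        using relators[OF m' R'(1) _ R'(3)] R'(2) cR r by auto
      show "expsum s r = 0" for s
        using lattice3_marking(2)[OF m' x(1) _ _ rF] x(2) r normal_closure_subset[of R' S] by blast
    qed
  qed (use cR in auto)
  then show ?thesis
    using cR cS by simp
qed

subsection \<open>An optimal presentation\<close>

lemma (in group) commute_inv_iff:
  assumes "x \<in> carrier G" "y \<in> carrier G"
  shows "x \<otimes> inv y = inv y \<otimes> x \<longleftrightarrow> x \<otimes> y = y \<otimes> x"
proof
  assume "x \<otimes> inv y = inv y \<otimes> x"
  then have "y \<otimes> (x \<otimes> inv y) \<otimes> y = y \<otimes> (inv y \<otimes> x) \<otimes> y"
    by simp
  then show "x \<otimes> y = y \<otimes> x"
    using assms by (metis inv_closed inv_solve_left inv_solve_right m_assoc m_closed)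
next
  assume "x \<otimes> y = y \<otimes> x"
  then show "x \<otimes> inv y = inv y \<otimes> x"
    using assms by (metis inv_closed inv_solve_left inv_solve_right m_assoc m_closed)
qed

lemma (in group) int_pow_commute:
  assumes x: "x \<in> carrier G" and y: "y \<in> carrier G" and xy: "x \<otimes> y = y \<otimes> x"
  shows "y \<otimes> x [^] (i :: int) = x [^] i \<otimes> y"
proof -
  have nat: "y \<otimes> x [^] (n :: nat) = x [^] n \<otimes> y" for n
    by (rule group_commutes_pow[OF xy x y, symmetric])
  show ?thesis
  proof (cases i rule: int_cases)
    case (nonneg n)
    then show ?thesis
      using nat by (simp only: int_pow_int)
  next
    case (neg n)
    then have "x [^] i = inv (x [^] Suc n)"
      using int_pow_neg[OF x, of "int (Suc n)"] by (simp only: int_pow_int)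
    then show ?thesis
      using commute_inv_iff[OF y nat_pow_closed[OF x, of "Suc n"]] nat[of "Suc n"] by (simp only:)
  qed
qed

text \<open>
  The additional relator says \<open>x y\<^sup>-\<^sup>1 z = z y\<^sup>-\<^sup>1 x\<close>. If two of the three pairs of generators commute, a letter common to
  them can be moved out and cancelled, and what remains says that the third pair commutes.
\<close>

lemma (in group) torus_relations:
  assumes x: "x \<in> carrier G" and y: "y \<in> carrier G" and z: "z \<in> carrier G"
  shows "x \<otimes> (y \<otimes> (inv x \<otimes> (inv y \<otimes> \<one>))) = \<one> \<longleftrightarrow> x \<otimes> y = y \<otimes> x"
    and "x \<otimes> (inv y \<otimes> (z \<otimes> (inv x \<otimes> (y \<otimes> (inv z \<otimes> \<one>))))) = \<one> \<longleftrightarrow>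
      x \<otimes> (inv y \<otimes> z) = z \<otimes> (inv y \<otimes> x)"
    and "y \<otimes> z = z \<otimes> y \<Longrightarrow> z \<otimes> x = x \<otimes> z \<Longrightarrow>
      x \<otimes> (inv y \<otimes> z) = z \<otimes> (inv y \<otimes> x) \<longleftrightarrow> x \<otimes> y = y \<otimes> x"
    and "x \<otimes> y = y \<otimes> x \<Longrightarrow> z \<otimes> x = x \<otimes> z \<Longrightarrow>
      x \<otimes> (inv y \<otimes> z) = z \<otimes> (inv y \<otimes> x) \<longleftrightarrow> y \<otimes> z = z \<otimes> y"
    and "x \<otimes> y = y \<otimes> x \<Longrightarrow> y \<otimes> z = z \<otimes> y \<Longrightarrow>
      x \<otimes> (inv y \<otimes> z) = z \<otimes> (inv y \<otimes> x) \<longleftrightarrow> z \<otimes> x = x \<otimes> z"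
proof -
  have eq1: "u \<otimes> inv v = \<one> \<longleftrightarrow> u = v" if "u \<in> carrier G" "v \<in> carrier G" for u v
    using that by (metis inv_closed inv_equality inv_inv r_inv)
  have l: "u \<otimes> v = u \<otimes> v' \<longleftrightarrow> v = v'" if "u \<in> carrier G" "v \<in> carrier G" "v' \<in> carrier G" for u v v'
    using that Units_l_cancel[of u v v'] by simp
  have "x \<otimes> (y \<otimes> (inv x \<otimes> (inv y \<otimes> \<one>))) = (x \<otimes> y) \<otimes> inv (y \<otimes> x)"
    using x y by (simp add: m_assoc inv_mult_group)
  then show "x \<otimes> (y \<otimes> (inv x \<otimes> (inv y \<otimes> \<one>))) = \<one> \<longleftrightarrow> x \<otimes> y = y \<otimes> x"
    using eq1[of "x \<otimes> y" "y \<otimes> x"] x y by simp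
  have "x \<otimes> (inv y \<otimes> (z \<otimes> (inv x \<otimes> (y \<otimes> (inv z \<otimes> \<one>))))) = (x \<otimes> (inv y \<otimes> z)) \<otimes> inv (z \<otimes> (inv y \<otimes> x))"
    using x y z by (simp add: m_assoc inv_mult_group)
  then show "x \<otimes> (inv y \<otimes> (z \<otimes> (inv x \<otimes> (y \<otimes> (inv z \<otimes> \<one>))))) = \<one> \<longleftrightarrow>
      x \<otimes> (inv y \<otimes> z) = z \<otimes> (inv y \<otimes> x)"
    using eq1[of "x \<otimes> (inv y \<otimes> z)" "z \<otimes> (inv y \<otimes> x)"] x y z by simp
  {
    assume yz: "y \<otimes> z = z \<otimes> y" and zx: "z \<otimes> x = x \<otimes> z"
    have "inv y \<otimes> z = z \<otimes> inv y"
      using commute_inv_iff[of z y] yz y z by simp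
    then have "x \<otimes> (inv y \<otimes> z) = z \<otimes> (x \<otimes> inv y)"
      using x y z zx by (metis inv_closed m_assoc)
    then show "x \<otimes> (inv y \<otimes> z) = z \<otimes> (inv y \<otimes> x) \<longleftrightarrow> x \<otimes> y = y \<otimes> x"
      using l[OF z m_closed[OF x inv_closed[OF y]] m_closed[OF inv_closed[OF y] x]]
        commute_inv_iff[OF x y] by metis
  next
    assume xy: "x \<otimes> y = y \<otimes> x" and zx: "z \<otimes> x = x \<otimes> z"
    have "inv y \<otimes> x = x \<otimes> inv y"
      using commute_inv_iff[OF x y] xy by simp
    then have "z \<otimes> (inv y \<otimes> x) = x \<otimes> (z \<otimes> inv y)"
      using x y z zx by (metis inv_closed m_assoc)
    then show "x \<otimes> (inv y \<otimes> z) = z \<otimes> (inv y \<otimes> x) \<longleftrightarrow> y \<otimes> z = z \<otimes> y"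
      using l[OF x m_closed[OF inv_closed[OF y] z] m_closed[OF z inv_closed[OF y]]]
        commute_inv_iff[OF z y] by metis
  next
    assume xy: "x \<otimes> y = y \<otimes> x" and yz: "y \<otimes> z = z \<otimes> y"
    have "inv y \<otimes> x = x \<otimes> inv y" "inv y \<otimes> z = z \<otimes> inv y"
      using commute_inv_iff[OF x y] commute_inv_iff[OF z y] xy yz by simp_all
    then have "x \<otimes> (inv y \<otimes> z) = inv y \<otimes> (x \<otimes> z)" "z \<otimes> (inv y \<otimes> x) = inv y \<otimes> (z \<otimes> x)"
      using x y z by (metis inv_closed m_assoc)+
    then show "x \<otimes> (inv y \<otimes> z) = z \<otimes> (inv y \<otimes> x) \<longleftrightarrow> z \<otimes> x = x \<otimes> z"
      using l[OF inv_closed[OF y] m_closed[OF x z] m_closed[OF z x]] by metis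
  }
qed

definition lattice3_basis :: "nat \<Rightarrow> int \<times> int \<times> int" where
  "lattice3_basis s = (if s = 0 then (1, 0, 0) else if s = 1 then (0, 1, 0) else (0, 0, 1))"

lemma torus_presentation:
  defines "a \<equiv> [(0, True), (1, True), (0, False), (1, False)]"
    and "b \<equiv> [(1, True), (2, True), (1, False), (2, False)]"
    and "c \<equiv> [(2, True), (0, True), (2, False), (0, False)]"
    and "w \<equiv> [(0, True), (1, False), (2, True), (0, False), (1, True), (2, False)]"
  shows "marking lattice3 {0, 1, 2 :: nat} {a, b, c} lattice3_basis" (is "marking _ ?S _ _")
    and "w \<in> Rbar {0, 1, 2 :: nat} {a, b, c}"
proof -
  have F: "a \<in> carrier (free_group ?S)" "b \<in> carrier (free_group ?S)" "c \<in> carrier (free_group ?S)"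
      "w \<in> carrier (free_group ?S)"
    by (auto simp: a_def b_def c_def w_def carrier_free_group reduced_Cons inv_letter_def)
  have rel: "word_val Q g a = \<one>\<^bsub>Q\<^esub> \<longleftrightarrow> g 0 \<otimes>\<^bsub>Q\<^esub> g 1 = g 1 \<otimes>\<^bsub>Q\<^esub> g 0"
      "word_val Q g b = \<one>\<^bsub>Q\<^esub> \<longleftrightarrow> g 1 \<otimes>\<^bsub>Q\<^esub> g 2 = g 2 \<otimes>\<^bsub>Q\<^esub> g 1"
      "word_val Q g c = \<one>\<^bsub>Q\<^esub> \<longleftrightarrow> g 2 \<otimes>\<^bsub>Q\<^esub> g 0 = g 0 \<otimes>\<^bsub>Q\<^esub> g 2"
      "word_val Q g w = \<one>\<^bsub>Q\<^esub> \<longleftrightarrow>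
        g 0 \<otimes>\<^bsub>Q\<^esub> (inv\<^bsub>Q\<^esub> g 1 \<otimes>\<^bsub>Q\<^esub> g 2) = g 2 \<otimes>\<^bsub>Q\<^esub> (inv\<^bsub>Q\<^esub> g 1 \<otimes>\<^bsub>Q\<^esub> g 0)"
    if "group Q" "g 0 \<in> carrier Q" "g 1 \<in> carrier Q" "g 2 \<in> carrier Q"
    for Q :: "nat letter list set monoid" and g
    using group.torus_relations(1)[OF that(1,2,3,4)] group.torus_relations(1)[OF that(1,3,4,2)]
      group.torus_relations(1)[OF that(1,4,2,3)] group.torus_relations(2)[OF that]
    by (simp_all add: a_def b_def c_def w_def letter_val_def)
  show "w \<in> Rbar ?S {a, b, c}"
  proof (rule RbarI)
    fix Q :: "nat letter list set monoid" and g
    assume Q: "group Q" and g: "g \<in> ?S \<rightarrow> carrier Q"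
    then have e: "g 0 \<in> carrier Q" "g 1 \<in> carrier Q" "g 2 \<in> carrier Q"
      by auto
    let ?h = "\<lambda>r. word_val Q g r = \<one>\<^bsub>Q\<^esub>"
    have iff: "?h b \<Longrightarrow> ?h c \<Longrightarrow> ?h w \<longleftrightarrow> ?h a" "?h a \<Longrightarrow> ?h c \<Longrightarrow> ?h w \<longleftrightarrow> ?h b"
      "?h a \<Longrightarrow> ?h b \<Longrightarrow> ?h w \<longleftrightarrow> ?h c"
      unfolding rel[OF Q e] using group.torus_relations(3-5)[OF Q e] by blast+
    then show "?h w" if "\<forall>r\<in>{a, b, c}. ?h r"
      using that by blast
    have ne: "a \<noteq> b" "a \<noteq> c" "b \<noteq> c"
      by (simp_all add: a_def b_def c_def)
    show "?h r" if r: "r \<in> {a, b, c}" and others: "\<forall>s\<in>{a, b, c} - {r}. ?h s" and w: "?h w" for r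
    proof -
      have others: "r = a \<or> ?h a" "r = b \<or> ?h b" "r = c \<or> ?h c"
        using others by blast+
      consider "r = a" | "r = b" | "r = c"
        using r by blast
      then show ?thesis
        by cases (use others iff ne w in metis)+
    qed
  qed (use F in auto)
  let ?nf = "\<lambda>Q g (i :: int, j :: int, k :: int). g 0 [^]\<^bsub>Q\<^esub> i \<otimes>\<^bsub>Q\<^esub> (g 1 [^]\<^bsub>Q\<^esub> j \<otimes>\<^bsub>Q\<^esub> g 2 [^]\<^bsub>Q\<^esub> k)"
  show "marking lattice3 ?S {a, b, c} lattice3_basis"
  proof (rule markingI_normal_form[OF group_lattice3, where nf = ?nf])
    show "{a, b, c} \<subseteq> carrier (free_group ?S)"
      using F by simp
    show "word_val lattice3 lattice3_basis r = \<one>\<^bsub>lattice3\<^esub>" if "r \<in> {a, b, c}" for r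
      using that by (auto simp: a_def b_def c_def letter_val_def)
    show "\<exists>w. fst ` set w \<subseteq> ?S \<and> h = word_val lattice3 lattice3_basis w" for h
    proof (intro exI conjI)
      let ?W = "\<lambda>s n. replicate (nat \<bar>n\<bar>) (s :: nat, 0 \<le> n)"
      let ?w = "?W 0 (coord3 1 h) @ ?W 1 (coord3 2 h) @ ?W 2 (coord3 3 h)"
      show "fst ` set ?w \<subseteq> ?S"
        by (auto simp: set_replicate_conv_if)
      show "h = word_val lattice3 lattice3_basis ?w"
      proof (rule coord3_eqI)
        show "coord3 i h = coord3 i (word_val lattice3 lattice3_basis ?w)" for i
          using exhaust_3[of i] unfolding coord3_word_val
          by (elim disjE) (simp_all add: sum_list_replicate exponent_def, simp_all add: lattice3_basis_def coord3_def)
      qed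
    qed
    fix Q :: "nat letter list set monoid" and g s and h :: "int \<times> int \<times> int"
    assume Q: "group Q" and g: "g \<in> ?S \<rightarrow> carrier Q"
      and rels: "\<And>r. r \<in> {a, b, c} \<Longrightarrow> word_val Q g r = \<one>\<^bsub>Q\<^esub>"
    then have e: "g 0 \<in> carrier Q" "g 1 \<in> carrier Q" "g 2 \<in> carrier Q"
      by auto
    interpret Q: group Q
      by (rule Q)
    show "?nf Q g \<one>\<^bsub>lattice3\<^esub> = \<one>\<^bsub>Q\<^esub>"
      by (simp add: zero_prod_def)
    assume s: "s \<in> ?S"
    obtain i j k where h: "h = (i, j, k)"
      by (metis prod_cases3)
    have comm: "g 0 \<otimes>\<^bsub>Q\<^esub> g 1 = g 1 \<otimes>\<^bsub>Q\<^esub> g 0" "g 1 \<otimes>\<^bsub>Q\<^esub> g 2 = g 2 \<otimes>\<^bsub>Q\<^esub> g 1"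
      "g 2 \<otimes>\<^bsub>Q\<^esub> g 0 = g 0 \<otimes>\<^bsub>Q\<^esub> g 2"
      using rels[of a] rels[of b] rels[of c] rel[OF Q e] by blast+
    let ?X = "g 0 [^]\<^bsub>Q\<^esub> i" and ?Y = "g 1 [^]\<^bsub>Q\<^esub> j" and ?Z = "g 2 [^]\<^bsub>Q\<^esub> k"
    have cl: "?X \<in> carrier Q" "?Y \<in> carrier Q" "?Z \<in> carrier Q"
      using e by simp_all
    have suc: "g t \<otimes>\<^bsub>Q\<^esub> g t [^]\<^bsub>Q\<^esub> n = g t [^]\<^bsub>Q\<^esub> (1 + n)" if "g t \<in> carrier Q" for t and n :: int
      using Q.int_pow_mult[OF that, of 1 n] that by simp
    have 0: "g 0 \<otimes>\<^bsub>Q\<^esub> (?X \<otimes>\<^bsub>Q\<^esub> (?Y \<otimes>\<^bsub>Q\<^esub> ?Z)) = g 0 [^]\<^bsub>Q\<^esub> (1 + i) \<otimes>\<^bsub>Q\<^esub> (?Y \<otimes>\<^bsub>Q\<^esub> ?Z)"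
      using cl e suc[OF e(1), of i] by (simp add: Q.m_assoc[symmetric])
    have "g 1 \<otimes>\<^bsub>Q\<^esub> ?X = ?X \<otimes>\<^bsub>Q\<^esub> g 1"
      by (rule Q.int_pow_commute[OF e(1,2) comm(1)])
    then have 1: "g 1 \<otimes>\<^bsub>Q\<^esub> (?X \<otimes>\<^bsub>Q\<^esub> (?Y \<otimes>\<^bsub>Q\<^esub> ?Z)) = ?X \<otimes>\<^bsub>Q\<^esub> (g 1 [^]\<^bsub>Q\<^esub> (1 + j) \<otimes>\<^bsub>Q\<^esub> ?Z)"
      using cl e suc[OF e(2), of j] by (metis Q.m_assoc Q.m_closed)
    have "g 2 \<otimes>\<^bsub>Q\<^esub> ?X = ?X \<otimes>\<^bsub>Q\<^esub> g 2"
      by (rule Q.int_pow_commute[OF e(1,3) comm(3)[symmetric]])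
    moreover have "g 2 \<otimes>\<^bsub>Q\<^esub> ?Y = ?Y \<otimes>\<^bsub>Q\<^esub> g 2"
      by (rule Q.int_pow_commute[OF e(2,3) comm(2)])
    ultimately have 2: "g 2 \<otimes>\<^bsub>Q\<^esub> (?X \<otimes>\<^bsub>Q\<^esub> (?Y \<otimes>\<^bsub>Q\<^esub> ?Z)) = ?X \<otimes>\<^bsub>Q\<^esub> (?Y \<otimes>\<^bsub>Q\<^esub> g 2 [^]\<^bsub>Q\<^esub> (1 + k))"
      using cl e suc[OF e(3), of k] by (metis Q.m_assoc Q.m_closed)
    show "?nf Q g h \<in> carrier Q \<and> g s \<otimes>\<^bsub>Q\<^esub> ?nf Q g h = ?nf Q g (lattice3_basis s \<otimes>\<^bsub>lattice3\<^esub> h)"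
      using s cl 0 1 2 by (elim insertE) (simp_all add: h lattice3_basis_def)
  qed auto
qed

lemma weight_lattice3: "weight lattice3 = 24"
proof -
  let ?a = "[(0, True), (1, True), (0, False), (1, False)] :: nat letter list"
    and ?b = "[(1, True), (2, True), (1, False), (2, False)] :: nat letter list"
    and ?c = "[(2, True), (0, True), (2, False), (0, False)] :: nat letter list"
    and ?w = "[(0, True), (1, False), (2, True), (0, False), (1, True), (2, False)] :: nat letter list"
  have P: "({0, 1, 2}, {?a, ?b, ?c}) \<in> presentations lattice3 3"
    unfolding presentations_iff[OF group_lattice3] using torus_presentation(1)
    by (auto simp: carrier_free_group reduced_Cons inv_letter_def)
  have "lam ?a = 6" "lam ?b = 6" "lam ?c = 6" "lam ?w = 6"
    by (simp_all add: eps_def inv_letter_def)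
  then have "phi {0, 1, 2} {?a, ?b, ?c} \<le> 24"
    using phi_le[OF torus_presentation(2)] by simp
  moreover have "card S = 3 \<and> 24 \<le> phi S R"
    if "(S, R) \<in> presentations lattice3 q" "q \<le> 3" for S R q
    using that phi_lattice3_ge[of S R] unfolding presentations_iff[OF group_lattice3] by (meson order_trans)
  ultimately have "weight lattice3 = max 24 (6 * 3 + 2)"
    by (intro weight_of_optimal_presentation[OF P]) simp_all
  then show ?thesis
    by simp
qed

section \<open>Lifting along orbit maps\<close>

text \<open>
  A group \<open>H\<close> acts freely on \<open>E\<close> and the fibres of the open map \<open>p\<close>, which is locally injective, are the orbits. These
  are the regular coverings, stated in a form that is immediate to verify for orbit spaces and for products
  of circles alike.
\<close>

locale deck_covering =
  fixes E :: "'a topology" and B :: "'b topology" and p :: "'a \<Rightarrow> 'b"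
    and H :: "('h, 'm) monoid_scheme" and act :: "'h \<Rightarrow> 'a \<Rightarrow> 'a"
  assumes group_H: "group H"
    and act_cont: "h \<in> carrier H \<Longrightarrow> continuous_map E E (act h)"
    and act_one: "x \<in> topspace E \<Longrightarrow> act \<one>\<^bsub>H\<^esub> x = x"
    and act_mult: "h \<in> carrier H \<Longrightarrow> k \<in> carrier H \<Longrightarrow> x \<in> topspace E \<Longrightarrow>
      act (h \<otimes>\<^bsub>H\<^esub> k) x = act h (act k x)"
    and free: "h \<in> carrier H \<Longrightarrow> x \<in> topspace E \<Longrightarrow> act h x = x \<Longrightarrow> h = \<one>\<^bsub>H\<^esub>"
    and p_cont: "continuous_map E B p" and p_open: "open_map E B p"
    and p_surj: "p ` topspace E = topspace B"
    and fibre: "x \<in> topspace E \<Longrightarrow> y \<in> topspace E \<Longrightarrow> p x = p y \<longleftrightarrow> (\<exists>h\<in>carrier H. y = act h x)"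
    and local_inj: "x \<in> topspace E \<Longrightarrow> \<exists>U. openin E U \<and> x \<in> U \<and> inj_on p U"
begin

lemma act_closed: "h \<in> carrier H \<Longrightarrow> x \<in> topspace E \<Longrightarrow> act h x \<in> topspace E"
  using act_cont[of h] by (auto simp: continuous_map_def)

lemma p_act: "h \<in> carrier H \<Longrightarrow> x \<in> topspace E \<Longrightarrow> p (act h x) = p x"
  using fibre[OF _ act_closed] by metis

lemma act_inj:
  assumes "h \<in> carrier H" "k \<in> carrier H" "x \<in> topspace E" "act h x = act k x"
  shows "h = k"
proof -
  interpret H: group H
    by (rule group_H)
  have "act (inv\<^bsub>H\<^esub> k \<otimes>\<^bsub>H\<^esub> h) x = act (inv\<^bsub>H\<^esub> k) (act k x)"
    using assms by (simp add: act_mult)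
  also have "\<dots> = x"
    using assms(2,3) act_mult[of "inv\<^bsub>H\<^esub> k" k x] by (simp add: act_one)
  finally have "inv\<^bsub>H\<^esub> k \<otimes>\<^bsub>H\<^esub> h = \<one>\<^bsub>H\<^esub>"
    using assms by (intro free) auto
  then have "inv\<^bsub>H\<^esub> (inv\<^bsub>H\<^esub> k) = h"
    using assms by (intro H.inv_equality) (auto simp: H.inv_comm)
  then show ?thesis
    using assms by simp
qed

text \<open>
  The open map \<open>p\<close> restricts to a homeomorphism from a set on which it is injective onto an open set.
\<close>

lemma local_section:
  assumes "b \<in> topspace B"
  obtains V \<sigma> where "openin B V" "b \<in> V" "continuous_map (subtopology B V) E \<sigma>" "\<And>v. v \<in> V \<Longrightarrow> p (\<sigma> v) = v"
proof -
  obtain x where x: "x \<in> topspace E" "b = p x"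
    using assms p_surj by blast
  obtain U where U: "openin E U" "x \<in> U" "inj_on p U"
    using local_inj[OF x(1)] by blast
  let ?V = "p ` U" and ?s = "inv_into U p"
  have V: "openin B ?V"
    using p_open U(1) by (simp add: open_map_def)
  have "continuous_map (subtopology B ?V) E ?s"
    unfolding continuous_map_def
  proof (intro conjI allI impI)
    show "?s \<in> topspace (subtopology B ?V) \<rightarrow> topspace E"
      using openin_subset[OF U(1)] inv_into_into[of _ p U] by auto
    fix W
    assume W: "openin E W"
    have "{v \<in> topspace (subtopology B ?V). ?s v \<in> W} = p ` (U \<inter> W)"
      using openin_subset[OF V] U(3) by (auto simp: inv_into_f_f)
    moreover have "openin (subtopology B ?V) (p ` (U \<inter> W) \<inter> ?V)"
      using p_open openin_Int[OF U(1) W] by (intro openin_subtopology_Int) (simp add: open_map_def)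
    moreover have "p ` (U \<inter> W) \<inter> ?V = p ` (U \<inter> W)"
      by blast
    ultimately show "openin (subtopology B ?V) {v \<in> topspace (subtopology B ?V). ?s v \<in> W}"
      by (simp only:)
  qed
  moreover have "p (?s v) = v" if "v \<in> ?V" for v
    using that by (rule f_inv_into_f)
  ultimately show thesis
    using that[OF V] U(2) x(2) by blast
qed

definition lift_on :: "'c::topological_space set \<Rightarrow> ('c \<Rightarrow> 'b) \<Rightarrow> ('c \<Rightarrow> 'a) \<Rightarrow> bool" where
  "lift_on T F L \<longleftrightarrow> continuous_map (top_of_set T) E L \<and> (\<forall>z\<in>T. p (L z) = F z)"

lemma lift_onD:
  assumes "lift_on T F L"
  shows "continuous_map (top_of_set T) E L" "z \<in> T \<Longrightarrow> p (L z) = F z" "z \<in> T \<Longrightarrow> L z \<in> topspace E"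
  using assms by (auto simp: lift_on_def continuous_map_def)

lemma lift_on_subset: "lift_on T F L \<Longrightarrow> T' \<subseteq> T \<Longrightarrow> lift_on T' F L"
  unfolding lift_on_def by (metis continuous_map_from_subtopology_mono subsetD)

lemma lift_on_act:
  assumes "lift_on T F L" "h \<in> carrier H"
  shows "lift_on T F (act h \<circ> L)"
  using assms lift_onD[OF assms(1)] continuous_map_compose[OF _ act_cont]
  by (auto simp: lift_on_def p_act)

lemma openin_lifts_agree:
  assumes L: "lift_on T F L" and L': "lift_on T F L'"
  shows "openin (top_of_set T) {z \<in> T. L z = L' z}"
  unfolding openin_subopen[of _ "{z \<in> T. L z = L' z}"]
proof
  fix z
  assume "z \<in> {z \<in> T. L z = L' z}"
  then have z: "z \<in> T" "L z = L' z"
    by auto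
  obtain U where U: "openin E U" "L z \<in> U" "inj_on p U"
    using local_inj[OF lift_onD(3)[OF L z(1)]] by blast
  let ?O = "{z \<in> T. L z \<in> U} \<inter> {z \<in> T. L' z \<in> U}"
  have "openin (top_of_set T) ?O"
    using openin_continuous_map_preimage[OF lift_onD(1)[OF L] U(1)]
      openin_continuous_map_preimage[OF lift_onD(1)[OF L'] U(1)] by (intro openin_Int) simp_all
  moreover have "?O \<subseteq> {z \<in> T. L z = L' z}"
    using U(3) lift_onD(2)[OF L] lift_onD(2)[OF L'] by (auto simp: inj_on_def)
  ultimately show "\<exists>O'. openin (top_of_set T) O' \<and> z \<in> O' \<and> O' \<subseteq> {z \<in> T. L z = L' z}"
    using z U(2) by (intro exI[of _ ?O]) auto
qed

text \<open>
  Where two lifts differ, one is a nontrivial translate of the other, and remains so nearby. So the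
  set on which they agree is clopen.
\<close>

lemma lift_unique:
  assumes L: "lift_on T F L" and L': "lift_on T F L'" and T: "connected T"
    and z0: "z0 \<in> T" "L z0 = L' z0" and z: "z \<in> T"
  shows "L z = L' z"
proof (rule ccontr)
  assume "L z \<noteq> L' z"
  let ?A = "{z \<in> T. L z = L' z}" and ?D = "{z \<in> T. L z \<noteq> L' z}"
  have "openin (top_of_set T) ?D"
    unfolding openin_subopen[of _ ?D]
  proof
    fix y
    assume "y \<in> ?D"
    then have y: "y \<in> T" "L y \<noteq> L' y"
      by auto
    obtain h where h: "h \<in> carrier H" "L' y = act h (L y)"
      using fibre[OF lift_onD(3)[OF L y(1)] lift_onD(3)[OF L' y(1)]] lift_onD(2)[OF L y(1)] lift_onD(2)[OF L' y(1)]
      by auto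
    have h1: "h \<noteq> \<one>\<^bsub>H\<^esub>"
      using y(2) h(2) act_one[OF lift_onD(3)[OF L y(1)]] by auto
    let ?O = "{z \<in> T. (act h \<circ> L) z = L' z}"
    have "openin (top_of_set T) ?O"
      by (rule openin_lifts_agree[OF lift_on_act[OF L h(1)] L'])
    moreover have "?O \<subseteq> ?D"
      using free[OF h(1)] h1 lift_onD(3)[OF L] by fastforce
    ultimately show "\<exists>O'. openin (top_of_set T) O' \<and> y \<in> O' \<and> O' \<subseteq> ?D"
      using y(1) h(2) by (intro exI[of _ ?O]) auto
  qed
  moreover have "openin (top_of_set T) ?A"
    by (rule openin_lifts_agree[OF L L'])
  moreover have "?A \<noteq> {}" "?D \<noteq> {}" "T \<subseteq> ?A \<union> ?D" "?A \<inter> ?D = {}"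
    using z0 z \<open>L z \<noteq> L' z\<close> by auto
  ultimately show False
    using T unfolding connected_openin by blast
qed

lemma lift_through_point:
  assumes L: "lift_on T F L" and z: "z \<in> T" and e: "e \<in> topspace E" "p e = F z"
  obtains L' where "lift_on T F L'" "L' z = e"
proof -
  obtain h where "h \<in> carrier H" "e = act h (L z)"
    using fibre[OF lift_onD(3)[OF L z] e(1)] lift_onD(2)[OF L z] e(2) by auto
  then show thesis
    using lift_on_act[OF L] that[of "act h \<circ> L"] by auto
qed

text \<open>
  A translate of the second lift agrees with the first one at a point of the overlap, and hence on all of it.
\<close>

lemma lift_glue:
  assumes 1: "lift_on T1 F L1" and 2: "lift_on T2 F L2" and cl: "closed T1" "closed T2"
    and conn: "connected (T1 \<inter> T2)" and ne: "T1 \<inter> T2 \<noteq> {}"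
  shows "\<exists>L. lift_on (T1 \<union> T2) F L"
proof -
  obtain z0 where z0: "z0 \<in> T1" "z0 \<in> T2"
    using ne by blast
  obtain L2' where L2': "lift_on T2 F L2'" "L2' z0 = L1 z0"
    using lift_through_point[OF 2 z0(2) lift_onD(3)[OF 1 z0(1)] lift_onD(2)[OF 1 z0(1)]] by blast
  have agree: "L1 z = L2' z" if "z \<in> T1 \<inter> T2" for z
    using lift_unique[OF lift_on_subset[OF 1 Int_lower1] lift_on_subset[OF L2'(1) Int_lower2] conn, of z0 z]
      z0 L2'(2) that by simp
  let ?L = "\<lambda>z. if z \<in> T1 then L1 z else L2' z"
  have "continuous_map (top_of_set (T1 \<union> T2)) E ?L"
    unfolding continuous_map_closedin
  proof (intro conjI ballI allI impI)
    show "?L \<in> topspace (top_of_set (T1 \<union> T2)) \<rightarrow> topspace E"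
      using lift_onD(3)[OF 1] lift_onD(3)[OF L2'(1)] by auto
    fix C
    assume C: "closedin E C"
    have "{z \<in> topspace (top_of_set (T1 \<union> T2)). ?L z \<in> C} = {z \<in> T1. L1 z \<in> C} \<union> {z \<in> T2. L2' z \<in> C}"
      using agree by auto
    moreover have "closed {z \<in> T1. L1 z \<in> C}" "closed {z \<in> T2. L2' z \<in> C}"
      using closedin_continuous_map_preimage[OF lift_onD(1)[OF 1] C]
        closedin_continuous_map_preimage[OF lift_onD(1)[OF L2'(1)] C] cl by (auto intro: closedin_closed_trans)
    ultimately show "closedin (top_of_set (T1 \<union> T2)) {z \<in> topspace (top_of_set (T1 \<union> T2)). ?L z \<in> C}"
      by (auto intro!: closed_subset)
  qed
  then have "lift_on (T1 \<union> T2) F ?L"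
    using lift_onD(2)[OF 1] lift_onD(2)[OF L2'(1)] by (auto simp: lift_on_def)
  then show ?thesis
    by blast
qed

lemma lift_locally:
  fixes F :: "'c::metric_space \<Rightarrow> 'b"
  assumes F: "continuous_map (top_of_set Q) B F" and z: "z \<in> Q"
  obtains e where "0 < e" "\<exists>L. lift_on (Q \<inter> ball z e) F L"
proof -
  have "F z \<in> topspace B"
    using F z by (auto simp: continuous_map_def)
  then obtain V \<sigma> where V: "openin B V" "F z \<in> V" "continuous_map (subtopology B V) E \<sigma>"
    "\<And>v. v \<in> V \<Longrightarrow> p (\<sigma> v) = v"
    using local_section by blast
  have "openin (top_of_set Q) {y \<in> Q. F y \<in> V}"
    using openin_continuous_map_preimage[OF F V(1)] by simp
  then obtain e where e: "0 < e" "Q \<inter> ball z e \<subseteq> {y \<in> Q. F y \<in> V}"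
    using z V(2) unfolding openin_contains_ball by (metis (mono_tags, lifting) inf_commute mem_Collect_eq)
  have "continuous_map (top_of_set (Q \<inter> ball z e)) (subtopology B V) F"
    using e(2) continuous_map_from_subtopology_mono[OF F, of "Q \<inter> ball z e"]
    by (auto simp: continuous_map_in_subtopology)
  then have "continuous_map (top_of_set (Q \<inter> ball z e)) E (\<sigma> \<circ> F)"
    using V(3) by (rule continuous_map_compose)
  then have "lift_on (Q \<inter> ball z e) F (\<sigma> \<circ> F)"
    using e(2) V(4) by (auto simp: lift_on_def)
  then show thesis
    using e(1) that by blast
qed

text \<open>Lifts over small squares are glued to strips, and these to the unit square.\<close>

lemma lift_unit_square:
  fixes F :: "real \<times> real \<Rightarrow> 'b"
  assumes F: "continuous_map (top_of_set ({0..1} \<times> {0..1})) B F"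
  shows "\<exists>L. lift_on ({0..1} \<times> {0..1}) F L"
proof -
  let ?Q = "{0..1} \<times> {0..1} :: (real \<times> real) set"
  have strip: "\<exists>\<delta>>0. \<exists>L. lift_on ({0..1} \<times> ({t - \<delta>..t + \<delta>} \<inter> {0..1})) F L" if t: "t \<in> {0..1}" for t
  proof -
    let ?J = "\<lambda>\<delta>. {t - \<delta>..t + \<delta>} \<inter> {0..1}"
    have "0 \<le> (0::real) \<longrightarrow> (1::real) \<le> 1 \<longrightarrow> (\<exists>\<delta>>0. \<exists>L. lift_on ({0..1} \<times> ?J \<delta>) F L)"
    proof (rule Bolzano[where P = "\<lambda>a b. 0 \<le> a \<longrightarrow> b \<le> 1 \<longrightarrow> (\<exists>\<delta>>0. \<exists>L. lift_on ({a..b} \<times> ?J \<delta>) F L)"])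
      show "0 \<le> a \<longrightarrow> c \<le> 1 \<longrightarrow> (\<exists>\<delta>>0. \<exists>L. lift_on ({a..c} \<times> ?J \<delta>) F L)"
        if ab: "0 \<le> a \<longrightarrow> b \<le> 1 \<longrightarrow> (\<exists>\<delta>>0. \<exists>L. lift_on ({a..b} \<times> ?J \<delta>) F L)"
          and bc: "0 \<le> b \<longrightarrow> c \<le> 1 \<longrightarrow> (\<exists>\<delta>>0. \<exists>L. lift_on ({b..c} \<times> ?J \<delta>) F L)"
          and le: "a \<le> b" "b \<le> c" for a b c
      proof (intro impI)
        assume "0 \<le> a" "c \<le> 1"
        then obtain d1 L1 d2 L2 where d: "0 < d1" "lift_on ({a..b} \<times> ?J d1) F L1" "0 < d2"
          "lift_on ({b..c} \<times> ?J d2) F L2"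
          using ab bc le by (meson order_trans)
        let ?d = "min d1 d2"
        have 1: "lift_on ({a..b} \<times> ?J ?d) F L1" "lift_on ({b..c} \<times> ?J ?d) F L2"
          by (rule lift_on_subset[OF d(2)], force, rule lift_on_subset[OF d(4)], force)
        have eq: "{a..b} \<times> ?J ?d \<inter> {b..c} \<times> ?J ?d = {b} \<times> ?J ?d"
          using le by auto
        have "t \<in> ?J ?d"
          using t d by auto
        then have ne: "{a..b} \<times> ?J ?d \<inter> {b..c} \<times> ?J ?d \<noteq> {}"
          unfolding eq by blast
        have conn: "connected ({a..b} \<times> ?J ?d \<inter> {b..c} \<times> ?J ?d)"
          unfolding eq by (intro convex_connected convex_Times convex_Int) auto
        have "\<exists>L. lift_on ({a..b} \<times> ?J ?d \<union> {b..c} \<times> ?J ?d) F L"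
          by (rule lift_glue[OF 1 _ _ conn ne]) (intro closed_Times closed_Int closed_atLeastAtMost)+
        moreover have "{a..b} \<times> ?J ?d \<union> {b..c} \<times> ?J ?d = {a..c} \<times> ?J ?d"
          using le by auto
        ultimately show "\<exists>\<delta>>0. \<exists>L. lift_on ({a..c} \<times> ?J \<delta>) F L"
          using d by (intro exI[of _ ?d]) simp
      qed
      fix s :: real
      assume s: "0 \<le> s" "s \<le> 1"
      then have "(s, t) \<in> ?Q"
        using t by simp
      then obtain e L where e: "0 < e" "lift_on (?Q \<inter> ball (s, t) e) F L"
        using lift_locally[OF F] by blast
      show "\<exists>d>0. \<forall>a b. a \<le> s \<and> s \<le> b \<and> b - a < d \<longrightarrow>
          0 \<le> a \<longrightarrow> b \<le> 1 \<longrightarrow> (\<exists>\<delta>>0. \<exists>L. lift_on ({a..b} \<times> ?J \<delta>) F L)"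
      proof (rule exI[of _ "e / 2"], intro conjI allI impI)
        fix a b
        assume ab: "a \<le> s \<and> s \<le> b \<and> b - a < e / 2" "0 \<le> a" "b \<le> 1"
        have "{a..b} \<times> ?J (e / 2) \<subseteq> ?Q \<inter> ball (s, t) e"
        proof
          fix z
          assume z: "z \<in> {a..b} \<times> ?J (e / 2)"
          then obtain u v where uv: "z = (u, v)" "u \<in> {a..b}" "v \<in> ?J (e / 2)"
            by blast
          have "dist (s, t) (u, v) \<le> \<bar>s - u\<bar> + \<bar>t - v\<bar>"
            using sqrt_sum_squares_le_sum_abs[of "s - u" "t - v"] by (simp add: dist_Pair_Pair dist_real_def)
          also have "\<dots> < e / 2 + e / 2"
            using uv ab by (intro add_less_le_mono) (auto simp: abs_if)
          finally show "z \<in> ?Q \<inter> ball (s, t) e"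
            using uv ab by (auto simp: uv(1))
        qed
        then have "lift_on ({a..b} \<times> ?J (e / 2)) F L"
          by (rule lift_on_subset[OF e(2)])
        then show "\<exists>\<delta>>0. \<exists>L. lift_on ({a..b} \<times> ?J \<delta>) F L"
          using e(1) half_gt_zero by blast
      qed (use e(1) in simp)
    qed simp
    then show ?thesis
      by simp
  qed
  have "0 \<le> (0::real) \<longrightarrow> (1::real) \<le> 1 \<longrightarrow> (\<exists>L. lift_on ({0..1} \<times> {0..1}) F L)"
  proof (rule Bolzano[where P = "\<lambda>c d. 0 \<le> c \<longrightarrow> d \<le> 1 \<longrightarrow> (\<exists>L. lift_on ({0..1} \<times> {c..d}) F L)"])
    show "0 \<le> a \<longrightarrow> c \<le> 1 \<longrightarrow> (\<exists>L. lift_on ({0..1} \<times> {a..c}) F L)"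
      if ab: "0 \<le> a \<longrightarrow> b \<le> 1 \<longrightarrow> (\<exists>L. lift_on ({0..1} \<times> {a..b}) F L)"
        and bc: "0 \<le> b \<longrightarrow> c \<le> 1 \<longrightarrow> (\<exists>L. lift_on ({0..1} \<times> {b..c}) F L)"
        and le: "a \<le> b" "b \<le> c" for a b c
    proof (intro impI)
      assume "0 \<le> a" "c \<le> 1"
      then obtain L1 L2 where 1: "lift_on ({0..1} \<times> {a..b}) F L1" "lift_on ({0..1} \<times> {b..c}) F L2"
        using ab bc le by (meson order_trans)
      have eq: "{0..1} \<times> {a..b} \<inter> {0..1} \<times> {b..c} = {0..1::real} \<times> {b}"
        using le by auto
      have "\<exists>L. lift_on ({0..1} \<times> {a..b} \<union> {0..1} \<times> {b..c}) F L"
      proof (rule lift_glue[OF 1])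
        show "connected ({0..1} \<times> {a..b} \<inter> {0..1::real} \<times> {b..c})"
          unfolding eq by (intro convex_connected convex_Times) auto
        show "{0..1} \<times> {a..b} \<inter> {0..1::real} \<times> {b..c} \<noteq> {}"
          unfolding eq by auto
      qed (intro closed_Times closed_atLeastAtMost)+
      moreover have "{0..1} \<times> {a..b} \<union> {0..1} \<times> {b..c} = {0..1::real} \<times> {a..c}"
        using le by auto
      ultimately show "\<exists>L. lift_on ({0..1} \<times> {a..c}) F L"
        by simp
    qed
    fix t :: real
    assume "0 \<le> t" "t \<le> 1"
    then obtain d L where d: "0 < d" "lift_on ({0..1} \<times> ({t - d..t + d} \<inter> {0..1})) F L"
      using strip[of t] by auto
    show "\<exists>\<delta>>0. \<forall>a b. a \<le> t \<and> t \<le> b \<and> b - a < \<delta> \<longrightarrow> 0 \<le> a \<longrightarrow> b \<le> 1 \<longrightarrow> (\<exists>L. lift_on ({0..1} \<times> {a..b}) F L)"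
    proof (rule exI[of _ d], intro conjI allI impI)
      fix a b
      assume "a \<le> t \<and> t \<le> b \<and> b - a < d" "0 \<le> a" "b \<le> 1"
      then have "{0..1} \<times> {a..b} \<subseteq> {0..1::real} \<times> ({t - d..t + d} \<inter> {0..1})"
        by auto
      then show "\<exists>L. lift_on ({0..1} \<times> {a..b}) F L"
        using lift_on_subset[OF d(2)] by blast
    qed (rule d(1))
  qed simp
  then show ?thesis
    by simp
qed

lemma lift_path:
  fixes q :: "real \<Rightarrow> 'b"
  assumes q: "continuous_map (top_of_set {0..1}) B q" and e: "e \<in> topspace E" "p e = q 0"
  obtains L where "lift_on {0..1} q L" "L 0 = e"
proof -
  have snd: "continuous_map (top_of_set ({0..1} \<times> {0..1})) (top_of_set {0..1}) (snd :: real \<times> real \<Rightarrow> real)"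
    by (auto intro!: continuous_intros)
  have "continuous_map (top_of_set ({0..1} \<times> {0..1})) B (q \<circ> (snd :: real \<times> real \<Rightarrow> real))"
    using snd q by (rule continuous_map_compose)
  then obtain L where L: "lift_on ({0..1} \<times> {0..1}) (q \<circ> snd) (L :: real \<times> real \<Rightarrow> 'a)"
    using lift_unit_square by blast
  have "continuous_map (top_of_set {0..1}) (top_of_set ({0..1} \<times> {0..1})) (\<lambda>t::real. (0::real, t))"
    by (auto intro!: continuous_intros)
  then have "continuous_map (top_of_set {0..1}) E (L \<circ> (\<lambda>t. (0, t)))"
    using lift_onD(1)[OF L] by (rule continuous_map_compose)
  then have "lift_on {0..1} q (L \<circ> (\<lambda>t. (0, t)))"
    using lift_onD(2)[OF L] by (auto simp: lift_on_def)
  then show thesis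
    using lift_through_point[of "{0..1}" q _ 0 e] e that by auto
qed

section \<open>The fundamental group of an orbit space\<close>

text \<open>
  A relation instead of a function, so that no lift has to be chosen.
\<close>

definition lift_ends :: "'a \<Rightarrow> (real \<Rightarrow> 'b) \<Rightarrow> 'h \<Rightarrow> bool" where
  "lift_ends e q h \<longleftrightarrow> (\<exists>L. lift_on {0..1} q L \<and> L 0 = e \<and> L 1 = act h e)"

lemma loops_atD:
  assumes "q \<in> loops_at B b"
  shows "continuous_map (top_of_set {0..1}) B q" "q 0 = b" "q 1 = b"
  using assms by (auto simp: loops_at_def pathin_def)

lemma lift_ends_exists:
  assumes e: "e \<in> topspace E" and q: "q \<in> loops_at B (p e)"
  shows "\<exists>h\<in>carrier H. lift_ends e q h"
proof -
  obtain L where L: "lift_on {0..1} q L" "L 0 = e"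
    using lift_path[OF loops_atD(1)[OF q] e] loops_atD(2)[OF q] by auto
  have "p (L 1) = p e" "L 1 \<in> topspace E"
    using lift_onD(2,3)[OF L(1), of 1] loops_atD(3)[OF q] by auto
  then show ?thesis
    using fibre[OF e, of "L 1"] L by (auto simp: lift_ends_def)
qed

lemma lift_ends_loop:
  assumes e: "e \<in> topspace E" and h: "h \<in> carrier H" and q: "lift_ends e q h"
  shows "q \<in> loops_at B (p e)"
proof -
  obtain L where L: "lift_on {0..1} q L" "L 0 = e" "L 1 = act h e"
    using q by (auto simp: lift_ends_def)
  have "continuous_map (top_of_set {0..1}) B (p \<circ> L)"
    using continuous_map_compose[OF lift_onD(1)[OF L(1)] p_cont] .
  then have "continuous_map (top_of_set {0..1}) B q"
    by (rule continuous_map_eq) (use lift_onD(2)[OF L(1)] in auto)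
  then show ?thesis
    using lift_onD(2)[OF L(1), of 0] lift_onD(2)[OF L(1), of 1] L p_act[OF h e]
    by (simp add: loops_at_def pathin_def)
qed

text \<open>
  The homotopy lifts to the unit square. It is constant on the two sides where the ends of the loops stay
  at the base point, and so is its lift.
\<close>

lemma lift_ends_homotopic:
  assumes e: "e \<in> topspace E" and h: "h \<in> carrier H" and q: "lift_ends e q h"
    and hom: "loop_homotopic B (p e) q r"
  shows "lift_ends e r h"
proof -
  obtain F :: "real \<times> real \<Rightarrow> 'b" where F: "continuous_map (prod_topology (top_of_set {0..1}) (top_of_set {0..1})) B F"
    and F0: "\<forall>t. F (0, t) = q t" and F1: "\<forall>t. F (1, t) = r t"
    and Fe: "\<forall>s\<in>{0..1}. F (s, 0) = p e \<and> F (s, 1) = p e"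
    using hom unfolding loop_homotopic_def homotopic_with_def by blast
  note F0 = F0[rule_format] and F1 = F1[rule_format] and Fe = Fe[rule_format]
  obtain Lq where Lq: "lift_on {0..1} q Lq" "Lq 0 = e" "Lq 1 = act h e"
    using q by (auto simp: lift_ends_def)
  have F': "continuous_map (top_of_set ({0..1} \<times> {0..1})) B F"
    using F by simp
  have "p e = F (0, 0)"
    using Fe[of 0] by simp
  then obtain L where L: "lift_on ({0..1} \<times> {0..1}) F L" "L (0, 0) = e"
    using lift_unit_square[OF F'] lift_through_point[of "{0..1} \<times> {0..1}" F _ "(0, 0)" e] e by auto
  have slice: "lift_on {0..1} (F \<circ> g) (L \<circ> g)"
    if g: "continuous_on {0..1} g" "g \<in> {0..1} \<rightarrow> {0..1} \<times> {0..1}" for g :: "real \<Rightarrow> real \<times> real"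
  proof -
    have "continuous_map (top_of_set {0..1}) (top_of_set ({0..1} \<times> {0..1})) g"
      using g by auto
    then have "continuous_map (top_of_set {0..1}) E (L \<circ> g)"
      using lift_onD(1)[OF L(1)] by (rule continuous_map_compose)
    moreover have "p (L (g z)) = F (g z)" if "z \<in> {0..1}" for z
      using lift_onD(2)[OF L(1), of "g z"] g(2) that by blast
    ultimately show ?thesis
      by (simp add: lift_on_def)
  qed
  have c1: "continuous_on {0..1::real} (\<lambda>s. (s, c::real))" and c2: "continuous_on {0..1::real} (\<lambda>s. (c::real, s))" for c
    by (intro continuous_intros)+
  have conn: "connected {0..1::real}"
    by (rule connected_Icc)
  have const: "lift_on {0..1} (\<lambda>_. p x) (\<lambda>_. x)" if "x \<in> topspace E" for x
    using that by (simp add: lift_on_def)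
  have bottom: "L (s, 0) = e" if "s \<in> {0..1}" for s
  proof -
    have "lift_on {0..1} (\<lambda>_. p e) (L \<circ> (\<lambda>s. (s, 0)))"
      using slice[OF c1[of 0]] Fe by (auto simp: lift_on_def)
    from lift_unique[OF this const[OF e] conn, of 0 s] show ?thesis
      using that L(2) by simp
  qed
  have left: "L (0, t) = Lq t" if "t \<in> {0..1}" for t
  proof -
    have "lift_on {0..1} q (L \<circ> (\<lambda>t. (0, t)))"
      using slice[OF c2[of 0]] F0 by (auto simp: lift_on_def)
    from lift_unique[OF this Lq(1) conn, of 0 t] show ?thesis
      using that L(2) Lq(2) by simp
  qed
  have top: "L (s, 1) = act h e" if "s \<in> {0..1}" for s
  proof -
    have "lift_on {0..1} (\<lambda>_. p (act h e)) (L \<circ> (\<lambda>s. (s, 1)))"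
      using slice[OF c1[of 1]] Fe p_act[OF h e] by (auto simp: lift_on_def)
    from lift_unique[OF this const[OF act_closed[OF h e]] conn, of 0 s] show ?thesis
      using that left[of 1] Lq(3) by simp
  qed
  have "lift_on {0..1} r (L \<circ> (\<lambda>t. (1, t)))"
    using slice[OF c2[of 1]] F1 by (auto simp: lift_on_def)
  then show ?thesis
    using bottom[of 1] top[of 1] unfolding lift_ends_def by (intro exI[of _ "L \<circ> (\<lambda>t. (1, t))"]) simp
qed

lemma lift_ends_unique:
  assumes e: "e \<in> topspace E" and h: "h \<in> carrier H" "k \<in> carrier H" and q: "lift_ends e q h" "lift_ends e q k"
  shows "h = k"
proof -
  obtain L L' where "lift_on {0..1} q L" "L 0 = e" "L 1 = act h e" "lift_on {0..1} q L'" "L' 0 = e" "L' 1 = act k e"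
    using q by (auto simp: lift_ends_def)
  then have "act h e = act k e"
    using lift_unique[of "{0..1}" q L L' 0 1] connected_Icc[of "0::real" 1] by simp
  then show ?thesis
    using act_inj e h by blast
qed

text \<open>
  The lift of the second loop is moved by \<open>h\<close> to start where the first lift ends; it then ends at \<open>act h (act k e)\<close>,
  which is why joining loops corresponds to the product in this order.
\<close>

lemma lift_ends_join:
  assumes e: "e \<in> topspace E" and h: "h \<in> carrier H" "k \<in> carrier H" and q: "lift_ends e q h" and r: "lift_ends e r k"
  shows "lift_ends e (loop_join q r) (h \<otimes>\<^bsub>H\<^esub> k)"
proof -
  obtain L where L: "lift_on {0..1} q L" "L 0 = e" "L 1 = act h e"
    using q by (auto simp: lift_ends_def)
  obtain M where M: "lift_on {0..1} r M" "M 0 = e" "M 1 = act k e"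
    using r by (auto simp: lift_ends_def)
  let ?M = "act h \<circ> M"
  have M': "lift_on {0..1} r ?M"
    by (rule lift_on_act[OF M(1) h(1)])
  let ?L = "loop_join L ?M"
  have "continuous_map (top_of_set {0..1}) E ?L"
    unfolding continuous_map_closedin
  proof (intro conjI ballI allI impI)
    show "?L \<in> topspace (top_of_set {0..1}) \<rightarrow> topspace E"
      using lift_onD(3)[OF L(1)] lift_onD(3)[OF M'] by (auto simp: loop_join_def)
    fix C
    assume C: "closedin E C"
    have "continuous_map (top_of_set {0..1/2}) (top_of_set {0..1}) (\<lambda>t::real. 2 * t)"
      "continuous_map (top_of_set {1/2..1}) (top_of_set {0..1}) (\<lambda>t::real. 2 * t - 1)"
      by (auto intro!: continuous_intros)
    then have "continuous_map (top_of_set {0..1/2}) E (L \<circ> (\<lambda>t::real. 2 * t))"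
      "continuous_map (top_of_set {1/2..1}) E (?M \<circ> (\<lambda>t::real. 2 * t - 1))"
      using lift_onD(1)[OF L(1)] lift_onD(1)[OF M'] by (blast intro: continuous_map_compose)+
    then have "closed {t \<in> {0..1/2}. L (2 * t) \<in> C}" "closed {t \<in> {1/2..1}. ?M (2 * t - 1) \<in> C}"
      using C by (auto dest!: closedin_continuous_map_preimage[where C = C] intro: closedin_closed_trans)
    moreover have "{t \<in> topspace (top_of_set {0..1}). ?L t \<in> C} =
        {t \<in> {0..1/2}. L (2 * t) \<in> C} \<union> {t \<in> {1/2..1}. ?M (2 * t - 1) \<in> C}" (is "?X = ?Y")
    proof (rule Set.set_eqI)
      fix t :: real
      have "?M 0 = L 1"
        using L(3) M(2) by simp
      show "t \<in> ?X \<longleftrightarrow> t \<in> ?Y"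
      proof (cases "t = 1/2")
        case True
        show ?thesis
          unfolding True using \<open>?M 0 = L 1\<close> by (simp add: loop_join_def)
      next
        case False
        then show ?thesis
          by (auto simp: loop_join_def)
      qed
    qed
    ultimately show "closedin (top_of_set {0..1}) {t \<in> topspace (top_of_set {0..1}). ?L t \<in> C}"
      by (metis (no_types, lifting) closed_Un closed_subset mem_Collect_eq subsetI topspace_euclidean_subtopology)
  qed
  then have "lift_on {0..1} (loop_join q r) ?L"
    using lift_onD(2)[OF L(1)] lift_onD(2)[OF M'] by (auto simp: lift_on_def loop_join_def)
  moreover have "?L 0 = e" "?L 1 = act (h \<otimes>\<^bsub>H\<^esub> k) e"
    using L M act_mult[OF h e] by (simp_all add: loop_join_def)
  ultimately show ?thesis
    by (auto simp: lift_ends_def)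
qed

end

text \<open>
  Simple connectivity of \<open>E\<close>, in terms of paths with fixed ends in an arbitrary topology.
\<close>

locale universal_deck_covering = deck_covering +
  assumes path_conn: "x \<in> topspace E \<Longrightarrow> y \<in> topspace E \<Longrightarrow> \<exists>g. pathin E g \<and> g 0 = x \<and> g 1 = y"
    and simply_conn: "\<lbrakk>pathin E g; pathin E g'; g' 0 = g 0; g' 1 = g 1\<rbrakk> \<Longrightarrow>
      homotopic_with (\<lambda>r. r 0 = g 0 \<and> r 1 = g 1) (top_of_set {0..1}) E g g'"
begin

lemma lift_ends_imp_homotopic:
  assumes e: "e \<in> topspace E" and h: "h \<in> carrier H" and q: "lift_ends e q h" and r: "lift_ends e r h"
  shows "loop_homotopic B (p e) q r"
proof -
  obtain L where L: "lift_on {0..1} q L" "L 0 = e" "L 1 = act h e"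
    using q by (auto simp: lift_ends_def)
  obtain M where M: "lift_on {0..1} r M" "M 0 = e" "M 1 = act h e"
    using r by (auto simp: lift_ends_def)
  let ?P = "\<lambda>r. r 0 = p e \<and> r 1 = p e"
  have "homotopic_with (\<lambda>r. r 0 = L 0 \<and> r 1 = L 1) (top_of_set {0..1}) E L M"
    using lift_onD(1)[OF L(1)] lift_onD(1)[OF M(1)] L M by (intro simply_conn) (auto simp: pathin_def)
  then have 1: "homotopic_with ?P (top_of_set {0..1}) B (p \<circ> L) (p \<circ> M)"
    by (rule homotopic_with_compose_continuous_map_left[OF _ p_cont]) (use L p_act[OF h e] in auto)
  have 2: "homotopic_with ?P (top_of_set {0..1}) B (p \<circ> K) s"
    if K: "lift_on {0..1} s K" "K 0 = e" "K 1 = act h e" for s and K :: "real \<Rightarrow> 'a"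
  proof (rule homotopic_with_equal)
    show "continuous_map (top_of_set {0..1}) B (p \<circ> K)"
      using continuous_map_compose[OF lift_onD(1)[OF K(1)] p_cont] .
    show "(p \<circ> K) t = s t" if "t \<in> topspace (top_of_set {0..1})" for t
      using lift_onD(2)[OF K(1)] that by simp
    show "?P (p \<circ> K)"
      using K p_act[OF h e] by simp
    then show "?P s"
      using lift_onD(2)[OF K(1), of 0] lift_onD(2)[OF K(1), of 1] by auto
  qed
  show ?thesis
    unfolding loop_homotopic_def
    using homotopic_with_trans[OF homotopic_with_trans[OF homotopic_with_symD[OF 2[OF L]] 1] 2[OF M]] .
qed

lemma lift_ends_surj:
  assumes e: "e \<in> topspace E" and h: "h \<in> carrier H"
  shows "\<exists>q. lift_ends e q h"
proof -
  obtain g where g: "pathin E g" "g 0 = e" "g 1 = act h e"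
    using path_conn[OF e act_closed[OF h e]] by blast
  then have "lift_on {0..1} (p \<circ> g) g"
    by (simp add: lift_on_def pathin_def)
  then show ?thesis
    using g unfolding lift_ends_def by blast
qed

lemma loop_class_eq:
  assumes e: "e \<in> topspace E" and h: "h \<in> carrier H" and q: "lift_ends e q h"
  shows "loop_class B (p e) q = {r. lift_ends e r h}"
  using lift_ends_homotopic[OF e h q] lift_ends_imp_homotopic[OF e h q] lift_ends_loop[OF e h]
  by (auto simp: loop_class_def)

text \<open>
  An element \<open>h\<close> corresponds to the set of all loops whose lift from \<open>e\<close> ends at \<open>act h e\<close>. Such sets are
  exactly the classes of loops, so neither the product on classes nor its group laws
  have to be examined separately.
\<close>

theorem deck_group_iso_fundamental_group:
  assumes "b \<in> topspace B"
  shows "H \<cong> fundamental_group B b"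
proof -
  interpret H: group H
    by (rule group_H)
  obtain e where e: "e \<in> topspace E" and b: "b = p e"
    using assms p_surj by blast
  let ?\<Phi> = "\<lambda>h. {q. lift_ends e q h}" and ?G = "fundamental_group B b"
  have \<Phi>: "?\<Phi> h = loop_class B b q" if "h \<in> carrier H" "lift_ends e q h" for h q
    using loop_class_eq[OF e that] by (simp add: b)
  have car: "?\<Phi> ` carrier H = carrier ?G"
  proof
    show "?\<Phi> ` carrier H \<subseteq> carrier ?G"
    proof
      fix A
      assume "A \<in> ?\<Phi> ` carrier H"
      then obtain h where h: "h \<in> carrier H" "A = ?\<Phi> h"
        by blast
      obtain q where q: "lift_ends e q h"
        using lift_ends_surj[OF e h(1)] by blast
      have "q \<in> loops_at B b"
        using lift_ends_loop[OF e h(1) q] by (simp add: b)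
      then show "A \<in> carrier ?G"
        using \<Phi>[OF h(1) q] h(2) by (simp add: fundamental_group_def)
    qed
    show "carrier ?G \<subseteq> ?\<Phi> ` carrier H"
    proof
      fix A
      assume "A \<in> carrier ?G"
      then obtain q where q: "q \<in> loops_at B b" "A = loop_class B b q"
        by (auto simp: fundamental_group_def)
      then obtain h where h: "h \<in> carrier H" "lift_ends e q h"
        using lift_ends_exists[OF e, of q] by (auto simp: b)
      then show "A \<in> ?\<Phi> ` carrier H"
        using \<Phi>[OF h] q(2) by blast
    qed
  qed
  have "?\<Phi> \<in> hom H ?G"
  proof (rule homI)
    show "?\<Phi> h \<in> carrier ?G" if "h \<in> carrier H" for h
      using car that by blast
    fix h k
    assume h: "h \<in> carrier H" and k: "k \<in> carrier H"
    obtain q0 where q0: "lift_ends e q0 h"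
      using lift_ends_surj[OF e h] by blast
    obtain r0 where r0: "lift_ends e r0 k"
      using lift_ends_surj[OF e k] by blast
    have "loop_class B b (loop_join q r) = ?\<Phi> (h \<otimes>\<^bsub>H\<^esub> k)" if "q \<in> ?\<Phi> h" "r \<in> ?\<Phi> k" for q r
      using \<Phi>[OF H.m_closed[OF h k] lift_ends_join[OF e h k, of q r]] that by simp
    then have "(\<Union>q\<in>?\<Phi> h. \<Union>r\<in>?\<Phi> k. loop_class B b (loop_join q r)) = (\<Union>q\<in>?\<Phi> h. \<Union>r\<in>?\<Phi> k. ?\<Phi> (h \<otimes>\<^bsub>H\<^esub> k))"
      by (intro SUP_cong refl) blast
    also have "\<dots> = ?\<Phi> (h \<otimes>\<^bsub>H\<^esub> k)"
      using q0 r0 by blast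
    finally show "?\<Phi> (h \<otimes>\<^bsub>H\<^esub> k) = ?\<Phi> h \<otimes>\<^bsub>?G\<^esub> ?\<Phi> k"
      by (simp add: fundamental_group_def)
  qed
  moreover have "inj_on ?\<Phi> (carrier H)"
  proof (rule inj_onI)
    fix h k
    assume h: "h \<in> carrier H" and k: "k \<in> carrier H" and eq: "?\<Phi> h = ?\<Phi> k"
    obtain q where q: "lift_ends e q h"
      using lift_ends_surj[OF e h] by blast
    then have "lift_ends e q k"
      using eq by blast
    then show "h = k"
      using lift_ends_unique[OF e h k q] by blast
  qed
  ultimately have "?\<Phi> \<in> iso H ?G"
    using car by (simp add: iso_def bij_betw_def)
  then show ?thesis
    by (auto simp: is_iso_def)
qed

end

section \<open>Orbit spaces of isometric actions\<close>

lemma (in universal_deck_covering) space_weight_eq: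
  assumes "topspace B \<noteq> {}"
  shows "space_weight B = weight H"
proof -
  have "(SOME x. x \<in> topspace B) \<in> topspace B"
    using assms some_in_eq by blast
  then show ?thesis
    unfolding space_weight_def
    by (intro weight_cong[OF group_H] deck_group_iso_fundamental_group)
qed

lemma universal_deck_coveringI:
  fixes S :: "'a::real_normed_vector set"
  assumes dc: "deck_covering (top_of_set S) B p H act" and S: "simply_connected S"
  shows "universal_deck_covering (top_of_set S) B p H act"
proof -
  interpret deck_covering "top_of_set S" B p H act
    by (rule dc)
  have pc: "path_connected S"
    and hom: "\<And>g g'. \<lbrakk>path g; path_image g \<subseteq> S; path g'; path_image g' \<subseteq> S; pathstart g' = pathstart g;
      pathfinish g' = pathfinish g\<rbrakk> \<Longrightarrow> homotopic_paths S g g'"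
    using S unfolding simply_connected_eq_homotopic_paths by blast+
  have path: "pathin (top_of_set S) g \<longleftrightarrow> path g \<and> path_image g \<subseteq> S" for g
    by (auto simp: pathin_canon_iff path_image_def)
  show ?thesis
  proof unfold_locales
    fix x y
    assume "x \<in> topspace (top_of_set S)" "y \<in> topspace (top_of_set S)"
    then show "\<exists>g. pathin (top_of_set S) g \<and> g 0 = x \<and> g 1 = y"
      using pc unfolding path_connected_def path pathstart_def pathfinish_def by simp
  next
    fix g g'
    assume "pathin (top_of_set S) g" "pathin (top_of_set S) g'" "g' 0 = g 0" "g' 1 = g 1"
    then have "homotopic_paths S g g'"
      by (intro hom) (auto simp: path pathstart_def pathfinish_def)
    then show "homotopic_with (\<lambda>r. r 0 = g 0 \<and> r 1 = g 1) (top_of_set {0..1}) (top_of_set S) g g'"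
      by (simp add: homotopic_paths_def pathstart_def pathfinish_def)
  qed
qed

text \<open>
  If all nontrivial isometries in the group move \<open>x\<close> by at least \<open>d\<close>, then the ball of radius \<open>d / 2\<close> around \<open>x\<close> meets
  no orbit twice.
\<close>

lemma orbit_space_deck_covering:
  fixes S :: "'a::real_normed_vector set"
  assumes H: "group H"
    and closed: "\<And>h x. h \<in> carrier H \<Longrightarrow> x \<in> S \<Longrightarrow> act h x \<in> S"
    and isometry: "\<And>h x y. h \<in> carrier H \<Longrightarrow> x \<in> S \<Longrightarrow> y \<in> S \<Longrightarrow> dist (act h x) (act h y) = dist x y"
    and one: "\<And>x. x \<in> S \<Longrightarrow> act \<one>\<^bsub>H\<^esub> x = x"
    and mult: "\<And>h k x. h \<in> carrier H \<Longrightarrow> k \<in> carrier H \<Longrightarrow> x \<in> S \<Longrightarrow> act (h \<otimes>\<^bsub>H\<^esub> k) x = act h (act k x)"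
    and separated: "\<And>x. x \<in> S \<Longrightarrow> \<exists>d>0. \<forall>h\<in>carrier H - {\<one>\<^bsub>H\<^esub>}. d \<le> dist x (act h x)"
  shows "deck_covering (top_of_set S) (orbit_space (top_of_set S) (act ` carrier H))
    (\<lambda>x. (\<lambda>g. g x) ` act ` carrier H) H act"
proof -
  interpret H: group H
    by (rule H)
  let ?p = "\<lambda>x. (\<lambda>g. g x) ` act ` carrier H" and ?B = "orbit_space (top_of_set S) (act ` carrier H)"
  have quot: "quotient_map (top_of_set S) ?B ?p"
    unfolding orbit_space_def by (rule quotient_map_quotient_topology)
  have cont: "continuous_map (top_of_set S) (top_of_set S) (act h)" if "h \<in> carrier H" for h
    using closed isometry that by (auto simp: continuous_on_iff)
  have orbit: "?p (act h x) = ?p x" if h: "h \<in> carrier H" and x: "x \<in> S" for h x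
  proof -
    have 1: "act k (act h x) = act (k \<otimes>\<^bsub>H\<^esub> h) x" if "k \<in> carrier H" for k
      using mult[OF that h x] by simp
    have 2: "act k x = act (k \<otimes>\<^bsub>H\<^esub> inv\<^bsub>H\<^esub> h) (act h x)" if k: "k \<in> carrier H" for k
    proof -
      have "act (k \<otimes>\<^bsub>H\<^esub> inv\<^bsub>H\<^esub> h) (act h x) = act (k \<otimes>\<^bsub>H\<^esub> inv\<^bsub>H\<^esub> h \<otimes>\<^bsub>H\<^esub> h) x"
        using mult[OF _ h x, of "k \<otimes>\<^bsub>H\<^esub> inv\<^bsub>H\<^esub> h"] h k by simp
      then show ?thesis
        using h k by (simp add: H.m_assoc)
    qed
    show ?thesis
      unfolding image_image
    proof (intro equalityI image_subsetI)
      fix k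
      assume k: "k \<in> carrier H"
      show "act k (act h x) \<in> (\<lambda>k. act k x) ` carrier H"
        using 1[OF k] H.m_closed[OF k h] by (rule image_eqI)
      show "act k x \<in> (\<lambda>k. act k (act h x)) ` carrier H"
        using 2[OF k] H.m_closed[OF k H.inv_closed[OF h]] by (rule image_eqI)
    qed
  qed
  have fibre: "?p x = ?p y \<longleftrightarrow> (\<exists>h\<in>carrier H. y = act h x)" if x: "x \<in> S" and y: "y \<in> S" for x y
  proof
    assume "?p x = ?p y"
    moreover have "act \<one>\<^bsub>H\<^esub> y \<in> ?p y"
      by blast
    ultimately show "\<exists>h\<in>carrier H. y = act h x"
      using one[OF y] by auto
  next
    assume "\<exists>h\<in>carrier H. y = act h x"
    then show "?p x = ?p y"
      using orbit x by blast
  qed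
  have "open_map (top_of_set S) ?B ?p"
    unfolding open_map_def
  proof (intro allI impI)
    fix U
    assume U: "openin (top_of_set S) U"
    have US: "U \<subseteq> S"
      using openin_subset[OF U] by simp
    have "{x \<in> S. ?p x \<in> ?p ` U} = (\<Union>h\<in>carrier H. {x \<in> S. act h x \<in> U})" (is "?X = ?Y")
    proof (rule Set.set_eqI)
      fix x
      have "(\<exists>u\<in>U. ?p x = ?p u) \<longleftrightarrow> (\<exists>u\<in>U. \<exists>h\<in>carrier H. u = act h x)" if "x \<in> S"
        using fibre[OF that] US by blast
      then show "x \<in> ?X \<longleftrightarrow> x \<in> ?Y"
        by auto
    qed
    moreover have "openin (top_of_set S) ?Y"
      using openin_continuous_map_preimage[OF cont U] by (intro openin_Union) auto
    ultimately have "openin (top_of_set S) ?X"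
      by simp
    moreover have "?p ` U \<subseteq> ?p ` topspace (top_of_set S)"
      using US by auto
    ultimately show "openin ?B (?p ` U)"
      unfolding orbit_space_def openin_quotient_topology by simp
  qed
  moreover have "\<exists>U. openin (top_of_set S) U \<and> x \<in> U \<and> inj_on ?p U" if x: "x \<in> S" for x
  proof -
    obtain d where d: "0 < d" "\<forall>h\<in>carrier H - {\<one>\<^bsub>H\<^esub>}. d \<le> dist x (act h x)"
      using separated[OF x] by blast
    have "inj_on ?p (S \<inter> ball x (d / 2))"
    proof (rule inj_onI)
      fix y z
      assume y: "y \<in> S \<inter> ball x (d / 2)" and z: "z \<in> S \<inter> ball x (d / 2)" and "?p y = ?p z"
      then obtain h where h: "h \<in> carrier H" "z = act h y"
        using fibre by blast
      have "dist x (act h x) \<le> dist x z + dist (act h y) (act h x)"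
        using dist_triangle[of x "act h x" z] by (simp add: h(2))
      also have "\<dots> < d / 2 + d / 2"
        using y z isometry[OF h(1), of y x] x by (intro add_strict_mono) (auto simp: dist_commute)
      finally have "h = \<one>\<^bsub>H\<^esub>"
        using d(2) h(1) by force
      then show "y = z"
        using h(2) one y by simp
    qed
    moreover have "openin (top_of_set S) (S \<inter> ball x (d / 2))"
      by (simp add: openin_open_Int)
    ultimately show ?thesis
      using x d(1) by (intro exI[of _ "S \<inter> ball x (d / 2)"]) simp
  qed
  moreover have "h = \<one>\<^bsub>H\<^esub>" if "h \<in> carrier H" "x \<in> S" "act h x = x" for h x
    using separated[OF that(2)] that by force
  ultimately show ?thesis
    using H cont one mult fibre quotient_imp_continuous_map[OF quot] quotient_imp_surjective_map[OF quot]
    by unfold_locales auto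
qed

lemma orbit_space_weight:
  fixes S :: "'a::real_normed_vector set"
  assumes "group H"
    and "\<And>h x. h \<in> carrier H \<Longrightarrow> x \<in> S \<Longrightarrow> act h x \<in> S"
    and "\<And>h x y. h \<in> carrier H \<Longrightarrow> x \<in> S \<Longrightarrow> y \<in> S \<Longrightarrow> dist (act h x) (act h y) = dist x y"
    and "\<And>x. x \<in> S \<Longrightarrow> act \<one>\<^bsub>H\<^esub> x = x"
    and "\<And>h k x. h \<in> carrier H \<Longrightarrow> k \<in> carrier H \<Longrightarrow> x \<in> S \<Longrightarrow> act (h \<otimes>\<^bsub>H\<^esub> k) x = act h (act k x)"
    and "\<And>x. x \<in> S \<Longrightarrow> \<exists>d>0. \<forall>h\<in>carrier H - {\<one>\<^bsub>H\<^esub>}. d \<le> dist x (act h x)"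
    and "simply_connected S" "S \<noteq> {}"
  shows "space_weight (orbit_space (top_of_set S) (act ` carrier H)) = weight H"
proof -
  interpret universal_deck_covering "top_of_set S" "orbit_space (top_of_set S) (act ` carrier H)"
    "\<lambda>x. (\<lambda>g. g x) ` act ` carrier H" H act
    by (rule universal_deck_coveringI[OF orbit_space_deck_covering]) (use assms in blast)+
  show ?thesis
    using assms(8) by (intro space_weight_eq) (simp add: orbit_space_def)
qed

lemma finite_free_separated:
  fixes x :: "'a::metric_space"
  assumes "finite A" "\<And>h. h \<in> A \<Longrightarrow> act h x \<noteq> x"
  shows "\<exists>d>0. \<forall>h\<in>A. d \<le> dist x (act h x)"
proof (cases "A = {}")
  case True
  then show ?thesis
    by (intro exI[of _ 1]) simp
next
  case False
  let ?D = "(\<lambda>h. dist x (act h x)) ` A"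
  have "0 < Min ?D"
    using assms False by (subst Min_gr_iff) (auto, metis)
  moreover have "\<forall>h\<in>A. Min ?D \<le> dist x (act h x)"
    using assms(1) by simp
  ultimately show ?thesis
    by blast
qed

section \<open>Spherical space forms\<close>

lemma S3_sphere: "S3 = top_of_set (sphere 0 1)"
proof -
  have "{(z1, z2). (cmod z1)\<^sup>2 + (cmod z2)\<^sup>2 = 1} = sphere (0 :: complex \<times> complex) 1"
    by (auto simp: norm_Pair real_sqrt_eq_1_iff)
  then show ?thesis
    by (simp add: S3_def)
qed

lemma S3_orbit_space_weight:
  assumes H: "group H" "finite (carrier H)"
    and norm: "\<And>h x. h \<in> carrier H \<Longrightarrow> norm (act h x) = norm x"
    and diff: "\<And>h x y. h \<in> carrier H \<Longrightarrow> act h x - act h y = act h (x - y)"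
    and one: "\<And>x. act \<one>\<^bsub>H\<^esub> x = x"
    and mult: "\<And>h k x. h \<in> carrier H \<Longrightarrow> k \<in> carrier H \<Longrightarrow> act (h \<otimes>\<^bsub>H\<^esub> k) x = act h (act k x)"
    and free: "\<And>h x. h \<in> carrier H \<Longrightarrow> norm x = 1 \<Longrightarrow> act h x = x \<Longrightarrow> h = \<one>\<^bsub>H\<^esub>"
    and \<Gamma>: "\<Gamma> = act ` carrier H"
  shows "space_weight (orbit_space S3 \<Gamma>) = weight H"
  unfolding S3_sphere \<Gamma>
proof (rule orbit_space_weight[OF H(1)])
  show "dist (act h x) (act h y) = dist x y" if "h \<in> carrier H" for h x y
    using norm[OF that, of "x - y"] diff[OF that, of x y] by (simp add: dist_norm)
  show "\<exists>d>0. \<forall>h\<in>carrier H - {\<one>\<^bsub>H\<^esub>}. d \<le> dist x (act h x)" if "x \<in> sphere 0 1" for x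
    using that H(2) free[of _ x] by (intro finite_free_separated) auto
  show "simply_connected (sphere (0 :: complex \<times> complex) 1)"
    by (rule simply_connected_sphere) simp
  have "(1, 0) \<in> sphere (0 :: complex \<times> complex) 1"
    by (simp add: norm_Pair)
  then show "sphere (0 :: complex \<times> complex) 1 \<noteq> {}"
    by blast
qed (use norm one mult in auto)

lemma space_weight_RP3: "space_weight RP3 = weight (integer_mod_group 2)"
  unfolding RP3_def
proof (rule S3_orbit_space_weight[where act = "\<lambda>k x. if k = 0 then x else - x"])
  have c: "carrier (integer_mod_group 2) = {0, 1}"
    by (auto simp: carrier_integer_mod_group)
  show "finite (carrier (integer_mod_group 2))"
    by (simp add: c)
  show "{\<lambda>z. z, \<lambda>z. - z} = (\<lambda>k x. if k = 0 then x else - x) ` carrier (integer_mod_group 2)"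
    by (simp add: c)
  show "(if h \<otimes>\<^bsub>integer_mod_group 2\<^esub> k = 0 then x else - x) = (if h = 0 then if k = 0 then x else - x else - (if k = 0 then x else - x))"
    if "h \<in> carrier (integer_mod_group 2)" "k \<in> carrier (integer_mod_group 2)" for h k and x :: "complex \<times> complex"
    using that by (auto simp: c)
  fix h and x :: "complex \<times> complex"
  assume h: "h \<in> carrier (integer_mod_group 2)" and x: "norm x = 1" "(if h = 0 then x else - x) = x"
  show "h = \<one>\<^bsub>integer_mod_group 2\<^esub>"
  proof (rule ccontr)
    assume "h \<noteq> \<one>\<^bsub>integer_mod_group 2\<^esub>"
    then have "- x = x"
      using x by simp
    then have "x + x = 0"
      by (metis add.right_inverse)
    then have "2 *\<^sub>R x = 0"
      by (simp add: scaleR_2)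
    then show False
      using x(1) by simp
  qed
qed auto

lemma lens_rotation_power:
  "(lens_rotation p q ^^ k) (z1, z2) =
    (cis (2 * pi * real k / real p) * z1, cis (2 * pi * real q * real k / real p) * z2)"
proof (induction k)
  case (Suc k)
  have "2 * pi * real (Suc k) / real p = 2 * pi / real p + 2 * pi * real k / real p"
    "2 * pi * real q * real (Suc k) / real p = 2 * pi * real q / real p + 2 * pi * real q * real k / real p"
    by (simp_all add: field_simps add_divide_distrib[symmetric])
  then show ?case
    using Suc by (simp add: lens_rotation_def mult.assoc[symmetric] cis_mult)
qed simp

lemma cis_eq_1_imp_dvd:
  assumes "0 < p" "cis (2 * pi * real k / real p) = 1"
  shows "p dvd k"
proof -
  have "cos (2 * pi * real k / real p) = 1"
    using assms(2) by (simp add: complex_eq_iff)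
  then obtain n :: int where "2 * pi * real k / real p = of_int n * 2 * pi"
    unfolding cos_one_2pi_int by auto
  then have "real k = real_of_int n * real p"
    using assms(1) by (simp add: field_simps)
  then have "int k = n * int p"
    by (metis of_int_eq_iff of_int_mult of_int_of_nat_eq)
  then show ?thesis
    by (metis dvd_triv_right int_dvd_int_iff)
qed

lemma cis_2pi_nat: "cis (2 * pi * real k) = 1"
  using cis_multiple_2pi[of "real k"] by simp

text \<open>
  Coprimality makes the action free on the circle \<open>z1 = 0\<close> as well.
\<close>

lemma space_weight_lens_space:
  assumes p: "0 < p" and pq: "coprime p q"
  shows "space_weight (lens_space p q) = weight (integer_mod_group p)"
  unfolding lens_space_def
proof (rule S3_orbit_space_weight[where act = "\<lambda>k. lens_rotation p q ^^ nat k"])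
  let ?r = "lens_rotation p q"
  have c: "carrier (integer_mod_group p) = {0..<int p}"
    using p by (simp add: carrier_integer_mod_group)
  show "finite (carrier (integer_mod_group p))"
    by (simp add: c)
  have rp: "(?r ^^ p) = id"
  proof
    fix z
    have "2 * pi * real q * real p / real p = 2 * pi * real q" "2 * pi * real p / real p = 2 * pi * real 1"
      using p by simp_all
    then show "(?r ^^ p) z = id z"
      by (cases z) (simp only: lens_rotation_power cis_2pi_nat, simp)
  qed
  have rmod: "?r ^^ k = ?r ^^ (k mod p)" for k
  proof -
    have "?r ^^ k = (?r ^^ p) ^^ (k div p) \<circ> ?r ^^ (k mod p)"
      by (simp add: funpow_mult funpow_add[symmetric])
    then show ?thesis
      by (simp add: rp)
  qed
  show "range (\<lambda>k::nat. ?r ^^ k) = (\<lambda>k. ?r ^^ nat k) ` carrier (integer_mod_group p)"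
  proof
    show "range (\<lambda>k::nat. ?r ^^ k) \<subseteq> (\<lambda>k. ?r ^^ nat k) ` carrier (integer_mod_group p)"
    proof
      fix g
      assume "g \<in> range (\<lambda>k::nat. ?r ^^ k)"
      then obtain k where "g = ?r ^^ k"
        by blast
      then have "g = ?r ^^ nat (int (k mod p))"
        using rmod[of k] by simp
      moreover have "int (k mod p) \<in> carrier (integer_mod_group p)"
        using p by (simp add: c)
      ultimately show "g \<in> (\<lambda>k. ?r ^^ nat k) ` carrier (integer_mod_group p)"
        by blast
    qed
  qed blast
  show "(?r ^^ nat (h \<otimes>\<^bsub>integer_mod_group p\<^esub> k)) x = (?r ^^ nat h) ((?r ^^ nat k) x)"
    if "h \<in> carrier (integer_mod_group p)" "k \<in> carrier (integer_mod_group p)" for h k x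
  proof -
    have "nat (h \<otimes>\<^bsub>integer_mod_group p\<^esub> k) = (nat h + nat k) mod p"
      using that by (simp add: c nat_mod_distrib nat_add_distrib)
    then have "(?r ^^ nat (h \<otimes>\<^bsub>integer_mod_group p\<^esub> k)) x = (?r ^^ (nat h + nat k)) x"
      using rmod[of "nat h + nat k"] by (simp only:)
    then show ?thesis
      by (simp add: funpow_add)
  qed
  show "norm ((?r ^^ nat h) x) = norm x" for h x
    by (cases x) (simp add: lens_rotation_power norm_Pair norm_mult)
  show "(?r ^^ nat h) x - (?r ^^ nat h) y = (?r ^^ nat h) (x - y)" for h x y
    by (cases x; cases y) (simp add: lens_rotation_power right_diff_distrib)
  show "h = \<one>\<^bsub>integer_mod_group p\<^esub>"
    if h: "h \<in> carrier (integer_mod_group p)" and x: "norm x = 1" and hx: "(?r ^^ nat h) x = x" for h x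
  proof -
    obtain z1 z2 where z: "x = (z1, z2)"
      by (cases x)
    have "p dvd nat h"
    proof (cases "z1 = 0")
      case True
      then have "z2 \<noteq> 0"
        using x by (auto simp: z)
      then have "cis (2 * pi * real (q * nat h) / real p) = 1"
        using hx by (simp add: z lens_rotation_power mult.assoc)
      then show ?thesis
        using cis_eq_1_imp_dvd[OF p] pq coprime_dvd_mult_right_iff by blast
    next
      case False
      then show ?thesis
        using hx cis_eq_1_imp_dvd[OF p, of "nat h"] by (simp add: z lens_rotation_power)
    qed
    moreover have "nat h < p" "0 \<le> h"
      using h by (auto simp: c)
    ultimately have "nat h = 0"
      using nat_dvd_not_less by blast
    then show ?thesis
      using \<open>0 \<le> h\<close> by simp
  qed
qed auto

lemma space_weight_S3_mod_Q8: "space_weight S3_mod_Q8 = weight quat_group"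
  unfolding S3_mod_Q8_def
proof (rule S3_orbit_space_weight[where act = quat_mult])
  show "finite (carrier quat_group)"
    by (simp add: Q8_def)
  show "norm (quat_mult h x) = norm x" if "h \<in> carrier quat_group" for h x
  proof -
    obtain a b where x: "x = (a, b)"
      by (cases x)
    have "h \<in> Q8"
      using that by simp
    from Q8_cases[OF this] show ?thesis
      by (elim disjE) (simp_all add: x quat_mult_def norm_Pair norm_mult add.commute)
  qed
  show "quat_mult h x - quat_mult h y = quat_mult h (x - y)" for h x y
    by (cases h; cases x; cases y) (simp add: quat_mult_def algebra_simps)
  show "h = \<one>\<^bsub>quat_group\<^esub>" if x: "norm x = 1" and hx: "quat_mult h x = x" for h x
  proof -
    obtain a b where ab: "x = (a, b)"
      by (cases x)
    have "(cmod a)\<^sup>2 + (cmod b)\<^sup>2 = 1"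
      using x by (simp add: ab norm_Pair real_sqrt_eq_1_iff)
    then have "a * cnj a + b * cnj b = 1"
      by (metis complex_norm_square of_real_1 of_real_add)
    then have inv: "quat_mult x (cnj a, - b) = (1, 0)"
      by (simp add: ab quat_mult_def)
    have "h = quat_mult h (quat_mult x (cnj a, - b))"
      by (simp add: inv)
    also have "\<dots> = quat_mult (quat_mult h x) (cnj a, - b)"
      by (simp only: quat_mult_assoc)
    also have "\<dots> = (1, 0)"
      by (simp add: hx inv)
    finally show ?thesis
      by simp
  qed
qed (simp_all add: group_quat_group quat_mult_assoc)

section \<open>Manifolds with infinite fundamental group\<close>

lemma simply_connected_S2_line: "simply_connected (sphere (0 :: real ^ 3) 1 \<times> (UNIV :: real set))"
  by (intro simply_connected_Times simply_connected_sphere convex_imp_simply_connected) simp_all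

lemma S2_nonempty: "sphere (0 :: real ^ 3) 1 \<noteq> {}"
  by simp

lemma dist_Pair_ge: "\<bar>s - t\<bar> \<le> dist (x, s) (y, t :: real)"
  using dist_snd_le[of "(x, s)" "(y, t)"] by (simp add: dist_real_def)

lemma space_weight_S2_twisted_S1: "space_weight S2_twisted_S1 = weight integer_group"
proof -
  let ?act = "\<lambda>(k::int) (x :: real ^ 3, t :: real). (if even k then x else - x, t + of_int k)"
  have "space_weight (orbit_space (top_of_set (sphere 0 1 \<times> UNIV)) (?act ` carrier integer_group)) = weight integer_group"
  proof (rule orbit_space_weight)
    show "dist (?act h x) (?act h y) = dist x y" for h x y
      by (cases x; cases y) (simp add: dist_Pair_Pair dist_minus)
    show "\<exists>d>0. \<forall>h\<in>carrier integer_group - {\<one>\<^bsub>integer_group\<^esub>}. d \<le> dist x (?act h x)" for x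
    proof (intro exI[of _ 1] conjI ballI)
      fix h
      assume "h \<in> carrier integer_group - {\<one>\<^bsub>integer_group\<^esub>}"
      then have "1 \<le> \<bar>real_of_int h\<bar>"
        by simp
      then show "1 \<le> dist x (?act h x)"
        using dist_Pair_ge[of "snd x" "snd (?act h x)" "fst x" "fst (?act h x)"] by (cases x) simp
    qed simp
    show "sphere (0 :: real ^ 3) 1 \<times> (UNIV :: real set) \<noteq> {}"
      using S2_nonempty by blast
  qed (auto simp: simply_connected_S2_line)
  moreover have "prod_topology S2 euclideanreal = top_of_set (sphere 0 1 \<times> UNIV)"
    using prod_topology_subtopology_eu[of "sphere 0 1" UNIV] by (simp add: S2_def)
  ultimately show ?thesis
    by (simp add: S2_twisted_S1_def)
qed

lemma circle_eq_iff: "cis (2 * pi * s) = cis (2 * pi * t) \<longleftrightarrow> (\<exists>k::int. t = s + of_int k)"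
proof -
  have "cis (2 * pi * s) = cis (2 * pi * t) \<longleftrightarrow> (\<exists>k::int. 2 * pi * t = 2 * pi * s + 2 * pi * of_int k)"
    unfolding sin_cos_eq_iff[symmetric] by (auto simp: complex_eq_iff)
  also have "\<dots> \<longleftrightarrow> (\<exists>k::int. t = s + of_int k)"
    by (simp add: distrib_left[symmetric])
  finally show ?thesis .
qed

lemma circle_surj: "range (\<lambda>t. cis (2 * pi * t)) = sphere 0 1"
proof
  show "sphere 0 1 \<subseteq> range (\<lambda>t. cis (2 * pi * t))"
  proof
    fix z :: complex
    assume "z \<in> sphere 0 1"
    then have "z \<noteq> 0" "cmod z = 1"
      by auto
    then have "z = cis (2 * pi * (Arg z / (2 * pi)))"
      using cis_Arg[of z] by (simp add: sgn_div_norm)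
    then show "z \<in> range (\<lambda>t. cis (2 * pi * t))"
      by blast
  qed
qed auto

lemma continuous_map_circle: "continuous_map euclideanreal S1 (\<lambda>t. cis (2 * pi * t))"
proof -
  have "continuous_on UNIV (\<lambda>t::real. cis (2 * pi * t))"
    unfolding cis_conv_exp by (intro continuous_intros)
  then show ?thesis
    by (auto simp: S1_def continuous_map_in_subtopology)
qed

text \<open>
  Over the unit circle, the covering \<open>exp\<close> of the punctured plane is \<open>t \<mapsto> cis (2 * pi * t)\<close>, and coverings
  are open.
\<close>

lemma open_map_circle: "open_map euclideanreal S1 (\<lambda>t. cis (2 * pi * t))"
  unfolding open_map_def
proof (intro allI impI)
  fix U
  assume "openin euclideanreal U"
  then have U: "open U"
    by simp
  let ?V = "{z. Im z / (2 * pi) \<in> U}"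
  have "open ?V"
    using open_vimage[OF U, of "\<lambda>z. Im z / (2 * pi)"] by (simp add: vimage_def continuous_intros)
  then have "openin (top_of_set (- {0})) (exp ` ?V)"
    using covering_space_open_map[OF covering_space_exp_punctured_plane, of ?V] by simp
  then have "open (exp ` ?V)"
    using openin_open_trans by blast
  moreover have "(\<lambda>t. cis (2 * pi * t)) ` U = sphere 0 1 \<inter> exp ` ?V"
  proof
    show "(\<lambda>t. cis (2 * pi * t)) ` U \<subseteq> sphere 0 1 \<inter> exp ` ?V"
    proof
      fix w
      assume "w \<in> (\<lambda>t. cis (2 * pi * t)) ` U"
      then obtain t where t: "t \<in> U" "w = cis (2 * pi * t)"
        by blast
      have "\<i> * of_real (2 * pi * t) \<in> ?V"
        using t(1) by simp
      moreover have "w = exp (\<i> * of_real (2 * pi * t))"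
        by (simp add: t(2) cis_conv_exp)
      ultimately show "w \<in> sphere 0 1 \<inter> exp ` ?V"
        using t(2) by auto
    qed
    show "sphere 0 1 \<inter> exp ` ?V \<subseteq> (\<lambda>t. cis (2 * pi * t)) ` U"
    proof
      fix w
      assume "w \<in> sphere 0 1 \<inter> exp ` ?V"
      then obtain z where z: "w = exp z" "Im z / (2 * pi) \<in> U" "norm (exp z) = 1"
        by auto
      then have "Re z = 0"
        by simp
      then have "z = \<i> * of_real (2 * pi * (Im z / (2 * pi)))"
        by (simp add: complex_eq_iff)
      then have "w = cis (2 * pi * (Im z / (2 * pi)))"
        unfolding z(1) cis_conv_exp by (rule arg_cong)
      then show "w \<in> (\<lambda>t. cis (2 * pi * t)) ` U"
        using z(2) by blast
    qed
  qed
  ultimately show "openin S1 ((\<lambda>t. cis (2 * pi * t)) ` U)"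
    by (simp add: S1_def openin_open_Int)
qed

lemma open_map_Times:
  assumes f: "open_map X X' f" and g: "open_map Y Y' g"
  shows "open_map (prod_topology X Y) (prod_topology X' Y') (\<lambda>(x, y). (f x, g y))"
  unfolding open_map_def
proof (intro allI impI)
  fix W
  assume W: "openin (prod_topology X Y) W"
  show "openin (prod_topology X' Y') ((\<lambda>(x, y). (f x, g y)) ` W)"
    unfolding openin_prod_topology_alt
  proof (intro allI impI)
    fix a b
    assume "(a, b) \<in> (\<lambda>(x, y). (f x, g y)) ` W"
    then obtain x y where xy: "(x, y) \<in> W" "a = f x" "b = g y"
      by auto
    have "\<exists>U V. openin X U \<and> openin Y V \<and> x \<in> U \<and> y \<in> V \<and> U \<times> V \<subseteq> W"
      using W[unfolded openin_prod_topology_alt, rule_format, OF xy(1)] .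
    then obtain U V where UV: "openin X U" "openin Y V" "x \<in> U" "y \<in> V" "U \<times> V \<subseteq> W"
      by (elim exE conjE)
    have "openin X' (f ` U)" "openin Y' (g ` V)"
      using f g UV by (auto simp: open_map_def)
    moreover have "f ` U \<times> g ` V \<subseteq> (\<lambda>(x, y). (f x, g y)) ` W"
      using UV(5) by fastforce
    ultimately show "\<exists>U V. openin X' U \<and> openin Y' V \<and> a \<in> U \<and> b \<in> V \<and> U \<times> V \<subseteq> (\<lambda>(x, y). (f x, g y)) ` W"
      using UV(3,4) xy(2,3) by (intro exI[of _ "f ` U"] exI[of _ "g ` V"]) auto
  qed
qed

lemma integer_diff_less_1:
  assumes "t = s + real_of_int k" "\<bar>s - t\<bar> < 1"
  shows "k = 0"
proof -
  have "\<bar>real_of_int k\<bar> < 1"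
    using assms by simp
  then show ?thesis
    by linarith
qed

lemma space_weight_S2_S1: "space_weight (prod_topology S2 S1) = weight integer_group"
proof -
  let ?E = "top_of_set (sphere 0 1 \<times> UNIV) :: ((real ^ 3) \<times> real) topology"
  let ?p = "\<lambda>(x :: real ^ 3, t :: real). (x, cis (2 * pi * t))"
  let ?act = "\<lambda>(k::int) (x :: real ^ 3, t :: real). (x, t + of_int k)"
  have E: "?E = prod_topology S2 euclideanreal"
    using prod_topology_subtopology_eu[of "sphere 0 1" UNIV, symmetric] by (simp only: S2_def subtopology_UNIV)
  have "deck_covering ?E (prod_topology S2 S1) ?p integer_group ?act"
  proof (rule deck_covering.intro)
    show "continuous_map ?E ?E (?act h)" for h
      by (auto simp: case_prod_unfold intro!: continuous_intros)
    have "continuous_map ?E S2 fst" "continuous_map ?E euclideanreal snd"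
      unfolding E by (simp_all add: continuous_map_fst continuous_map_snd)
    then have "continuous_map ?E (prod_topology S2 S1) (\<lambda>z. (fst z, ((\<lambda>t. cis (2 * pi * t)) \<circ> snd) z))"
      using continuous_map_compose[OF _ continuous_map_circle] by (intro continuous_map_pairedI)
    then show "continuous_map ?E (prod_topology S2 S1) ?p"
      by (simp add: case_prod_unfold o_def)
    have "open_map S2 S2 (\<lambda>x. x)"
      by (simp add: open_map_def)
    from open_map_Times[OF this open_map_circle] show "open_map ?E (prod_topology S2 S1) ?p"
      by (simp only: E)
    have "?p ` (sphere 0 1 \<times> UNIV) = sphere 0 1 \<times> range (\<lambda>t. cis (2 * pi * t))"
      by force
    then show "?p ` topspace ?E = topspace (prod_topology S2 S1)"
      by (simp add: circle_surj S2_def S1_def)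
    show "?p x = ?p y \<longleftrightarrow> (\<exists>h\<in>carrier integer_group. y = ?act h x)" for x y
      by (cases x; cases y) (auto simp: circle_eq_iff)
    fix x
    assume x: "x \<in> topspace ?E"
    let ?U = "(sphere 0 1 \<times> UNIV) \<inter> ball x (1 / 2)"
    have "inj_on ?p ?U"
    proof (rule inj_onI)
      fix y z
      assume y: "y \<in> ?U" and z: "z \<in> ?U" and eq: "?p y = ?p z"
      obtain k :: int where k: "fst z = fst y" "snd z = snd y + of_int k"
        using eq by (cases y; cases z) (auto simp: circle_eq_iff)
      have "\<bar>snd y - snd z\<bar> \<le> dist y z"
        using dist_snd_le[of y z] by (simp add: dist_real_def)
      also have "\<dots> < 1"
        using y z dist_triangle_half_r[of x y 1 z] by (simp add: dist_commute)
      finally have "k = 0"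
        using integer_diff_less_1[OF k(2)] by simp
      then show "y = z"
        using k by (simp add: prod_eq_iff)
    qed
    then show "\<exists>U. openin ?E U \<and> x \<in> U \<and> inj_on ?p U"
      using x by (intro exI[of _ ?U]) (auto simp: openin_open_Int)
  qed (auto simp: case_prod_unfold)
  then interpret universal_deck_covering ?E "prod_topology S2 S1" ?p integer_group ?act
    by (rule universal_deck_coveringI[OF _ simply_connected_S2_line])
  show ?thesis
    by (rule space_weight_eq) (use S2_nonempty in \<open>auto simp: S2_def S1_def\<close>)
qed

lemma space_weight_torus: "space_weight (prod_topology S1 (prod_topology S1 S1)) = weight lattice3"
proof -
  let ?E = "euclidean :: (real \<times> real \<times> real) topology" and ?B = "prod_topology S1 (prod_topology S1 S1)"
  let ?c = "\<lambda>t::real. cis (2 * pi * t)"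
  let ?p = "\<lambda>(r, s, t). (?c r, ?c s, ?c t)"
  let ?act = "\<lambda>(i::int, j::int, k::int) (r::real, s::real, t::real). (r + of_int i, s + of_int j, t + of_int k)"
  have E: "?E = prod_topology euclideanreal (prod_topology euclideanreal euclideanreal)"
    by simp
  have "deck_covering (top_of_set UNIV) ?B ?p lattice3 ?act"
    unfolding subtopology_UNIV
  proof (rule deck_covering.intro)
    show "group lattice3"
      by (rule group_lattice3)
    show "continuous_map ?E ?E (?act h)" for h
      by (cases h) (auto simp: case_prod_unfold intro!: continuous_intros)
    have circ: "continuous_map ?E S1 (\<lambda>z. ?c (f z))" if "continuous_on UNIV f" for f :: "real \<times> real \<times> real \<Rightarrow> real"
      using continuous_map_compose[OF _ continuous_map_circle, of ?E f] that by (simp add: o_def)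
    have "continuous_map ?E ?B (\<lambda>z. (?c (fst z), ?c (fst (snd z)), ?c (snd (snd z))))"
      by (intro continuous_map_pairedI circ continuous_intros)
    then show "continuous_map ?E ?B ?p"
      by (simp add: case_prod_unfold)
    have "(\<lambda>(x, y). (?c x, (\<lambda>(x, y). (?c x, ?c y)) y)) = ?p"
      by (auto simp: fun_eq_iff)
    then show "open_map ?E ?B ?p"
      using open_map_Times[OF open_map_circle open_map_Times[OF open_map_circle open_map_circle]]
      by (simp only: E)
    have "?p ` UNIV = range ?c \<times> range ?c \<times> range ?c"
      by (auto simp: image_iff)
    then show "?p ` topspace ?E = topspace ?B"
      by (simp add: circle_surj S1_def)
    show "?p x = ?p y \<longleftrightarrow> (\<exists>h\<in>carrier lattice3. y = ?act h x)" for x y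
      by (cases x; cases y) (auto simp: circle_eq_iff)
    fix x :: "real \<times> real \<times> real"
    let ?U = "ball x (1 / 2)"
    have "inj_on ?p ?U"
    proof (rule inj_onI)
      fix y z
      assume y: "y \<in> ?U" and z: "z \<in> ?U" and eq: "?p y = ?p z"
      obtain i j k :: int where k: "fst z = fst y + of_int i" "fst (snd z) = fst (snd y) + of_int j"
          "snd (snd z) = snd (snd y) + of_int k"
        using eq by (cases y; cases z) (auto simp: circle_eq_iff)
      have d: "dist y z < 1"
        using y z dist_triangle_half_r[of x y 1 z] by (simp add: dist_commute)
      have "dist (fst y) (fst z) < 1"
        using dist_fst_le[of y z] d by linarith
      moreover have "dist (snd y) (snd z) < 1"
        using dist_snd_le[of y z] d by linarith
      then have "dist (fst (snd y)) (fst (snd z)) < 1" "dist (snd (snd y)) (snd (snd z)) < 1"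
        using dist_fst_le[of "snd y" "snd z"] dist_snd_le[of "snd y" "snd z"] by linarith+
      ultimately have "i = 0" "j = 0" "k = 0"
        using integer_diff_less_1[OF k(1)] integer_diff_less_1[OF k(2)] integer_diff_less_1[OF k(3)]
        by (simp_all add: dist_real_def)
      then show "y = z"
        using k by (simp add: prod_eq_iff)
    qed
    then show "\<exists>U. openin ?E U \<and> x \<in> U \<and> inj_on ?p U"
      by (intro exI[of _ ?U]) auto
  qed (auto simp: zero_prod_def)
  then interpret universal_deck_covering "top_of_set UNIV" ?B ?p lattice3 ?act
    by (rule universal_deck_coveringI) (simp add: convex_imp_simply_connected)
  show ?thesis
    by (rule space_weight_eq) (auto simp: S1_def)
qed

theorem lemma1p3:
  shows "space_weight RP3 = 8 \<and>
         space_weight (prod_topology S2 S1) = 8 \<and>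
         space_weight S2_twisted_S1 = 8 \<and>
         space_weight (lens_space 3 1) = 12 \<and>
         (\<forall>q. 1 \<le> q \<and> q \<le> 2 \<longrightarrow> space_weight (lens_space 5 q) = 16) \<and>
         space_weight S3_mod_Q8 = 18 \<and>
         space_weight (prod_topology S1 (prod_topology S1 S1)) = 24"
proof (intro conjI allI impI)
  show "space_weight RP3 = 8"
    using weight_cyclic[of 2] by (simp add: space_weight_RP3)
  show "space_weight (prod_topology S2 S1) = 8" "space_weight S2_twisted_S1 = 8"
    by (simp_all add: space_weight_S2_S1 space_weight_S2_twisted_S1 weight_integer_group)
  show "space_weight (lens_space 3 1) = 12"
    using weight_cyclic[of 3] by (simp add: space_weight_lens_space)
  show "space_weight (lens_space 5 q) = 16" if "1 \<le> q \<and> q \<le> 2" for q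
  proof -
    have "q = 1 \<or> q = 2"
      using that by linarith
    then have "coprime 5 q"
      by (auto simp: coprime_right_2_iff_odd)
    then show ?thesis
      by (simp add: space_weight_lens_space weight_five)
  qed
  show "space_weight S3_mod_Q8 = 18"
    by (simp add: space_weight_S3_mod_Q8 weight_quat_group)
  show "space_weight (prod_topology S1 (prod_topology S1 S1)) = 24"
    by (simp add: space_weight_torus weight_lattice3)
qed

end
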